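(* Let $R$ be a commutative noetherian ring with characteristic $m>0$. Let $\{E^{i,j}_r\}_{r,i,j}$ be a convergent multiplicative spectral sequence of $R$-algebras concentrated in the half plane $i+j\ge0$. Assume that for some $r_0\ge1$: (i) $E_{r_0}^{*,*}$ is a finitely generated module over its graded center (grading by total degree), (ii) $E_{r_0}^{*,*}$ is a noetherian $R$-algebra, and (iii) the spectral sequence $\{E_r^{i,j}\}_{r,i,j}$ collapses at some page $r_1\ge r_0$. Then $E_\infty^{*,*}$ is a noetherian $R$-algebra. Additionally, let $\{\widetilde E^{i,j}_r\}_{r,i,j}$ be a convergent spectral sequence that is a differential bigraded module over $\{E^{i,j}_r\}_{r,i,j}$. Suppose that for the same value $r_0$, $\widetilde E_{r_0}^{*,*}$ is finitely generated over $E_{r_0}^{*,*}$. Then $\widetilde E_\infty^{*,*}$ is finitely generated over $E_\infty^{*,*}$.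
   Context: A spectral sequence of $R$-algebras is multiplicative if each page $E_r^{*,*}$ is a bigraded $R$-algebra, each differential $d_r$ is a derivation with the usual sign with respect to total degree $i+j$, and the product on $E_{r+1}$ is induced by that on $E_r$. It is said to collapse at page $r_1$ if $E_{r_1}=E_{r_1+1}=\cdots=E_\infty$. $\{\widetilde E_r\}$ is a differential bigraded module over $\{E_r\}$ if each $\widetilde E_r^{*,*}$ is a bigraded $E_r^{*,*}$-module whose differential satisfies the Leibniz rule with respect to $d_r$, and the module structure on $\widetilde E_{r+1}$ is induced by that on $\widetilde E_r$. The graded center of a page is the span of the homogeneous elements $c$ with $cx=(-1)^{|c||x|}xc$ for all homogeneous $x$, where $|\cdot|$ is the total degree.
   Formalization: "Noetherian R-algebra" is taken, in hypothesis (ii) and in the conclusion, to mean a left and right noetherian ring that is also finitely generated as an R-algebra; for merely noetherian rings the claim fails (a derivation on a field F_p(t_1,t_2,...) gives a counterexample). *)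

theory Defs
  imports
    "HOL-Algebra.Module"
    "HOL-Algebra.QuotRing"
    "HOL-Algebra.Ring_Divisibility"
begin

section \<open>Algebras, modules and finiteness conditions\<close>

definition has_char :: "'r ring \<Rightarrow> nat \<Rightarrow> bool" where
  "has_char R m \<longleftrightarrow> (\<forall>n::nat. [n] \<cdot>\<^bsub>R\<^esub> \<one>\<^bsub>R\<^esub> = \<zero>\<^bsub>R\<^esub> \<longleftrightarrow> m dvd n)"

text \<open>Unital associative algebras; unlike for the library locale \<open>algebra\<close>, the product need not
  be commutative.  The record type \<open>('r, 'a) module\<close> carries both the ring operations and the
  scalar multiplication.\<close>

locale assoc_algebra = module R A + ring A
  for R :: "'r ring" and A :: "('r, 'a) module" +
  assumes smult_mult_left:
      "\<lbrakk>a \<in> carrier R; x \<in> carrier A; y \<in> carrier A\<rbrakk> \<Longrightarrow>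
        (a \<odot>\<^bsub>A\<^esub> x) \<otimes>\<^bsub>A\<^esub> y = a \<odot>\<^bsub>A\<^esub> (x \<otimes>\<^bsub>A\<^esub> y)"
    and smult_mult_right:
      "\<lbrakk>a \<in> carrier R; x \<in> carrier A; y \<in> carrier A\<rbrakk> \<Longrightarrow>
        x \<otimes>\<^bsub>A\<^esub> (a \<odot>\<^bsub>A\<^esub> y) = a \<odot>\<^bsub>A\<^esub> (x \<otimes>\<^bsub>A\<^esub> y)"

text \<open>In the record of a module \<open>M\<close> the fields \<open>mult\<close> and \<open>one\<close> are not used.\<close>

locale left_module = A: assoc_algebra R A + M: module R M
  for R :: "'r ring" and A :: "('r, 'a) module"
    and act :: "'a \<Rightarrow> 'b \<Rightarrow> 'b" and M :: "('r, 'b) module" +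
  assumes act_closed: "\<lbrakk>x \<in> carrier A; u \<in> carrier M\<rbrakk> \<Longrightarrow> act x u \<in> carrier M"
    and act_add_left: "\<lbrakk>x \<in> carrier A; y \<in> carrier A; u \<in> carrier M\<rbrakk> \<Longrightarrow>
        act (x \<oplus>\<^bsub>A\<^esub> y) u = act x u \<oplus>\<^bsub>M\<^esub> act y u"
    and act_add_right: "\<lbrakk>x \<in> carrier A; u \<in> carrier M; v \<in> carrier M\<rbrakk> \<Longrightarrow>
        act x (u \<oplus>\<^bsub>M\<^esub> v) = act x u \<oplus>\<^bsub>M\<^esub> act x v"
    and act_mult: "\<lbrakk>x \<in> carrier A; y \<in> carrier A; u \<in> carrier M\<rbrakk> \<Longrightarrow>
        act (x \<otimes>\<^bsub>A\<^esub> y) u = act x (act y u)"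
    and act_one: "u \<in> carrier M \<Longrightarrow> act \<one>\<^bsub>A\<^esub> u = u"
    and act_smult_left: "\<lbrakk>a \<in> carrier R; x \<in> carrier A; u \<in> carrier M\<rbrakk> \<Longrightarrow>
        act (a \<odot>\<^bsub>A\<^esub> x) u = a \<odot>\<^bsub>M\<^esub> act x u"
    and act_smult_right: "\<lbrakk>a \<in> carrier R; x \<in> carrier A; u \<in> carrier M\<rbrakk> \<Longrightarrow>
        act x (a \<odot>\<^bsub>M\<^esub> u) = a \<odot>\<^bsub>M\<^esub> act x u"

text \<open>\<open>C\<close> is the set of scalars, acting on \<open>M\<close> through \<open>act\<close>.  Instances: \<open>R\<close>-submodules,
  left and right ideals, submodules over a (graded) center, submodules of a left module.\<close>

definition stable_subgroup ::
    "'c set \<Rightarrow> ('c \<Rightarrow> 'b \<Rightarrow> 'b) \<Rightarrow> ('r, 'b) module \<Rightarrow> 'b set \<Rightarrow> bool" where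
  "stable_subgroup C act M N \<longleftrightarrow>
     additive_subgroup N M \<and> (\<forall>c\<in>C. \<forall>u\<in>N. act c u \<in> N)"

definition generated ::
    "'c set \<Rightarrow> ('c \<Rightarrow> 'b \<Rightarrow> 'b) \<Rightarrow> ('r, 'b) module \<Rightarrow> 'b set \<Rightarrow> 'b set" where
  "generated C act M S = \<Inter>{N. stable_subgroup C act M N \<and> S \<subseteq> N}"

definition finitely_generated ::
    "'c set \<Rightarrow> ('c \<Rightarrow> 'b \<Rightarrow> 'b) \<Rightarrow> ('r, 'b) module \<Rightarrow> 'b set \<Rightarrow> bool" where
  "finitely_generated C act M N \<longleftrightarrow> (\<exists>S\<subseteq>N. finite S \<and> N = generated C act M S)"

definition left_noetherian :: "('r, 'a) module \<Rightarrow> bool" where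
  "left_noetherian A \<longleftrightarrow>
     (\<forall>I. stable_subgroup (carrier A) (\<lambda>x y. x \<otimes>\<^bsub>A\<^esub> y) A I \<longrightarrow>
          finitely_generated (carrier A) (\<lambda>x y. x \<otimes>\<^bsub>A\<^esub> y) A I)"

definition right_noetherian :: "('r, 'a) module \<Rightarrow> bool" where
  "right_noetherian A \<longleftrightarrow>
     (\<forall>I. stable_subgroup (carrier A) (\<lambda>x y. y \<otimes>\<^bsub>A\<^esub> x) A I \<longrightarrow>
          finitely_generated (carrier A) (\<lambda>x y. y \<otimes>\<^bsub>A\<^esub> x) A I)"

definition finitely_generated_algebra :: "'r ring \<Rightarrow> ('r, 'a) module \<Rightarrow> bool" where
  "finitely_generated_algebra R A \<longleftrightarrow>
     (\<exists>S\<subseteq>carrier A. finite S \<and>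
        carrier A = \<Inter>{B. submodule B R A \<and> \<one>\<^bsub>A\<^esub> \<in> B \<and>
                        (\<forall>x\<in>B. \<forall>y\<in>B. x \<otimes>\<^bsub>A\<^esub> y \<in> B) \<and> S \<subseteq> B})"

text \<open>A noetherian \<open>R\<close>-algebra is an \<open>R\<close>-algebra of finite type that is a (two-sided) noetherian
  ring.  Finite type over the noetherian base ring \<open>R\<close> is part of the notion: for noetherian rings
  that happen to be \<open>R\<close>-algebras, noetherianity does not pass from \<open>E\<^sub>r\<close> to \<open>E\<^sub>r\<^sub>+\<^sub>1\<close>.  For example
  let \<open>R\<close> be the field with \<open>p\<close> elements, let \<open>k = R(t\<^sub>1, t\<^sub>2, \<dots>)\<close> sit in bidegree \<open>(0, 0)\<close> and
  let \<open>V = k\<^sup>2\<close>, with \<open>V\<cdot>V = 0\<close>, sit in bidegree \<open>(r, 1 - r)\<close>.  Let \<open>D\<close> be the derivation of \<open>k\<close>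
  with \<open>D t\<^sub>i = t\<^sub>i\<^sub>+\<^sub>1\<close>; \<open>k\<close> has infinite dimension over \<open>K = ker D\<close>.  For the differential
  \<open>d\<^sub>r a = (D a, 0)\<close> the next page is \<open>K \<oplus> V / d\<^sub>r k\<close>, and \<open>V / d\<^sub>r k\<close> is a square-zero ideal of
  infinite dimension over \<open>K\<close>.\<close>

definition noetherian_algebra :: "'r ring \<Rightarrow> ('r, 'a) module \<Rightarrow> bool" where
  "noetherian_algebra R A \<longleftrightarrow>
     assoc_algebra R A \<and> finitely_generated_algebra R A \<and> left_noetherian A \<and> right_noetherian A"

definition finitely_generated_over ::
    "'r ring \<Rightarrow> ('r, 'a) module \<Rightarrow> ('a \<Rightarrow> 'b \<Rightarrow> 'b) \<Rightarrow> ('r, 'b) module \<Rightarrow> bool" where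
  "finitely_generated_over R A act M \<longleftrightarrow>
     left_module R A act M \<and> finitely_generated (carrier A) act M (carrier M)"

definition linear_map :: "'r ring \<Rightarrow> ('r, 'a) module \<Rightarrow> ('r, 'b) module \<Rightarrow> ('a \<Rightarrow> 'b) \<Rightarrow> bool" where
  "linear_map R M N f \<longleftrightarrow>
     f \<in> carrier M \<rightarrow> carrier N \<and>
     (\<forall>x\<in>carrier M. \<forall>y\<in>carrier M. f (x \<oplus>\<^bsub>M\<^esub> y) = f x \<oplus>\<^bsub>N\<^esub> f y) \<and>
     (\<forall>a\<in>carrier R. \<forall>x\<in>carrier M. f (a \<odot>\<^bsub>M\<^esub> x) = a \<odot>\<^bsub>N\<^esub> f x)"

definition linear_iso :: "'r ring \<Rightarrow> ('r, 'a) module \<Rightarrow> ('r, 'b) module \<Rightarrow> ('a \<Rightarrow> 'b) \<Rightarrow> bool" where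
  "linear_iso R M N f \<longleftrightarrow> linear_map R M N f \<and> bij_betw f (carrier M) (carrier N)"

text \<open>The subquotient \<open>Z / B\<close> of \<open>A\<close>, its elements being cosets of \<open>B\<close>.  If \<open>Z\<close> is a subalgebra
  and \<open>B\<close> an ideal of \<open>Z\<close>, it is an algebra.  The same construction serves for modules, where
  the fields \<open>mult\<close> and \<open>one\<close> are again irrelevant.\<close>

definition subquotient :: "('r, 'a) module \<Rightarrow> 'a set \<Rightarrow> 'a set \<Rightarrow> ('r, 'a set) module" where
  "subquotient A Z B =
     \<lparr>carrier = (\<lambda>x. B +>\<^bsub>A\<^esub> x) ` Z,
      mult = rcoset_mult A B,
      one = B +>\<^bsub>A\<^esub> \<one>\<^bsub>A\<^esub>,
      zero = B,
      add = set_add A,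
      smult = (\<lambda>a X. \<Union>x\<in>X. B +>\<^bsub>A\<^esub> (a \<odot>\<^bsub>A\<^esub> x))\<rparr>"


section \<open>Gradings\<close>

definition graded_module :: "'r ring \<Rightarrow> ('r, 'a) module \<Rightarrow> ('i \<Rightarrow> 'a set) \<Rightarrow> bool" where
  "graded_module R M G \<longleftrightarrow>
     module R M \<and> (\<forall>k. submodule (G k) R M) \<and>
     (\<forall>x\<in>carrier M. \<exists>!f. (\<forall>k. f k \<in> G k) \<and> finite {k. f k \<noteq> \<zero>\<^bsub>M\<^esub>} \<and>
                          x = finsum M f {k. f k \<noteq> \<zero>\<^bsub>M\<^esub>})"

definition bigraded_algebra :: "'r ring \<Rightarrow> ('r, 'a) module \<Rightarrow> (int \<times> int \<Rightarrow> 'a set) \<Rightarrow> bool" where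
  "bigraded_algebra R A G \<longleftrightarrow>
     assoc_algebra R A \<and> graded_module R A G \<and> \<one>\<^bsub>A\<^esub> \<in> G (0, 0) \<and>
     (\<forall>i j k l. \<forall>x\<in>G (i, j). \<forall>y\<in>G (k, l). x \<otimes>\<^bsub>A\<^esub> y \<in> G (i + k, j + l))"

definition linear_span :: "'r ring \<Rightarrow> ('r, 'a) module \<Rightarrow> 'a set \<Rightarrow> 'a set" where
  "linear_span R M S = generated (carrier R) (\<lambda>a x. a \<odot>\<^bsub>M\<^esub> x) M S"

definition total_degree_part ::
    "'r ring \<Rightarrow> ('r, 'a) module \<Rightarrow> (int \<times> int \<Rightarrow> 'a set) \<Rightarrow> int \<Rightarrow> 'a set" where
  "total_degree_part R A G n = linear_span R A (\<Union>i. G (i, n - i))"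

definition signed :: "('r, 'a) module \<Rightarrow> int \<Rightarrow> 'a \<Rightarrow> 'a" where
  "signed M n x = (if even n then x else \<ominus>\<^bsub>M\<^esub> x)"

definition graded_center ::
    "'r ring \<Rightarrow> ('r, 'a) module \<Rightarrow> (int \<times> int \<Rightarrow> 'a set) \<Rightarrow> 'a set" where
  "graded_center R A G =
     linear_span R A
       {c. \<exists>n. c \<in> total_degree_part R A G n \<and>
               (\<forall>k. \<forall>x\<in>total_degree_part R A G k. c \<otimes>\<^bsub>A\<^esub> x = signed A (n * k) (x \<otimes>\<^bsub>A\<^esub> c))}"


section \<open>Spectral sequences\<close>

text \<open>Pages are indexed by \<open>r \<ge> 1\<close>; the value of the fields at \<open>0\<close> is irrelevant.
  \<open>Page E r\<close> is the total object of the \<open>r\<close>-th page, \<open>Piece E r (i, j)\<close> its component of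
  bidegree \<open>(i, j)\<close>, and \<open>Ident E r\<close> identifies the homology of the \<open>r\<close>-th page with the next
  page.  All pages live in one type \<open>'a\<close>; this is no restriction, as each page is a subquotient
  of the first one.\<close>

record ('r, 'a) spectral_seq =
  Page :: "nat \<Rightarrow> ('r, 'a) module"
  Piece :: "nat \<Rightarrow> int \<times> int \<Rightarrow> 'a set"
  Diff :: "nat \<Rightarrow> 'a \<Rightarrow> 'a"
  Ident :: "nat \<Rightarrow> 'a set \<Rightarrow> 'a"

definition Cycles :: "('r, 'a) spectral_seq \<Rightarrow> nat \<Rightarrow> 'a set" where
  "Cycles E r = {x \<in> carrier (Page E r). Diff E r x = \<zero>\<^bsub>Page E r\<^esub>}"

definition Boundaries :: "('r, 'a) spectral_seq \<Rightarrow> nat \<Rightarrow> 'a set" where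
  "Boundaries E r = Diff E r ` carrier (Page E r)"

definition hclass :: "('r, 'a) spectral_seq \<Rightarrow> nat \<Rightarrow> 'a \<Rightarrow> 'a set" where
  "hclass E r x = Boundaries E r +>\<^bsub>Page E r\<^esub> x"

definition Homology :: "('r, 'a) spectral_seq \<Rightarrow> nat \<Rightarrow> ('r, 'a set) module" where
  "Homology E r = subquotient (Page E r) (Cycles E r) (Boundaries E r)"

locale spectral_sequence =
  fixes R :: "'r ring" and E :: "('r, 'a) spectral_seq"
  assumes page_graded: "r \<ge> 1 \<Longrightarrow> graded_module R (Page E r) (Piece E r)"
    and diff_linear: "r \<ge> 1 \<Longrightarrow> linear_map R (Page E r) (Page E r) (Diff E r)"
    and diff_bidegree: "\<lbrakk>r \<ge> 1; x \<in> Piece E r (i, j)\<rbrakk> \<Longrightarrow>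
          Diff E r x \<in> Piece E r (i + int r, j - int r + 1)"
    and diff_diff: "\<lbrakk>r \<ge> 1; x \<in> carrier (Page E r)\<rbrakk> \<Longrightarrow>
          Diff E r (Diff E r x) = \<zero>\<^bsub>Page E r\<^esub>"
    and ident_iso: "r \<ge> 1 \<Longrightarrow> linear_iso R (Homology E r) (Page E (Suc r)) (Ident E r)"
    and ident_bidegree: "r \<ge> 1 \<Longrightarrow>
          Ident E r ` hclass E r ` (Cycles E r \<inter> Piece E r k) = Piece E (Suc r) k"

locale multiplicative_spectral_sequence = spectral_sequence R E
  for R :: "'r ring" and E :: "('r, 'a) spectral_seq" +
  assumes page_algebra: "r \<ge> 1 \<Longrightarrow> bigraded_algebra R (Page E r) (Piece E r)"
    and diff_derivation:
      "\<lbrakk>r \<ge> 1; x \<in> Piece E r (i, j); y \<in> carrier (Page E r)\<rbrakk> \<Longrightarrow>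
        Diff E r (x \<otimes>\<^bsub>Page E r\<^esub> y) =
          Diff E r x \<otimes>\<^bsub>Page E r\<^esub> y \<oplus>\<^bsub>Page E r\<^esub>
          signed (Page E r) (i + j) (x \<otimes>\<^bsub>Page E r\<^esub> Diff E r y)"
    and ident_one: "r \<ge> 1 \<Longrightarrow> Ident E r (hclass E r \<one>\<^bsub>Page E r\<^esub>) = \<one>\<^bsub>Page E (Suc r)\<^esub>"
    and ident_mult:
      "\<lbrakk>r \<ge> 1; x \<in> Cycles E r; y \<in> Cycles E r\<rbrakk> \<Longrightarrow>
        Ident E r (hclass E r (x \<otimes>\<^bsub>Page E r\<^esub> y)) =
          Ident E r (hclass E r x) \<otimes>\<^bsub>Page E (Suc r)\<^esub> Ident E r (hclass E r y)"

locale module_spectral_sequence =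
  E: multiplicative_spectral_sequence R E + M: spectral_sequence R M
  for R :: "'r ring" and E :: "('r, 'a) spectral_seq"
    and act :: "nat \<Rightarrow> 'a \<Rightarrow> 'b \<Rightarrow> 'b" and M :: "('r, 'b) spectral_seq" +
  assumes page_module: "r \<ge> 1 \<Longrightarrow> left_module R (Page E r) (act r) (Page M r)"
    and act_bidegree:
      "\<lbrakk>r \<ge> 1; x \<in> Piece E r (i, j); u \<in> Piece M r (k, l)\<rbrakk> \<Longrightarrow>
        act r x u \<in> Piece M r (i + k, j + l)"
    and diff_leibniz:
      "\<lbrakk>r \<ge> 1; x \<in> Piece E r (i, j); u \<in> carrier (Page M r)\<rbrakk> \<Longrightarrow>
        Diff M r (act r x u) =
          act r (Diff E r x) u \<oplus>\<^bsub>Page M r\<^esub> signed (Page M r) (i + j) (act r x (Diff M r u))"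
    and ident_act:
      "\<lbrakk>r \<ge> 1; x \<in> Cycles E r; u \<in> Cycles M r\<rbrakk> \<Longrightarrow>
        Ident M r (hclass M r (act r x u)) =
          act (Suc r) (Ident E r (hclass E r x)) (Ident M r (hclass M r u))"

definition in_half_plane :: "('r, 'a) spectral_seq \<Rightarrow> bool" where
  "in_half_plane E \<longleftrightarrow>
     (\<forall>r\<ge>1. \<forall>i j. i + j < 0 \<longrightarrow> Piece E r (i, j) = {\<zero>\<^bsub>Page E r\<^esub>})"


section \<open>The limit page\<close>

text \<open>As usual, the pages are viewed as subquotients of the first page:
  \<open>E\<^sub>r = Z\<^sub>r / B\<^sub>r\<close> with \<open>B\<^sub>1 \<subseteq> B\<^sub>2 \<subseteq> \<dots> \<subseteq> Z\<^sub>2 \<subseteq> Z\<^sub>1 = E\<^sub>1\<close>, and \<open>E\<^sub>\<infinity> = (\<Inter>r. Z\<^sub>r) / (\<Union>r. B\<^sub>r)\<close>.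
  An element \<open>x\<close> of \<open>E\<^sub>1\<close> lies in \<open>Z\<^sub>r\<close> if it survives to page \<open>r\<close>; then \<open>Rep E r x\<close> is the element
  of \<open>Page E r\<close> it represents.  For other \<open>x\<close>, \<open>Rep E r x\<close> is meaningless.\<close>

primrec Rep :: "('r, 'a) spectral_seq \<Rightarrow> nat \<Rightarrow> 'a \<Rightarrow> 'a" where
  "Rep E 0 x = x"
| "Rep E (Suc r) x = (if r = 0 then x else Ident E r (hclass E r (Rep E r x)))"

definition Zsub :: "('r, 'a) spectral_seq \<Rightarrow> nat \<Rightarrow> 'a set" where
  "Zsub E r = {x \<in> carrier (Page E 1). \<forall>s. 1 \<le> s \<and> s < r \<longrightarrow> Rep E s x \<in> Cycles E s}"

definition Bsub :: "('r, 'a) spectral_seq \<Rightarrow> nat \<Rightarrow> 'a set" where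
  "Bsub E r = {x \<in> Zsub E r. Rep E r x = \<zero>\<^bsub>Page E r\<^esub>}"

definition Zinf :: "('r, 'a) spectral_seq \<Rightarrow> 'a set" where
  "Zinf E = (\<Inter>r\<in>{1..}. Zsub E r)"

definition Binf :: "('r, 'a) spectral_seq \<Rightarrow> 'a set" where
  "Binf E = (\<Union>r\<in>{1..}. Bsub E r)"

definition subpage :: "('r, 'a) spectral_seq \<Rightarrow> nat \<Rightarrow> ('r, 'a set) module" where
  "subpage E r = subquotient (Page E 1) (Zsub E r) (Bsub E r)"

definition Einf :: "('r, 'a) spectral_seq \<Rightarrow> ('r, 'a set) module" where
  "Einf E = subquotient (Page E 1) (Zinf E) (Binf E)"

definition Einf_piece :: "('r, 'a) spectral_seq \<Rightarrow> int \<times> int \<Rightarrow> 'a set set" where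
  "Einf_piece E k = (\<lambda>x. Binf E +>\<^bsub>Page E 1\<^esub> x) ` (Zinf E \<inter> Piece E 1 k)"

definition inf_act ::
    "('a \<Rightarrow> 'b \<Rightarrow> 'b) \<Rightarrow> ('r, 'b) spectral_seq \<Rightarrow> 'a set \<Rightarrow> 'b set \<Rightarrow> 'b set" where
  "inf_act act1 M X U = (\<Union>x\<in>X. \<Union>u\<in>U. Binf M +>\<^bsub>Page M 1\<^esub> act1 x u)"

definition collapses_at :: "('r, 'a) spectral_seq \<Rightarrow> nat \<Rightarrow> bool" where
  "collapses_at E r\<^sub>1 \<longleftrightarrow>
     (\<forall>r\<ge>r\<^sub>1. subpage E r = subpage E r\<^sub>1) \<and> Einf E = subpage E r\<^sub>1"


section \<open>Convergence\<close>

text \<open>A graded module \<open>H\<^sup>*\<close> with a decreasing filtration; \<open>Fil H p n\<close> is the \<open>p\<close>-th filtration step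
  of the component \<open>Deg H n\<close> of degree \<open>n\<close>.\<close>

record ('r, 'h) abutment =
  Tot :: "('r, 'h) module"
  Deg :: "int \<Rightarrow> 'h set"
  Fil :: "int \<Rightarrow> int \<Rightarrow> 'h set"

locale converges_to = spectral_sequence R E
  for R :: "'r ring" and E :: "('r, 'a) spectral_seq"
    and H :: "('r, 'h) abutment" and gr_iso :: "int \<times> int \<Rightarrow> 'h set \<Rightarrow> 'a set" +
  assumes abut_graded: "graded_module R (Tot H) (Deg H)"
    and fil_submodule: "submodule (Fil H p n) R (Tot H)"
    and fil_decreasing: "Fil H (p + 1) n \<subseteq> Fil H p n"
    and fil_exhaustive: "(\<Union>p. Fil H p n) = Deg H n"
    and fil_separated: "(\<Inter>p. Fil H p n) = {\<zero>\<^bsub>Tot H\<^esub>}"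
    and gr_iso: "linear_iso R
          (subquotient (Tot H) (Fil H p (p + q)) (Fil H (p + 1) (p + q)))
          ((Einf E)\<lparr>carrier := Einf_piece E (p, q)\<rparr>)
          (gr_iso (p, q))"

text \<open>Here \<open>H\<^sup>*\<close> is a graded algebra, the filtration is multiplicative, and \<open>E\<^sub>\<infinity>\<close> is the associated
  graded algebra.\<close>

locale converges_multiplicatively_to =
  multiplicative_spectral_sequence R E + converges_to R E H gr_iso
  for R :: "'r ring" and E :: "('r, 'a) spectral_seq"
    and H :: "('r, 'h) abutment" and gr_iso :: "int \<times> int \<Rightarrow> 'h set \<Rightarrow> 'a set" +
  assumes abut_algebra: "assoc_algebra R (Tot H)"
    and fil_one: "\<one>\<^bsub>Tot H\<^esub> \<in> Fil H 0 0"
    and fil_mult: "\<lbrakk>x \<in> Fil H p n; y \<in> Fil H q m\<rbrakk> \<Longrightarrow> x \<otimes>\<^bsub>Tot H\<^esub> y \<in> Fil H (p + q) (n + m)"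
    and gr_iso_one: "gr_iso (0, 0) (Fil H 1 0 +>\<^bsub>Tot H\<^esub> \<one>\<^bsub>Tot H\<^esub>) = \<one>\<^bsub>Einf E\<^esub>"
    and gr_iso_mult:
      "\<lbrakk>x \<in> Fil H p (p + q); y \<in> Fil H p' (p' + q')\<rbrakk> \<Longrightarrow>
        gr_iso (p + p', q + q')
          (Fil H (p + p' + 1) (p + p' + (q + q')) +>\<^bsub>Tot H\<^esub> (x \<otimes>\<^bsub>Tot H\<^esub> y)) =
        gr_iso (p, q) (Fil H (p + 1) (p + q) +>\<^bsub>Tot H\<^esub> x) \<otimes>\<^bsub>Einf E\<^esub>
        gr_iso (p', q') (Fil H (p' + 1) (p' + q') +>\<^bsub>Tot H\<^esub> y)"

end

theory Submission
  imports Defs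
begin

text \<open>Write \<open>A = E\<^sub>r\<close> with \<open>r = r\<^sub>0\<close>.  It is of finite type over \<open>R\<close> and finite over its graded center.
The argument of Artin and Tate shows that finitely many homogeneous elements \<open>c\<close> of the graded
center suffice as coefficients: \<open>A\<close> is finite over the \<open>R\<close>-subalgebra that they generate
(\<open>finite_over_homogeneous_central\<close>).  It is then also finite over the subalgebra generated by the
squares \<open>c\<^sup>2\<close>.  These have even degree and commute with everything without sign
(\<open>finite_over_even_central\<close>), so that \<open>A\<close> is finite over a commutative algebra \<open>R[S]\<close>, where \<open>S\<close> is a
finite set of central elements of even degree.

If \<open>s \<in> S\<close>, then \<open>d\<^sub>r (s\<^sup>m) = m s\<^sup>m\<^sup>-\<^sup>1 d\<^sub>r s = 0\<close>, because \<open>m = 0\<close> in \<open>R\<close>.  The page is still finite over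
\<open>R[s\<^sup>m | s \<in> S]\<close>, and \<open>d\<^sub>r\<close> is linear over this ring.  By Hilbert's basis theorem the cycles are a
finite module over it, and so is their quotient \<open>E\<^sub>r\<^sub>+\<^sub>1\<close>.  The classes of the \<open>s\<^sup>m\<close> are again central of even
degree, and the argument can be repeated (\<open>fg_next_page\<close>).  It applies verbatim to the pages of a
module spectral sequence \<open>M\<close> that is finite over \<open>A\<close>.

After finitely many steps the page \<open>E\<^sub>r\<close> with \<open>r = r\<^sub>1\<close> is reached, which is \<open>E\<^sub>\<infinity>\<close>.  Being finite over a
central subalgebra \<open>R[S]\<close> of finite type, it is a noetherian algebra
(\<open>noetherian_algebra_if_finite_over_central\<close>).  The module \<open>M\<close> may still have nonzero differentials from
this page on.  But now \<open>S\<close> consists of permanent cycles, hence the image of \<open>\<Inter>s. Z\<^sub>s M\<close> in the noetherian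
\<open>R[S]\<close>-module \<open>M\<^sub>r\<close> is a submodule, thus finite, and \<open>M\<^sub>\<infinity>\<close> is a quotient of it (\<open>fg_limit\<close>).

The ring \<open>R[S]\<close> itself is never formed.  Instead, modules over it are regarded as abelian groups with a set of
operators, namely the multiplications by elements of \<open>R\<close> and of \<open>S\<close>.  Hilbert's basis theorem then is a
statement about the adjunction of one operator that commutes with the others (\<open>hilbert_basis\<close>), and
passing from \<open>s\<close> to \<open>s\<^sup>m\<close> means replacing an operator by a power of it.  Moreover, \<open>E\<close> is a module spectral
sequence over itself, so that finiteness has to be carried from page to page for modules only.\<close>

section \<open>Abelian groups with operators\<close>

abbreviation op_stable :: "('b \<Rightarrow> 'b) set \<Rightarrow> ('r, 'b) module \<Rightarrow> 'b set \<Rightarrow> bool" where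
  "op_stable \<Omega> M N \<equiv> stable_subgroup \<Omega> (\<lambda>f. f) M N"

abbreviation op_span :: "('b \<Rightarrow> 'b) set \<Rightarrow> ('r, 'b) module \<Rightarrow> 'b set \<Rightarrow> 'b set" where
  "op_span \<Omega> M S \<equiv> generated \<Omega> (\<lambda>f. f) M S"

abbreviation op_fg :: "('b \<Rightarrow> 'b) set \<Rightarrow> ('r, 'b) module \<Rightarrow> 'b set \<Rightarrow> bool" where
  "op_fg \<Omega> M N \<equiv> finitely_generated \<Omega> (\<lambda>f. f) M N"

lemma generated_minimal:
  "\<lbrakk>stable_subgroup C act M N; S \<subseteq> N\<rbrakk> \<Longrightarrow> generated C act M S \<subseteq> N"
  unfolding generated_def by blast

lemma generated_superset: "S \<subseteq> generated C act M S"
  unfolding generated_def by blast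

lemma stable_subset: "stable_subgroup C act M N \<Longrightarrow> N \<subseteq> carrier M"
  by (simp add: stable_subgroup_def additive_subgroup.a_subset)

lemma stable_zero: "stable_subgroup C act M N \<Longrightarrow> \<zero>\<^bsub>M\<^esub> \<in> N"
  by (simp add: stable_subgroup_def additive_subgroup.zero_closed)

lemma stable_add: "\<lbrakk>stable_subgroup C act M N; x \<in> N; y \<in> N\<rbrakk> \<Longrightarrow> x \<oplus>\<^bsub>M\<^esub> y \<in> N"
  by (simp add: stable_subgroup_def additive_subgroup.a_closed)

lemma stable_uminus:
  "\<lbrakk>stable_subgroup C act M N; abelian_group M; x \<in> N\<rbrakk> \<Longrightarrow> \<ominus>\<^bsub>M\<^esub> x \<in> N"
  by (simp add: stable_subgroup_def additive_subgroup.a_inv_closed)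

lemma stable_minus:
  "\<lbrakk>stable_subgroup C act M N; abelian_group M; x \<in> N; y \<in> N\<rbrakk> \<Longrightarrow> x \<ominus>\<^bsub>M\<^esub> y \<in> N"
  by (simp add: a_minus_def stable_add stable_uminus)

lemma stable_act: "\<lbrakk>stable_subgroup C act M N; c \<in> C; x \<in> N\<rbrakk> \<Longrightarrow> act c x \<in> N"
  by (simp add: stable_subgroup_def)

lemma (in abelian_group) additive_subgroupI':
  assumes "H \<subseteq> carrier G" "\<zero> \<in> H" "\<And>x y. \<lbrakk>x \<in> H; y \<in> H\<rbrakk> \<Longrightarrow> x \<oplus> y \<in> H"
    "\<And>x. x \<in> H \<Longrightarrow> \<ominus> x \<in> H"
  shows "additive_subgroup H G"
  using assms by (intro additive_subgroupI add.subgroupI) auto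

lemma stable_subgroupI:
  assumes "abelian_group M" "N \<subseteq> carrier M" "\<zero>\<^bsub>M\<^esub> \<in> N"
    "\<And>x y. \<lbrakk>x \<in> N; y \<in> N\<rbrakk> \<Longrightarrow> x \<oplus>\<^bsub>M\<^esub> y \<in> N" "\<And>x. x \<in> N \<Longrightarrow> \<ominus>\<^bsub>M\<^esub> x \<in> N"
    "\<And>c x. \<lbrakk>c \<in> C; x \<in> N\<rbrakk> \<Longrightarrow> act c x \<in> N"
  shows "stable_subgroup C act M N"
  using assms unfolding stable_subgroup_def
  by (intro conjI abelian_group.additive_subgroupI') auto

lemma stable_subgroup_antimono:
  "\<lbrakk>stable_subgroup C act M N; C' \<subseteq> C\<rbrakk> \<Longrightarrow> stable_subgroup C' act M N"
  unfolding stable_subgroup_def by blast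

lemma generated_mono: "C' \<subseteq> C \<Longrightarrow> S' \<subseteq> S \<Longrightarrow> generated C' act M S' \<subseteq> generated C act M S"
  unfolding generated_def using stable_subgroup_antimono by blast

lemma generated_stable:
  assumes M: "abelian_group M" and S: "S \<subseteq> carrier M"
    and cl: "\<And>c x. \<lbrakk>c \<in> C; x \<in> carrier M\<rbrakk> \<Longrightarrow> act c x \<in> carrier M"
  shows "stable_subgroup C act M (generated C act M S)"
proof -
  interpret abelian_group M by fact
  have "stable_subgroup C act M (carrier M)"
    using cl M by (intro stable_subgroupI) auto
  then show ?thesis
    using S M unfolding generated_def
    by (intro stable_subgroupI)
      (blast intro: stable_zero stable_add stable_uminus stable_act)+
qed

locale operator_group = abelian_group M for M :: "('r, 'b) module" (structure) +
  fixes \<Omega> :: "('b \<Rightarrow> 'b) set"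
  assumes op_closed: "\<lbrakk>f \<in> \<Omega>; x \<in> carrier M\<rbrakk> \<Longrightarrow> f x \<in> carrier M"
    and op_add: "\<lbrakk>f \<in> \<Omega>; x \<in> carrier M; y \<in> carrier M\<rbrakk> \<Longrightarrow> f (x \<oplus> y) = f x \<oplus> f y"
begin

lemma is_group: "abelian_group M" ..

lemma op_zero: "f \<in> \<Omega> \<Longrightarrow> f \<zero> = \<zero>"
  using op_add[of f \<zero> \<zero>] op_closed[of f \<zero>] by (simp add: add.l_cancel_one)

lemma op_uminus: "\<lbrakk>f \<in> \<Omega>; x \<in> carrier M\<rbrakk> \<Longrightarrow> f (\<ominus> x) = \<ominus> f x"
  using op_add[of f "\<ominus> x" x] op_closed by (simp add: l_neg op_zero minus_equality)

lemma span_stable: "S \<subseteq> carrier M \<Longrightarrow> op_stable \<Omega> M (op_span \<Omega> M S)"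
  by (intro generated_stable is_group) (auto intro: op_closed)

lemma span_closed: "S \<subseteq> carrier M \<Longrightarrow> op_span \<Omega> M S \<subseteq> carrier M"
  using span_stable stable_subset by blast

lemma mono_operators: "\<Omega>' \<subseteq> \<Omega> \<Longrightarrow> operator_group M \<Omega>'"
  by unfold_locales (auto intro: op_closed op_add)

text \<open>If \<open>F\<close> generates the module with the operator \<open>s\<close>, then with \<open>s\<^sup>k\<close> in its place the elements \<open>s\<^sup>i f\<close> with \<open>i < k\<close> and \<open>f \<in> F\<close>
generate it.  Commutation up to sign is allowed because multiplications by elements of odd degree will be
replaced by their squares.\<close>

lemma fg_replace_by_power:
  assumes s: "s \<in> \<Omega>" and t: "\<And>x. x \<in> carrier M \<Longrightarrow> t x = (s ^^ k) x" and k: "k > 0"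
    and comm: "\<And>f x. \<lbrakk>f \<in> \<Omega>'; x \<in> carrier M\<rbrakk> \<Longrightarrow> s (f x) = f (s x) \<or> s (f x) = \<ominus> f (s x)"
    and \<Omega>: "\<Omega> = insert s \<Omega>'"
    and fg: "op_fg \<Omega> M (carrier M)"
  shows "op_fg (insert t \<Omega>') M (carrier M)"
proof -
  obtain F where F: "F \<subseteq> carrier M" "finite F" "carrier M = op_span \<Omega> M F"
    using fg unfolding finitely_generated_def by auto
  define F' where "F' = (\<Union>i<k. (s ^^ i) ` F)"
  define N where "N = op_span (insert t \<Omega>') M F'"
  have pow: "(s ^^ i) x \<in> carrier M" if "x \<in> carrier M" for i x
    using that s by (induction i) (auto intro: op_closed)
  have F': "F' \<subseteq> carrier M" unfolding F'_def using F(1) pow by auto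
  have N: "op_stable (insert t \<Omega>') M N"
    unfolding N_def using F' is_group
    by (intro generated_stable) (auto simp: t pow \<Omega> intro: op_closed)
  note Nc = stable_subset[OF N]
  \<comment> \<open>It suffices that \<open>N\<close> is stable under \<open>s\<close>.  This can be tested on the generators \<open>F\'\<close>.\<close>
  have "op_stable (insert t \<Omega>') M {x \<in> N. s x \<in> N}"
  proof (rule stable_subgroupI[OF is_group])
    fix f x assume f: "f \<in> insert t \<Omega>'" and "x \<in> {x \<in> N. s x \<in> N}"
    then have x: "x \<in> N" "s x \<in> N" by auto
    have "s (f x) \<in> N"
    proof (cases "f \<in> \<Omega>'")
      case True
      then show ?thesis
        using comm[OF True subsetD[OF Nc x(1)]] stable_act[OF N, of f "s x"] x(2)
          stable_uminus[OF N is_group, of "f (s x)"] by auto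
    next
      case False
      then have f: "f = t" using f by simp
      have "s (t x) = t (s x)"
        using x Nc s op_closed t by (simp add: subset_iff funpow_swap1)
      then show ?thesis using f x stable_act[OF N, of t "s x"] by auto
    qed
    then show "f x \<in> {x \<in> N. s x \<in> N}" using stable_act[OF N f x(1)] by blast
  qed (use Nc s in \<open>auto simp: op_zero op_add op_uminus subset_iff
          intro: stable_zero[OF N] stable_add[OF N] stable_uminus[OF N is_group]\<close>)
  moreover have "F' \<subseteq> {x \<in> N. s x \<in> N}"
  proof
    fix x assume "x \<in> F'"
    then obtain i y where x: "i < k" "y \<in> F" "x = (s ^^ i) y" unfolding F'_def by auto
    have sup: "F' \<subseteq> N" unfolding N_def by (rule generated_superset)
    have "s x \<in> N"
    proof (cases "Suc i < k")
      case True
      then have "s x \<in> F'" unfolding F'_def x(3) using x(2) by (auto intro!: bexI[of _ "Suc i"])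
      then show ?thesis using sup by blast
    next
      case False
      then have "s x = t y" using t[of y] x F(1) k
        by (metis Suc_lessI comp_apply funpow.simps(2) subset_iff)
      moreover have "y \<in> F'" unfolding F'_def using x k by (auto intro!: bexI[of _ 0])
      ultimately show ?thesis using stable_act[OF N, of t y] sup by auto
    qed
    then show "x \<in> {x \<in> N. s x \<in> N}" using \<open>x \<in> F'\<close> sup by blast
  qed
  ultimately have "N \<subseteq> {x \<in> N. s x \<in> N}" unfolding N_def by (rule generated_minimal)
  then have "op_stable \<Omega> M N"
    using N unfolding stable_subgroup_def \<Omega> by auto
  moreover have "F \<subseteq> N"
    using generated_superset[of F' "insert t \<Omega>'" "\<lambda>f. f" M] k unfolding N_def F'_def by force
  ultimately have "carrier M \<subseteq> N" unfolding F(3) by (rule generated_minimal)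
  then have "N = carrier M" using Nc by blast
  moreover have "finite F'" unfolding F'_def using F(2) by auto
  ultimately show ?thesis
    unfolding finitely_generated_def using F' N_def by blast
qed

end

lemma fg_replace_by_powers:
  assumes "finite S" "k > 0" "operator_group M (\<Omega> \<union> g ` S)"
    and "\<And>s f x. \<lbrakk>s \<in> S; f \<in> \<Omega> \<union> g ` S; x \<in> carrier M\<rbrakk>
            \<Longrightarrow> g s (f x) = f (g s x) \<or> g s (f x) = \<ominus>\<^bsub>M\<^esub> f (g s x)"
    and "\<And>s x. \<lbrakk>s \<in> S; x \<in> carrier M\<rbrakk> \<Longrightarrow> h s x = (g s ^^ k) x"
    and "op_fg (\<Omega> \<union> g ` S) M (carrier M)"
  shows "op_fg (\<Omega> \<union> h ` S) M (carrier M)"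
  using assms
proof (induction S arbitrary: \<Omega> rule: finite_induct)
  case (insert s S)
  interpret operator_group M "\<Omega> \<union> g ` insert s S" by fact
  have hs: "h s x = (g s ^^ k) x" if "x \<in> carrier M" for x
    using insert.prems(4) that by blast
  have pow: "(g s ^^ i) x \<in> carrier M" if "x \<in> carrier M" for i x
    using that by (induction i) (auto intro: op_closed)
  have pow_add: "(g s ^^ i) (x \<oplus>\<^bsub>M\<^esub> y) = (g s ^^ i) x \<oplus>\<^bsub>M\<^esub> (g s ^^ i) y"
    if "x \<in> carrier M" "y \<in> carrier M" for i x y
    using that pow by (induction i) (auto simp: op_add)
  have pow_um: "(g s ^^ i) (\<ominus>\<^bsub>M\<^esub> x) = \<ominus>\<^bsub>M\<^esub> ((g s ^^ i) x)" if "x \<in> carrier M" for i x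
    using that pow by (induction i) (auto simp: op_uminus)
  have "op_fg (insert (h s) (\<Omega> \<union> g ` S)) M (carrier M)"
    by (rule fg_replace_by_power[of "g s" _ k])
      (use insert.prems hs in auto)
  then have fg: "op_fg (insert (h s) \<Omega> \<union> g ` S) M (carrier M)" by simp
  have og: "operator_group M (insert (h s) \<Omega> \<union> g ` S)"
    by unfold_locales (auto simp: hs pow pow_add op_add intro: op_closed)
  have comm_pow: "g t ((g s ^^ i) x) = (g s ^^ i) (g t x) \<or> g t ((g s ^^ i) x) = \<ominus>\<^bsub>M\<^esub> ((g s ^^ i) (g t x))"
    if "t \<in> S" "x \<in> carrier M" for t i x
  proof (induction i)
    case (Suc i)
    have "g t (g s ((g s ^^ i) x)) = g s (g t ((g s ^^ i) x)) \<or>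
        g t (g s ((g s ^^ i) x)) = \<ominus>\<^bsub>M\<^esub> g s (g t ((g s ^^ i) x))"
      using insert.prems(3)[of t "g s" "(g s ^^ i) x"] that pow by auto
    then show ?case
      using Suc that pow[of "g t x" i] op_closed[of "g t" x] op_uminus[of "g s" "(g s ^^ i) (g t x)"]
        op_closed[of "g s" "(g s ^^ i) (g t x)"]
      by auto
  qed simp
  have "op_fg (insert (h s) \<Omega> \<union> h ` S) M (carrier M)"
  proof (rule insert.IH)
    fix t f x assume a: "t \<in> S" "f \<in> insert (h s) \<Omega> \<union> g ` S" "x \<in> carrier M"
    show "g t (f x) = f (g t x) \<or> g t (f x) = \<ominus>\<^bsub>M\<^esub> f (g t x)"
    proof (cases "f = h s")
      case True
      then show ?thesis using comm_pow[OF a(1,3), of k] a op_closed[of "g t" x] by (simp add: hs)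
    next
      case False
      then show ?thesis using insert.prems(3)[of t f x] a by auto
    qed
  qed (use insert.prems fg og in auto)
  then show ?case by simp
qed simp

section \<open>Hilbert's basis theorem\<close>

text \<open>These identities serve to cancel the leading term of an element of \<open>N\<close> against that of an element of a
subgroup \<open>N' \<subseteq> N\<close>.\<close>

lemma (in abelian_group) split_difference:
  assumes "a \<in> carrier G" "x \<in> carrier G" "y \<in> carrier G"
  shows "a \<oplus> x = (a \<oplus> y) \<oplus> (x \<ominus> y)" "x \<ominus> y = (a \<oplus> x) \<ominus> (a \<oplus> y)"
proof -
  show *: "a \<oplus> x = (a \<oplus> y) \<oplus> (x \<ominus> y)"
    using assms by (simp add: a_assoc a_minus_def a_comm[of x] r_neg2)
  have "(w \<oplus> d) \<ominus> w = d" if "w \<in> carrier G" "d \<in> carrier G" for w d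
    using that by (simp add: minus_eq a_assoc a_comm[of w d] r_neg)
  then show "x \<ominus> y = (a \<oplus> x) \<ominus> (a \<oplus> y)"
    using assms unfolding * by simp
qed

lemma stable_chain_union:
  fixes A :: "nat \<Rightarrow> 'b set"
  assumes M: "abelian_group M" and A: "\<And>n. stable_subgroup C act M (A n)"
    and mono: "\<And>m n. m \<le> n \<Longrightarrow> A m \<subseteq> A n"
  shows "stable_subgroup C act M (\<Union>n. A n)"
proof (rule stable_subgroupI[OF M])
  show "(\<Union>n. A n) \<subseteq> carrier M" using stable_subset[OF A] by blast
  show "\<zero>\<^bsub>M\<^esub> \<in> (\<Union>n. A n)" using stable_zero[OF A] by blast
  fix x assume "x \<in> (\<Union>n. A n)"
  then obtain m where m: "x \<in> A m" by blast
  show "\<ominus>\<^bsub>M\<^esub> x \<in> (\<Union>n. A n)" using stable_uminus[OF A M m] by blast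
  { fix c assume "c \<in> C"
    then show "act c x \<in> (\<Union>n. A n)" using stable_act[OF A _ m] by blast }
  { fix y assume "y \<in> (\<Union>n. A n)"
    then obtain n where n: "y \<in> A n" by blast
    have "x \<oplus>\<^bsub>M\<^esub> y \<in> A (max m n)"
      using m n mono[of m "max m n"] mono[of n "max m n"] by (intro stable_add[OF A]) auto
    then show "x \<oplus>\<^bsub>M\<^esub> y \<in> (\<Union>n. A n)" by blast }
qed

definition noetherian_on :: "('b \<Rightarrow> 'b) set \<Rightarrow> ('r, 'b) module \<Rightarrow> 'b set \<Rightarrow> bool" where
  "noetherian_on \<Omega> M L \<longleftrightarrow> (\<forall>N\<subseteq>L. op_stable \<Omega> M N \<longrightarrow> op_fg \<Omega> M N)"

abbreviation smults :: "'r ring \<Rightarrow> ('r, 'b) module \<Rightarrow> ('b \<Rightarrow> 'b) set" where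
  "smults R M \<equiv> (\<lambda>a x. a \<odot>\<^bsub>M\<^esub> x) ` carrier R"

text \<open>The locale \<open>module\<close> leaves the record extensions of \<open>R\<close> and \<open>M\<close> open; here they are those for which
\<open>stable_subgroup\<close> is defined.\<close>

locale plain_module = module R M
  for R :: "'r ring" (structure) and M :: "('r, 'b) module"

lemma (in plain_module) smults_operator_group: "operator_group M (smults R M)"
  by unfold_locales (auto simp: smult_r_distr)

lemma (in plain_module) noetherian_on_zero: "noetherian_on (smults R M) M (op_span (smults R M) M {})"
proof -
  interpret operator_group M "smults R M" by (rule smults_operator_group)
  show ?thesis
    unfolding noetherian_on_def
  proof (intro allI impI)
    fix N assume N: "N \<subseteq> op_span (smults R M) M {}" "op_stable (smults R M) M N"
    have "op_span (smults R M) M {} \<subseteq> N" using N(2) by (rule generated_minimal) simp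
    then show "op_fg (smults R M) M N"
      using N(1) unfolding finitely_generated_def by (intro exI[of _ "{}"]) auto
  qed
qed

text \<open>Let \<open>K\<close> be the span of \<open>S\<close>.  A submodule \<open>N' \<subseteq> N\<close> of \<open>R x + K\<close> equals \<open>N\<close> if it contains \<open>N \<inter> K\<close> and the same elements
of \<open>R\<close> occur as coefficients of \<open>x\<close> in both.  These coefficients form an ideal, which is finitely generated like \<open>N \<inter> K\<close>.  An element may have several such
coefficients if \<open>R x \<inter> K\<close> is not zero, therefore all of them are collected.\<close>

lemma (in plain_module) noetherian_on_insert:
  assumes R: "noetherian_ring R" and S: "S \<subseteq> carrier M" and x: "x \<in> carrier M"
    and noeth: "noetherian_on (smults R M) M (op_span (smults R M) M S)"
  shows "noetherian_on (smults R M) M (op_span (smults R M) M (insert x S))"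
  unfolding noetherian_on_def
proof (intro allI impI)
  interpret operator_group M "smults R M" by (rule smults_operator_group)
  define K where "K = op_span (smults R M) M S"
  have K: "op_stable (smults R M) M K" unfolding K_def using span_stable[OF S] .
  note Kc = subsetD[OF stable_subset[OF K]]
  have Ksm: "a \<odot>\<^bsub>M\<^esub> k \<in> K" if "a \<in> carrier R" "k \<in> K" for a k
    using stable_act[OF K, of "\<lambda>x. a \<odot>\<^bsub>M\<^esub> x" k] that by auto
  fix N assume NL: "N \<subseteq> op_span (smults R M) M (insert x S)"
    and N: "op_stable (smults R M) M N"
  define coef where "coef N' = {a \<in> carrier R. \<exists>k\<in>K. a \<odot>\<^bsub>M\<^esub> x \<oplus>\<^bsub>M\<^esub> k \<in> N'}" for N'
  have L: "op_span (smults R M) M (insert x S) \<subseteq> {a \<odot>\<^bsub>M\<^esub> x \<oplus>\<^bsub>M\<^esub> k | a k. a \<in> carrier R \<and> k \<in> K}"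
    (is "_ \<subseteq> ?L")
  proof (rule generated_minimal)
    show "op_stable (smults R M) M ?L"
    proof (rule stable_subgroupI[OF is_group])
      show "?L \<subseteq> carrier M" using x Kc by auto
      show "\<zero>\<^bsub>M\<^esub> \<in> ?L" using x stable_zero[OF K] by (force intro!: exI[of _ \<zero>])
      fix u assume "u \<in> ?L"
      then obtain a k where u: "a \<in> carrier R" "k \<in> K" "u = a \<odot>\<^bsub>M\<^esub> x \<oplus>\<^bsub>M\<^esub> k" by blast
      have "\<ominus>\<^bsub>M\<^esub> u = (\<ominus> a) \<odot>\<^bsub>M\<^esub> x \<oplus>\<^bsub>M\<^esub> (\<ominus>\<^bsub>M\<^esub> k)"
        using u x Kc by (simp add: M.minus_add smult_l_minus)
      then show "\<ominus>\<^bsub>M\<^esub> u \<in> ?L" using u stable_uminus[OF K is_group] by blast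
      { fix v assume "v \<in> ?L"
        then obtain b l where v: "b \<in> carrier R" "l \<in> K" "v = b \<odot>\<^bsub>M\<^esub> x \<oplus>\<^bsub>M\<^esub> l" by blast
        have "u \<oplus>\<^bsub>M\<^esub> v = (a \<oplus> b) \<odot>\<^bsub>M\<^esub> x \<oplus>\<^bsub>M\<^esub> (k \<oplus>\<^bsub>M\<^esub> l)"
          using u v x Kc by (simp add: smult_l_distr M.a_ac)
        then show "u \<oplus>\<^bsub>M\<^esub> v \<in> ?L" using u v stable_add[OF K] by blast }
      { fix f assume "f \<in> smults R M"
        then obtain b where b: "b \<in> carrier R" "f = (\<lambda>x. b \<odot>\<^bsub>M\<^esub> x)" by blast
        have "f u = (b \<otimes> a) \<odot>\<^bsub>M\<^esub> x \<oplus>\<^bsub>M\<^esub> (b \<odot>\<^bsub>M\<^esub> k)"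
          using u b x Kc by (simp add: smult_r_distr smult_assoc1)
        then show "f u \<in> ?L" using u b Ksm by blast }
    qed
    show "insert x S \<subseteq> ?L"
    proof
      fix u assume "u \<in> insert x S"
      then consider "u = x" | "u \<in> S" by blast
      then show "u \<in> ?L"
      proof cases
        case 1
        then have "u = \<one> \<odot>\<^bsub>M\<^esub> x \<oplus>\<^bsub>M\<^esub> \<zero>\<^bsub>M\<^esub>" using x by simp
        then show ?thesis using stable_zero[OF K] by blast
      next
        case 2
        then have "u \<in> K" unfolding K_def by (rule subsetD[OF generated_superset])
        then have "u = \<zero> \<odot>\<^bsub>M\<^esub> x \<oplus>\<^bsub>M\<^esub> u" using x Kc by simp
        then show ?thesis using \<open>u \<in> K\<close> by blast
      qed
    qed
  qed
  have coef: "ideal (coef N') R" if N': "op_stable (smults R M) M N'" for N'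
  proof (rule idealI[OF R.ring_axioms])
    note N'c = subsetD[OF stable_subset[OF N']]
    have sm: "b \<otimes> a \<in> coef N'" if ab: "a \<in> coef N'" "b \<in> carrier R" for a b
    proof -
      obtain k where k: "a \<in> carrier R" "k \<in> K" "a \<odot>\<^bsub>M\<^esub> x \<oplus>\<^bsub>M\<^esub> k \<in> N'"
        using ab(1) unfolding coef_def by blast
      have "b \<odot>\<^bsub>M\<^esub> (a \<odot>\<^bsub>M\<^esub> x \<oplus>\<^bsub>M\<^esub> k) \<in> N'"
        using stable_act[OF N', of "\<lambda>x. b \<odot>\<^bsub>M\<^esub> x"] k that by auto
      then have "(b \<otimes> a) \<odot>\<^bsub>M\<^esub> x \<oplus>\<^bsub>M\<^esub> (b \<odot>\<^bsub>M\<^esub> k) \<in> N'"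
        using k that x Kc by (simp add: smult_r_distr smult_assoc1)
      then show ?thesis unfolding coef_def using k that Ksm by blast
    qed
    show "a \<otimes> b \<in> coef N'" "b \<otimes> a \<in> coef N'" if "a \<in> coef N'" "b \<in> carrier R" for a b
      using sm[OF that] that unfolding coef_def by (auto simp: R.m_comm)
    show "subgroup (coef N') (add_monoid R)"
    proof (rule R.add.subgroupI)
      show "coef N' \<subseteq> carrier R" unfolding coef_def by blast
      have "\<zero> \<in> coef N'"
        unfolding coef_def using stable_zero[OF N'] stable_zero[OF K] x by force
      then show "coef N' \<noteq> {}" by blast
      fix a assume a: "a \<in> coef N'"
      then obtain k where k: "a \<in> carrier R" "k \<in> K" "a \<odot>\<^bsub>M\<^esub> x \<oplus>\<^bsub>M\<^esub> k \<in> N'"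
        unfolding coef_def by blast
      show "\<ominus> a \<in> coef N'"
        using sm[OF a, of "\<ominus> \<one>"] k by (simp add: R.l_minus)
      fix b assume "b \<in> coef N'"
      then obtain l where l: "b \<in> carrier R" "l \<in> K" "b \<odot>\<^bsub>M\<^esub> x \<oplus>\<^bsub>M\<^esub> l \<in> N'"
        unfolding coef_def by blast
      have "(a \<oplus> b) \<odot>\<^bsub>M\<^esub> x \<oplus>\<^bsub>M\<^esub> (k \<oplus>\<^bsub>M\<^esub> l) = (a \<odot>\<^bsub>M\<^esub> x \<oplus>\<^bsub>M\<^esub> k) \<oplus>\<^bsub>M\<^esub> (b \<odot>\<^bsub>M\<^esub> x \<oplus>\<^bsub>M\<^esub> l)"
        using k l x Kc by (simp add: smult_l_distr M.a_ac)
      then show "a \<oplus> b \<in> coef N'"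
        unfolding coef_def using stable_add[OF N' k(3) l(3)] stable_add[OF K k(2) l(2)] k(1) l(1)
        by (auto intro!: bexI[of _ "k \<oplus>\<^bsub>M\<^esub> l"])
    qed
  qed
  \<comment> \<open>Generators of \<open>N\<close>: lifts of generators of the coefficient ideal, and generators of \<open>N \<inter> K\<close>.\<close>
  obtain A where A: "A \<subseteq> carrier R" "finite A" "coef N = Idl A"
    using noetherian_ring.finetely_gen[OF R coef[OF N]] by blast
  have "\<forall>a\<in>A. \<exists>k\<in>K. a \<odot>\<^bsub>M\<^esub> x \<oplus>\<^bsub>M\<^esub> k \<in> N"
    using R.genideal_self[OF A(1)] unfolding A(3)[symmetric] coef_def by blast
  then obtain k where k: "\<And>a. a \<in> A \<Longrightarrow> k a \<in> K \<and> a \<odot>\<^bsub>M\<^esub> x \<oplus>\<^bsub>M\<^esub> k a \<in> N" by metis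
  have "op_stable (smults R M) M (N \<inter> K)"
    using stable_subset[OF N] stable_zero[OF N] stable_zero[OF K]
    by (intro stable_subgroupI[OF is_group])
      (auto intro: stable_add[OF N] stable_add[OF K] stable_uminus[OF N is_group]
        stable_uminus[OF K is_group] Ksm stable_act[OF N])
  then have "op_fg (smults R M) M (N \<inter> K)"
    using noeth unfolding noetherian_on_def K_def by blast
  then obtain G where G: "G \<subseteq> N \<inter> K" "finite G" "N \<inter> K = op_span (smults R M) M G"
    unfolding finitely_generated_def by blast
  define F where "F = G \<union> (\<lambda>a. a \<odot>\<^bsub>M\<^esub> x \<oplus>\<^bsub>M\<^esub> k a) ` A"
  define N' where "N' = op_span (smults R M) M F"
  have F: "F \<subseteq> N" "finite F" unfolding F_def using G A k by auto
  have N': "op_stable (smults R M) M N'"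
    unfolding N'_def using F(1) stable_subset[OF N] by (intro span_stable) blast
  have FN': "F \<subseteq> N'" unfolding N'_def by (rule generated_superset)
  have "N' \<subseteq> N" unfolding N'_def using N F(1) by (rule generated_minimal)
  have NK: "N \<inter> K \<subseteq> N'"
    unfolding G(3) using FN' by (intro generated_minimal[OF N']) (auto simp: F_def)
  have "A \<subseteq> coef N'" unfolding coef_def using A(1) k FN' unfolding F_def by blast
  then have cN: "coef N \<subseteq> coef N'" unfolding A(3) using coef[OF N'] R.genideal_minimal by blast
  have "N \<subseteq> N'"
  proof
    fix n assume n: "n \<in> N"
    then obtain a l where al: "a \<in> carrier R" "l \<in> K" "n = a \<odot>\<^bsub>M\<^esub> x \<oplus>\<^bsub>M\<^esub> l" using NL L by blast
    then have "a \<in> coef N'" using cN n unfolding coef_def by blast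
    then obtain l' where l': "l' \<in> K" "a \<odot>\<^bsub>M\<^esub> x \<oplus>\<^bsub>M\<^esub> l' \<in> N'" unfolding coef_def by blast
    have eq: "n = (a \<odot>\<^bsub>M\<^esub> x \<oplus>\<^bsub>M\<^esub> l') \<oplus>\<^bsub>M\<^esub> (l \<ominus>\<^bsub>M\<^esub> l')"
      unfolding al(3) using al l' x Kc by (intro M.split_difference) auto
    have "l \<ominus>\<^bsub>M\<^esub> l' = n \<ominus>\<^bsub>M\<^esub> (a \<odot>\<^bsub>M\<^esub> x \<oplus>\<^bsub>M\<^esub> l')"
      unfolding al(3) using al l' x Kc by (intro M.split_difference) auto
    then have "l \<ominus>\<^bsub>M\<^esub> l' \<in> N \<inter> K"
      using stable_minus[OF K is_group al(2) l'(1)] stable_minus[OF N is_group n] l' \<open>N' \<subseteq> N\<close> by auto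
    then show "n \<in> N'" unfolding eq using stable_add[OF N' l'(2)] NK by blast
  qed
  then have "N = N'" using \<open>N' \<subseteq> N\<close> by blast
  then show "op_fg (smults R M) M N"
    unfolding finitely_generated_def N'_def using F by blast
qed

lemma (in plain_module) noetherian_on_finite_span:
  assumes "noetherian_ring R" "finite S" "S \<subseteq> carrier M"
  shows "noetherian_on (smults R M) M (op_span (smults R M) M S)"
  using assms(2,3)
  by (induction S rule: finite_induct)
    (auto intro: noetherian_on_zero noetherian_on_insert[OF assms(1)])

text \<open>The elements \<open>\<Sum>i<n. s\<^sup>i l\<^sub>i\<close> with \<open>l\<^sub>i \<in> L\<close>: polynomials in \<open>s\<close> of degree less than \<open>n\<close>.\<close>

primrec degree_below :: "('b \<Rightarrow> 'b) \<Rightarrow> ('r, 'b) module \<Rightarrow> 'b set \<Rightarrow> nat \<Rightarrow> 'b set" where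
  "degree_below s M L 0 = {\<zero>\<^bsub>M\<^esub>}"
| "degree_below s M L (Suc n) = {(s ^^ n) l \<oplus>\<^bsub>M\<^esub> y | l y. l \<in> L \<and> y \<in> degree_below s M L n}"

text \<open>The coefficients of \<open>s\<^sup>n\<close> in those elements of \<open>N\<close> that can be written as a polynomial of degree at most \<open>n\<close>.  As
this representation need not be unique, an element can contribute several leading coefficients.\<close>

definition leading ::
    "('b \<Rightarrow> 'b) \<Rightarrow> ('r, 'b) module \<Rightarrow> 'b set \<Rightarrow> 'b set \<Rightarrow> nat \<Rightarrow> 'b set" where
  "leading s M L N n = {l \<in> L. \<exists>y\<in>degree_below s M L n. (s ^^ n) l \<oplus>\<^bsub>M\<^esub> y \<in> N}"

locale adjoined_operator = operator_group M "insert s \<Omega>"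
  for M :: "('r, 'b) module" (structure) and s \<Omega> +
  fixes L :: "'b set"
  assumes commute: "\<lbrakk>f \<in> \<Omega>; x \<in> carrier M\<rbrakk> \<Longrightarrow> f (s x) = s (f x)"
    and L: "op_stable \<Omega> M L"
begin

abbreviation "Lt \<equiv> degree_below s M L"
abbreviation "lc \<equiv> leading s M L"

lemma L_closed: "l \<in> L \<Longrightarrow> l \<in> carrier M"
  using stable_subset[OF L] by blast

lemma pow_closed: "x \<in> carrier M \<Longrightarrow> (s ^^ n) x \<in> carrier M"
  by (induction n) (auto intro: op_closed)

lemma pow_add: "\<lbrakk>x \<in> carrier M; y \<in> carrier M\<rbrakk> \<Longrightarrow> (s ^^ n) (x \<oplus> y) = (s ^^ n) x \<oplus> (s ^^ n) y"
  by (induction n) (auto simp: op_add pow_closed)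

lemma pow_zero: "(s ^^ n) \<zero> = \<zero>"
  by (induction n) (auto simp: op_zero)

lemma pow_uminus: "x \<in> carrier M \<Longrightarrow> (s ^^ n) (\<ominus> x) = \<ominus> (s ^^ n) x"
  by (induction n) (auto simp: op_uminus pow_closed)

lemma pow_commute: "\<lbrakk>f \<in> \<Omega>; x \<in> carrier M\<rbrakk> \<Longrightarrow> f ((s ^^ n) x) = (s ^^ n) (f x)"
  by (induction n) (auto simp: commute pow_closed)

lemma combine:
  assumes "l \<in> carrier M" "y \<in> carrier M" "l' \<in> carrier M" "y' \<in> carrier M"
  shows "((s ^^ n) l \<oplus> y) \<oplus> ((s ^^ n) l' \<oplus> y') = (s ^^ n) (l \<oplus> l') \<oplus> (y \<oplus> y')"
    "\<ominus> ((s ^^ n) l \<oplus> y) = (s ^^ n) (\<ominus> l) \<oplus> (\<ominus> y)"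
  using assms by (simp_all add: pow_add pow_closed pow_uminus a_ac minus_add)

lemma combine_op:
  assumes "l \<in> carrier M" "y \<in> carrier M" "f \<in> \<Omega>"
  shows "f ((s ^^ n) l \<oplus> y) = (s ^^ n) (f l) \<oplus> f y"
  using assms by (simp add: op_add pow_closed pow_commute)

lemma Lt_SucI: "\<lbrakk>l \<in> L; y \<in> Lt n\<rbrakk> \<Longrightarrow> (s ^^ n) l \<oplus> y \<in> Lt (Suc n)"
  by auto

lemma Lt_stable: "op_stable \<Omega> M (Lt n)"
proof (induction n)
  case 0
  show ?case using is_group by (intro stable_subgroupI) (auto simp: op_zero)
next
  case (Suc n)
  note c = subsetD[OF stable_subset[OF Suc]]
  show ?case
  proof (rule stable_subgroupI[OF is_group])
    show "Lt (Suc n) \<subseteq> carrier M" using L_closed pow_closed c by auto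
    show "\<zero> \<in> Lt (Suc n)"
      using stable_zero[OF L] stable_zero[OF Suc]
      by (auto intro!: exI[of _ \<zero>] simp: pow_zero)
    fix x assume "x \<in> Lt (Suc n)"
    then obtain l y where x: "x = (s ^^ n) l \<oplus> y" "l \<in> L" "y \<in> Lt n" by auto
    show "\<ominus> x \<in> Lt (Suc n)"
      unfolding x(1) using x(2,3) combine(2)[of l y l y n] L_closed c
        Lt_SucI[OF stable_uminus[OF L is_group x(2)] stable_uminus[OF Suc is_group x(3)]] by metis
    { fix x' assume "x' \<in> Lt (Suc n)"
      then obtain l' y' where x': "x' = (s ^^ n) l' \<oplus> y'" "l' \<in> L" "y' \<in> Lt n" by auto
      show "x \<oplus> x' \<in> Lt (Suc n)"
        unfolding x(1) x'(1) using x(2,3) x'(2,3) combine(1)[of l y l' y' n] L_closed c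
          Lt_SucI[OF stable_add[OF L x(2) x'(2)] stable_add[OF Suc x(3) x'(3)]] by metis }
    { fix f assume f: "f \<in> \<Omega>"
      show "f x \<in> Lt (Suc n)"
        unfolding x(1) using x(2,3) combine_op[of l y f n] L_closed c f
          Lt_SucI[OF stable_act[OF L f x(2)] stable_act[OF Suc f x(3)]] by metis }
  qed
qed

lemma Lt_closed: "x \<in> Lt n \<Longrightarrow> x \<in> carrier M"
  using stable_subset[OF Lt_stable] by blast

lemma Lt_Suc: "Lt n \<subseteq> Lt (Suc n)"
proof
  fix x assume "x \<in> Lt n"
  moreover from this have "x = (s ^^ n) \<zero> \<oplus> x" using Lt_closed by (simp add: pow_zero)
  ultimately show "x \<in> Lt (Suc n)" using stable_zero[OF L] by auto
qed

lemma Lt_mono: "m \<le> n \<Longrightarrow> Lt m \<subseteq> Lt n"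
  by (rule lift_Suc_mono_le[of Lt, OF Lt_Suc])

lemma s_Lt: "x \<in> Lt n \<Longrightarrow> s x \<in> Lt (Suc n)"
proof (induction n arbitrary: x)
  case 0
  then show ?case using Lt_Suc[of 0] by (auto simp: op_zero)
next
  case (Suc n)
  then obtain l y where x: "x = (s ^^ n) l \<oplus> y" "l \<in> L" "y \<in> Lt n" by auto
  have "s x = (s ^^ Suc n) l \<oplus> s y"
    using x L_closed Lt_closed by (simp add: op_add pow_closed)
  then show ?case using x Suc.IH[of y] by auto
qed

lemma span_subset_Lt: "op_span (insert s \<Omega>) M L \<subseteq> (\<Union>n. Lt n)"
proof (rule generated_minimal)
  show "L \<subseteq> (\<Union>n. Lt n)"
  proof
    fix l assume l: "l \<in> L"
    then have "l = (s ^^ 0) l \<oplus> \<zero>" using L_closed by simp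
    then have "l \<in> Lt (Suc 0)" using l by auto
    then show "l \<in> (\<Union>n. Lt n)" by blast
  qed
  show "op_stable (insert s \<Omega>) M (\<Union>n. Lt n)"
  proof -
    have "op_stable \<Omega> M (\<Union>n. Lt n)"
      by (intro stable_chain_union is_group Lt_stable Lt_mono)
    then show ?thesis unfolding stable_subgroup_def using s_Lt by blast
  qed
qed

lemma lc_stable:
  assumes N: "op_stable (insert s \<Omega>) M N"
  shows "op_stable \<Omega> M (lc N n)"
proof (rule stable_subgroupI[OF is_group])
  show "lc N n \<subseteq> carrier M" unfolding leading_def using L_closed by blast
  show "\<zero> \<in> lc N n"
    unfolding leading_def using stable_zero[OF L] stable_zero[OF N] stable_zero[OF Lt_stable]
    by (auto simp: pow_zero intro!: bexI[of _ \<zero>])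
  fix l assume "l \<in> lc N n"
  then obtain y where y: "l \<in> L" "y \<in> Lt n" "(s ^^ n) l \<oplus> y \<in> N" unfolding leading_def by blast
  note yc = L_closed[OF y(1)] Lt_closed[OF y(2)]
  show "\<ominus> l \<in> lc N n"
    using stable_uminus[OF N is_group y(3)] stable_uminus[OF L is_group y(1)]
      stable_uminus[OF Lt_stable is_group y(2)] combine(2)[OF yc yc]
    unfolding leading_def by auto
  { fix l' assume "l' \<in> lc N n"
    then obtain y' where y': "l' \<in> L" "y' \<in> Lt n" "(s ^^ n) l' \<oplus> y' \<in> N" unfolding leading_def by blast
    note y'c = L_closed[OF y'(1)] Lt_closed[OF y'(2)]
    show "l \<oplus> l' \<in> lc N n"
      using stable_add[OF N y(3) y'(3)] stable_add[OF L y(1) y'(1)]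
        stable_add[OF Lt_stable y(2) y'(2)] combine(1)[OF yc y'c]
      unfolding leading_def by auto }
  { fix f assume f: "f \<in> \<Omega>"
    show "f l \<in> lc N n"
      using stable_act[OF N _ y(3), of f] stable_act[OF L f y(1)]
        stable_act[OF Lt_stable f y(2)] combine_op[OF yc f] f
      unfolding leading_def by auto }
qed

lemma lc_Suc:
  assumes N: "op_stable (insert s \<Omega>) M N"
  shows "lc N n \<subseteq> lc N (Suc n)"
proof
  fix l assume "l \<in> lc N n"
  then obtain y where y: "l \<in> L" "y \<in> Lt n" "(s ^^ n) l \<oplus> y \<in> N" unfolding leading_def by blast
  have "(s ^^ Suc n) l \<oplus> s y \<in> N"
    using stable_act[OF N _ y(3), of s] y L_closed Lt_closed by (simp add: op_add pow_closed)
  then show "l \<in> lc N (Suc n)" unfolding leading_def using y s_Lt by blast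
qed

lemma lc_mono: "\<lbrakk>op_stable (insert s \<Omega>) M N; m \<le> n\<rbrakk> \<Longrightarrow> lc N m \<subseteq> lc N n"
  using lift_Suc_mono_le[of "lc N", OF lc_Suc] by blast

text \<open>An element of \<open>N\<close> is reduced modulo \<open>N'\<close> to one of smaller degree: by hypothesis its leading coefficient is
also that of an element of \<open>N'\<close>.\<close>

lemma subset_if_lc_subset:
  assumes N: "op_stable (insert s \<Omega>) M N" and N': "op_stable (insert s \<Omega>) M N'" "N' \<subseteq> N"
    and lc: "\<And>n. lc N n \<subseteq> lc N' n" and NL: "N \<subseteq> op_span (insert s \<Omega>) M L"
  shows "N \<subseteq> N'"
proof -
  have "x \<in> N'" if "x \<in> N" "x \<in> Lt n" for x n
    using that
  proof (induction n arbitrary: x)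
    case 0
    then show ?case using stable_zero[OF N'(1)] by simp
  next
    case (Suc n)
    then obtain l y where x: "x = (s ^^ n) l \<oplus> y" "l \<in> L" "y \<in> Lt n" by auto
    then have "l \<in> lc N' n" using lc Suc.prems(1) unfolding leading_def by blast
    then obtain y' where y': "y' \<in> Lt n" "(s ^^ n) l \<oplus> y' \<in> N'" unfolding leading_def by blast
    have c: "(s ^^ n) l \<in> carrier M" "y \<in> carrier M" "y' \<in> carrier M"
      using x y' L_closed Lt_closed pow_closed by auto
    have eq: "x = ((s ^^ n) l \<oplus> y') \<oplus> (y \<ominus> y')"
      unfolding x(1) using c by (intro split_difference)
    have "y \<ominus> y' = x \<ominus> ((s ^^ n) l \<oplus> y')"
      unfolding x(1) using c by (intro split_difference)
    then have "y \<ominus> y' \<in> N"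
      using stable_minus[OF N is_group Suc.prems(1)] y'(2) N'(2) by auto
    then have "y \<ominus> y' \<in> N'" using Suc.IH stable_minus[OF Lt_stable is_group x(3) y'(1)] by blast
    then show ?case unfolding eq by (rule stable_add[OF N'(1) y'(2)])
  qed
  then show ?thesis using NL span_subset_Lt by blast
qed

text \<open>The leading coefficients in degree \<open>n\<close> increase with \<open>n\<close>, and their union is finitely generated.  Hence they are constant
from some degree \<open>d\<close> on, and lifts of generators of the leading coefficients in degrees up to \<open>d\<close> generate \<open>N\<close>.\<close>

lemma hilbert_basis:
  assumes noeth: "noetherian_on \<Omega> M L"
  shows "noetherian_on (insert s \<Omega>) M (op_span (insert s \<Omega>) M L)"
  unfolding noetherian_on_def
proof (intro allI impI)
  fix N assume NL: "N \<subseteq> op_span (insert s \<Omega>) M L" and N: "op_stable (insert s \<Omega>) M N"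
  have fg: "op_fg \<Omega> M K" if "op_stable \<Omega> M K" "K \<subseteq> L" for K
    using noeth[unfolded noetherian_on_def, rule_format, OF that(2,1)] .
  have lcL: "lc N n \<subseteq> L" for n unfolding leading_def by blast
  have "op_stable \<Omega> M (\<Union>n. lc N n)"
    by (intro stable_chain_union is_group lc_stable N lc_mono)
  then have "op_fg \<Omega> M (\<Union>n. lc N n)" using fg lcL by blast
  then obtain G where G: "G \<subseteq> (\<Union>n. lc N n)" "finite G" "(\<Union>n. lc N n) = op_span \<Omega> M G"
    unfolding finitely_generated_def by blast
  have "\<exists>d. G \<subseteq> lc N d"
    using G(2,1)
  proof (induction G rule: finite_induct)
    case (insert g G)
    then obtain d d' where "G \<subseteq> lc N d" "g \<in> lc N d'" by auto
    then have "insert g G \<subseteq> lc N (max d d')"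
      using lc_mono[OF N, of d "max d d'"] lc_mono[OF N, of d' "max d d'"] by auto
    then show ?case by blast
  qed simp
  then obtain d where d: "G \<subseteq> lc N d" by blast
  have stab: "lc N n \<subseteq> lc N d" for n
  proof -
    have "lc N n \<subseteq> (\<Union>n. lc N n)" by blast
    also have "\<dots> \<subseteq> lc N d" unfolding G(3) using lc_stable[OF N] d by (rule generated_minimal)
    finally show ?thesis .
  qed
  have "\<forall>n. \<exists>H\<subseteq>lc N n. finite H \<and> lc N n = op_span \<Omega> M H"
    using fg[OF lc_stable[OF N] lcL] unfolding finitely_generated_def by auto
  then obtain H where H: "\<And>n. H n \<subseteq> lc N n" "\<And>n. finite (H n)" "\<And>n. lc N n = op_span \<Omega> M (H n)"
    by metis
  have "\<forall>n. \<forall>l\<in>H n. \<exists>y\<in>Lt n. (s ^^ n) l \<oplus> y \<in> N"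
    using H(1) unfolding leading_def by blast
  then obtain y where y: "\<And>n l. l \<in> H n \<Longrightarrow> y n l \<in> Lt n \<and> (s ^^ n) l \<oplus> y n l \<in> N" by metis
  define F where "F = (\<Union>n\<le>d. (\<lambda>l. (s ^^ n) l \<oplus> y n l) ` H n)"
  define N' where "N' = op_span (insert s \<Omega>) M F"
  have F: "finite F" "F \<subseteq> N" unfolding F_def using H(2) y by auto
  have N': "op_stable (insert s \<Omega>) M N'"
    unfolding N'_def using F(2) stable_subset[OF N] by (intro span_stable) blast
  have "N' \<subseteq> N" unfolding N'_def using N F(2) by (rule generated_minimal)
  have le: "lc N n \<subseteq> lc N' n" if "n \<le> d" for n
  proof -
    have "H n \<subseteq> lc N' n"
    proof
      fix l assume l: "l \<in> H n"
      then have "(s ^^ n) l \<oplus> y n l \<in> N'"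
        using that generated_superset[of F] unfolding N'_def F_def by blast
      then show "l \<in> lc N' n" using l y H(1) unfolding leading_def by blast
    qed
    then show ?thesis unfolding H(3) by (rule generated_minimal[OF lc_stable[OF N']])
  qed
  have "lc N n \<subseteq> lc N' n" for n
    using le[of n] le[of d] stab[of n] lc_mono[OF N', of d n] by (cases "n \<le> d") auto
  then have "N \<subseteq> N'" by (rule subset_if_lc_subset[OF N N' \<open>N' \<subseteq> N\<close> _ NL])
  then have "N = N'" using \<open>N' \<subseteq> N\<close> by blast
  then show "op_fg (insert s \<Omega>) M N"
    unfolding finitely_generated_def N'_def using F by blast
qed

end

lemma (in plain_module) noetherian_on_operators:
  assumes R: "noetherian_ring R" and F: "finite F" "F \<subseteq> carrier M" and "finite T"
    and "operator_group M (smults R M \<union> T)"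
    and "\<And>f g x. \<lbrakk>f \<in> T; g \<in> smults R M \<union> T; x \<in> carrier M\<rbrakk> \<Longrightarrow> f (g x) = g (f x)"
  shows "noetherian_on (smults R M \<union> T) M (op_span (smults R M \<union> T) M F)"
  using assms(4-)
proof (induction T rule: finite_induct)
  case empty
  then show ?case using noetherian_on_finite_span[OF R F] by simp
next
  case (insert s T)
  interpret operator_group M "smults R M \<union> insert s T" by fact
  let ?\<Omega> = "smults R M \<union> T"
  have og: "operator_group M ?\<Omega>" by (rule mono_operators) blast
  have IH: "noetherian_on ?\<Omega> M (op_span ?\<Omega> M F)"
    using insert.IH og insert.prems(2) by blast
  interpret adjoined_operator M s ?\<Omega> "op_span ?\<Omega> M F"
    by unfold_locales
      (use op_closed op_add insert.prems(2) operator_group.span_stable[OF og F(2)] in auto)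
  have "op_span (insert s ?\<Omega>) M (op_span ?\<Omega> M F) = op_span (insert s ?\<Omega>) M F" (is "?A = ?B")
  proof
    have sub: "op_span ?\<Omega> M F \<subseteq> ?B" by (rule generated_mono) auto
    have "op_stable (insert s ?\<Omega>) M ?B" using span_stable[OF F(2)] by simp
    then show "?A \<subseteq> ?B" using sub by (rule generated_minimal)
    show "?B \<subseteq> ?A" by (intro generated_mono generated_superset subset_refl)
  qed
  then show ?case using hilbert_basis[OF IH] by simp
qed

section \<open>Transfer of finiteness along a surjection\<close>

text \<open>The hypotheses say that \<open>p x \<mapsto> q x\<close> is a well-defined homomorphism from \<open>p Z\<close> onto \<open>q Z\<close>, compatible with the
operators.  It is given by the two maps \<open>p\<close> and \<open>q\<close>, since in the applications it relates different quotients of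
the same group of cycles.\<close>

lemma fg_transfer:
  fixes M0 :: "('r, 'z) module" and M1 :: "('r, 'b) module" and M2 :: "('r, 'c) module"
  assumes M0: "abelian_group M0" and og1: "operator_group M1 \<Omega>1" and og2: "operator_group M2 \<Omega>2"
    and Z: "additive_subgroup Z M0"
    and p: "p ` Z \<subseteq> carrier M1" "\<And>x y. \<lbrakk>x \<in> Z; y \<in> Z\<rbrakk> \<Longrightarrow> p (x \<oplus>\<^bsub>M0\<^esub> y) = p x \<oplus>\<^bsub>M1\<^esub> p y"
    and q: "\<And>x y. \<lbrakk>x \<in> Z; y \<in> Z\<rbrakk> \<Longrightarrow> q (x \<oplus>\<^bsub>M0\<^esub> y) = q x \<oplus>\<^bsub>M2\<^esub> q y"
    and ker: "\<And>x. \<lbrakk>x \<in> Z; p x = \<zero>\<^bsub>M1\<^esub>\<rbrakk> \<Longrightarrow> q x = \<zero>\<^bsub>M2\<^esub>"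
    and lift: "\<And>f. f \<in> \<Omega>1 \<Longrightarrow> \<exists>g\<in>\<Omega>2. \<exists>h. \<forall>x\<in>Z. h x \<in> Z \<and> p (h x) = f (p x) \<and> q (h x) = g (q x)"
    and fg: "op_fg \<Omega>1 M1 (p ` Z)" and st: "op_stable \<Omega>2 M2 (q ` Z)"
  shows "op_fg \<Omega>2 M2 (q ` Z)"
proof -
  interpret M0: abelian_group M0 by fact
  interpret M1: operator_group M1 \<Omega>1 by fact
  interpret M2: operator_group M2 \<Omega>2 by fact
  interpret Z: additive_subgroup Z M0 by fact
  have qc: "q x \<in> carrier M2" if "x \<in> Z" for x using stable_subset[OF st] that by blast
  have pc: "p x \<in> carrier M1" if "x \<in> Z" for x using p(1) that by blast
  have "p \<zero>\<^bsub>M0\<^esub> = \<zero>\<^bsub>M1\<^esub>"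
    using p(2)[of "\<zero>\<^bsub>M0\<^esub>" "\<zero>\<^bsub>M0\<^esub>"] pc[of "\<zero>\<^bsub>M0\<^esub>"] by (simp add: M1.add.l_cancel_one)
  note p0 = this
  have q0: "q \<zero>\<^bsub>M0\<^esub> = \<zero>\<^bsub>M2\<^esub>"
    using q(1)[of "\<zero>\<^bsub>M0\<^esub>" "\<zero>\<^bsub>M0\<^esub>"] qc[of "\<zero>\<^bsub>M0\<^esub>"] by (simp add: M2.add.l_cancel_one)
  have Zc: "x \<in> carrier M0" if "x \<in> Z" for x using Z.a_subset that by blast
  have pm: "p (\<ominus>\<^bsub>M0\<^esub> x) = \<ominus>\<^bsub>M1\<^esub> p x" if "x \<in> Z" for x
    using p(2)[of "\<ominus>\<^bsub>M0\<^esub> x" x] that pc Zc p0 by (simp add: M0.l_neg M1.minus_equality)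
  have qm: "q (\<ominus>\<^bsub>M0\<^esub> x) = \<ominus>\<^bsub>M2\<^esub> q x" if "x \<in> Z" for x
    using q(1)[of "\<ominus>\<^bsub>M0\<^esub> x" x] that qc Zc q0 by (simp add: M0.l_neg M2.minus_equality)
  obtain F where F: "F \<subseteq> Z" "finite F" "p ` Z = op_span \<Omega>1 M1 (p ` F)"
  proof -
    obtain F1 where F1: "F1 \<subseteq> p ` Z" "finite F1" "p ` Z = op_span \<Omega>1 M1 F1"
      using fg unfolding finitely_generated_def by blast
    then obtain F where "F \<subseteq> Z" "finite F" "F1 = p ` F"
      using finite_subset_image[OF F1(2,1)] by blast
    then show thesis using that F1 by blast
  qed
  have "q ` Z = op_span \<Omega>2 M2 (q ` F)"
  proof
    show "op_span \<Omega>2 M2 (q ` F) \<subseteq> q ` Z" using st F(1) by (intro generated_minimal) auto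
    have N: "op_stable \<Omega>2 M2 (op_span \<Omega>2 M2 (q ` F))" (is "op_stable _ _ ?N")
      using F(1) qc by (intro M2.span_stable) auto
    define P where "P = {p x | x. x \<in> Z \<and> q x \<in> ?N}"
    have "op_stable \<Omega>1 M1 P"
    proof (rule stable_subgroupI[OF M1.is_group])
      show "P \<subseteq> carrier M1" unfolding P_def using pc by blast
      have "q \<zero>\<^bsub>M0\<^esub> \<in> ?N" unfolding q0 using N by (rule stable_zero)
      then show "\<zero>\<^bsub>M1\<^esub> \<in> P" unfolding P_def p0[symmetric] using Z.zero_closed by blast
      fix u assume "u \<in> P"
      then obtain x where x: "x \<in> Z" "q x \<in> ?N" "u = p x" unfolding P_def by blast
      have "q (\<ominus>\<^bsub>M0\<^esub> x) \<in> ?N" unfolding qm[OF x(1)] using N M2.is_group x(2) by (rule stable_uminus)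
      then show "\<ominus>\<^bsub>M1\<^esub> u \<in> P"
        unfolding P_def x(3) pm[OF x(1), symmetric] using Z.a_inv_closed[OF x(1)] M0.abelian_group_axioms by blast
      { fix v assume "v \<in> P"
        then obtain y where y: "y \<in> Z" "q y \<in> ?N" "v = p y" unfolding P_def by blast
        have "q (x \<oplus>\<^bsub>M0\<^esub> y) \<in> ?N" unfolding q[OF x(1) y(1)] using N x(2) y(2) by (rule stable_add)
        then show "u \<oplus>\<^bsub>M1\<^esub> v \<in> P"
          unfolding P_def x(3) y(3) p(2)[OF x(1) y(1), symmetric] using Z.a_closed[OF x(1) y(1)] by blast }
      { fix f assume "f \<in> \<Omega>1"
        then obtain g h where gh: "g \<in> \<Omega>2" "h x \<in> Z" "p (h x) = f (p x)" "q (h x) = g (q x)"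
          using lift x(1) by blast
        have "q (h x) \<in> ?N" unfolding gh(4) using N gh(1) x(2) by (rule stable_act)
        then show "f u \<in> P" unfolding P_def x(3) gh(3)[symmetric] using gh(2) by blast }
    qed
    moreover have "p ` F \<subseteq> P"
      unfolding P_def using F(1) generated_superset[of "q ` F" \<Omega>2 "\<lambda>f. f" M2] by auto
    ultimately have sub: "p ` Z \<subseteq> P" unfolding F(3) by (rule generated_minimal)
    show "q ` Z \<subseteq> ?N"
    proof
      fix v assume "v \<in> q ` Z"
      then obtain x where x: "x \<in> Z" "v = q x" by blast
      then obtain y where y: "y \<in> Z" "q y \<in> ?N" "p x = p y" using sub unfolding P_def by blast
      have m: "\<ominus>\<^bsub>M0\<^esub> y \<in> Z" using Z.a_inv_closed y(1) M0.abelian_group_axioms by blast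
      have "p (x \<oplus>\<^bsub>M0\<^esub> \<ominus>\<^bsub>M0\<^esub> y) = \<zero>\<^bsub>M1\<^esub>"
        using x y m pc by (simp add: p pm M1.r_neg)
      then have "q (x \<oplus>\<^bsub>M0\<^esub> \<ominus>\<^bsub>M0\<^esub> y) = \<zero>\<^bsub>M2\<^esub>" using ker x m by blast
      then have "q x \<oplus>\<^bsub>M2\<^esub> \<ominus>\<^bsub>M2\<^esub> q y = \<zero>\<^bsub>M2\<^esub>" using x y m by (simp add: q qm)
      then have "q x = q y" 
        using qc x y M2.minus_equality[of "q x" "\<ominus>\<^bsub>M2\<^esub> q y"] by simp
      then show "v \<in> ?N" using x y by simp
    qed
  qed
  moreover have "q ` F \<subseteq> q ` Z" using F(1) by blast
  ultimately show ?thesis unfolding finitely_generated_def using F(2) by blast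
qed

section \<open>Algebras that are finite over a finitely generated central subalgebra\<close>

text \<open>The subgroups stable under these operators are the submodules over \<open>R[S]\<close>.\<close>

abbreviation scalars ::
    "'r ring \<Rightarrow> ('a \<Rightarrow> 'b \<Rightarrow> 'b) \<Rightarrow> ('r, 'b) module \<Rightarrow> 'a set \<Rightarrow> ('b \<Rightarrow> 'b) set" where
  "scalars R act M S \<equiv> smults R M \<union> act ` S"

lemma assoc_algebra_is_left_module:
  assumes "assoc_algebra R A"
  shows "left_module R A (mult A) A"
proof -
  interpret assoc_algebra R A by fact
  show ?thesis
    by unfold_locales (auto simp: l_distr r_distr m_assoc smult_mult_left smult_mult_right)
qed

context left_module
begin

lemma act_zero_left: "u \<in> carrier M \<Longrightarrow> act \<zero>\<^bsub>A\<^esub> u = \<zero>\<^bsub>M\<^esub>"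
  using act_add_left[of "\<zero>\<^bsub>A\<^esub>" "\<zero>\<^bsub>A\<^esub>" u] act_closed[of "\<zero>\<^bsub>A\<^esub>" u]
  by (simp add: M.add.l_cancel_one)

lemma act_zero_right: "a \<in> carrier A \<Longrightarrow> act a \<zero>\<^bsub>M\<^esub> = \<zero>\<^bsub>M\<^esub>"
  using act_add_right[of a "\<zero>\<^bsub>M\<^esub>" "\<zero>\<^bsub>M\<^esub>"] act_closed[of a "\<zero>\<^bsub>M\<^esub>"]
  by (simp add: M.add.l_cancel_one)

lemma act_uminus_left:
  "\<lbrakk>a \<in> carrier A; u \<in> carrier M\<rbrakk> \<Longrightarrow> act (\<ominus>\<^bsub>A\<^esub> a) u = \<ominus>\<^bsub>M\<^esub> act a u"
  using act_add_left[of "\<ominus>\<^bsub>A\<^esub> a" a u] act_closed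
  by (simp add: A.add.l_inv M.minus_equality act_zero_left)

lemma act_uminus_right:
  "\<lbrakk>a \<in> carrier A; u \<in> carrier M\<rbrakk> \<Longrightarrow> act a (\<ominus>\<^bsub>M\<^esub> u) = \<ominus>\<^bsub>M\<^esub> act a u"
  using act_add_right[of a "\<ominus>\<^bsub>M\<^esub> u" u] act_closed
  by (simp add: M.l_neg M.minus_equality act_zero_right)

lemma scalars_operator_group:
  assumes "S \<subseteq> carrier A"
  shows "operator_group M (scalars R act M S)"
  using assms by unfold_locales (auto simp: M.smult_r_distr act_add_right intro: act_closed)

lemma scalars_commute:
  assumes S: "S \<subseteq> carrier A"
    and central: "\<And>s t. \<lbrakk>s \<in> S; t \<in> S\<rbrakk> \<Longrightarrow> s \<otimes>\<^bsub>A\<^esub> t = t \<otimes>\<^bsub>A\<^esub> s"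
    and f: "f \<in> act ` S" and g: "g \<in> scalars R act M S" and x: "x \<in> carrier M"
  shows "f (g x) = g (f x)"
proof -
  obtain s where s: "s \<in> S" "f = act s" using f by blast
  consider a where "a \<in> carrier R" "g = (\<lambda>x. a \<odot>\<^bsub>M\<^esub> x)" | t where "t \<in> S" "g = act t"
    using g by blast
  then show ?thesis
  proof cases
    case 1
    then show ?thesis using s S x by (auto simp: act_smult_right)
  next
    case 2
    then show ?thesis
      using s S x central[of s t] by (auto simp: act_mult[symmetric] subset_iff)
  qed
qed

lemma noetherian_on_carrier:
  assumes R: "noetherian_ring R" and S: "finite S" "S \<subseteq> carrier A"
    and central: "\<And>s t. \<lbrakk>s \<in> S; t \<in> S\<rbrakk> \<Longrightarrow> s \<otimes>\<^bsub>A\<^esub> t = t \<otimes>\<^bsub>A\<^esub> s"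
    and fg: "op_fg (scalars R act M S) M (carrier M)"
  shows "noetherian_on (scalars R act M S) M (carrier M)"
proof -
  interpret plain_module R M by (unfold_locales)
  obtain F where F: "F \<subseteq> carrier M" "finite F" "carrier M = op_span (scalars R act M S) M F"
    using fg unfolding finitely_generated_def by auto
  have "noetherian_on (scalars R act M S) M (op_span (scalars R act M S) M F)"
    using R F S scalars_operator_group[OF S(2)] scalars_commute[OF S(2) central]
    by (intro noetherian_on_operators) auto
  then show ?thesis using F(3) by simp
qed

text \<open>If \<open>A\<close> is generated by \<open>F\<close> over \<open>R[S]\<close>, and \<open>M\<close> by \<open>G\<close> over \<open>A\<close>, then the products \<open>f g\<close> generate \<open>M\<close> over \<open>R[S]\<close>.\<close>

lemma fg_over_scalars:
  assumes S: "S \<subseteq> carrier A"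
    and A: "op_fg (scalars R (mult A) A S) A (carrier A)"
    and M: "finitely_generated (carrier A) act M (carrier M)"
  shows "op_fg (scalars R act M S) M (carrier M)"
proof -
  interpret L: left_module R A "mult A" A
    by (rule assoc_algebra_is_left_module) (rule A.assoc_algebra_axioms)
  interpret oA: operator_group A "scalars R (mult A) A S" by (rule L.scalars_operator_group[OF S])
  interpret oM: operator_group M "scalars R act M S" by (rule scalars_operator_group[OF S])
  obtain F where F: "F \<subseteq> carrier A" "finite F" "carrier A = op_span (scalars R (mult A) A S) A F"
    using A unfolding finitely_generated_def by auto
  obtain G where G: "G \<subseteq> carrier M" "finite G" "carrier M = generated (carrier A) act M G"
    using M unfolding finitely_generated_def by auto
  define H where "H = (\<lambda>(f, g). act f g) ` (F \<times> G)"
  have H: "finite H" "H \<subseteq> carrier M" unfolding H_def using F(1,2) G(1,2) by (auto intro!: act_closed)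
  let ?N = "op_span (scalars R act M S) M H"
  have N: "op_stable (scalars R act M S) M ?N" by (rule oM.span_stable[OF H(2)])
  have gen: "act a g \<in> ?N" if g: "g \<in> G" and a: "a \<in> carrier A" for a g
  proof -
    have gc: "g \<in> carrier M" using g G by blast
    have "op_stable (scalars R (mult A) A S) A {a \<in> carrier A. act a g \<in> ?N}"
    proof (rule stable_subgroupI[OF oA.is_group])
      fix f a assume f: "f \<in> scalars R (mult A) A S" and "a \<in> {a \<in> carrier A. act a g \<in> ?N}"
      then have a: "a \<in> carrier A" "act a g \<in> ?N" by auto
      consider b where "b \<in> carrier R" "f = (\<lambda>x. b \<odot>\<^bsub>A\<^esub> x)" | t where "t \<in> S" "f = mult A t"
        using f by blast
      then have "act (f a) g \<in> ?N"
      proof cases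
        case 1
        then show ?thesis using a gc stable_act[OF N _ a(2), of "\<lambda>x. b \<odot>\<^bsub>M\<^esub> x"]
          by (auto simp: act_smult_left)
      next
        case 2
        then show ?thesis using a gc S stable_act[OF N _ a(2), of "act t"]
          by (auto simp: act_mult)
      qed
      then show "f a \<in> {a \<in> carrier A. act a g \<in> ?N}" using oA.op_closed[OF f a(1)] by blast
    qed (use gc stable_zero[OF N] stable_add[OF N] stable_uminus[OF N oM.is_group] in
        \<open>auto simp: act_add_left act_zero_left act_uminus_left\<close>)
    moreover have "F \<subseteq> {a \<in> carrier A. act a g \<in> ?N}"
    proof
      fix f assume f: "f \<in> F"
      then have "act f g \<in> H" unfolding H_def using g by auto
      then show "f \<in> {a \<in> carrier A. act a g \<in> ?N}"
        using f F(1) subsetD[OF generated_superset[of H]] by auto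
    qed
    ultimately have "carrier A \<subseteq> {a \<in> carrier A. act a g \<in> ?N}"
      unfolding F(3)[symmetric] by (subst (1) F(3)) (rule generated_minimal)
    then show ?thesis using a by blast
  qed
  let ?N' = "{u \<in> carrier M. \<forall>a\<in>carrier A. act a u \<in> ?N}"
  have "stable_subgroup (carrier A) act M ?N'"
  proof (rule stable_subgroupI[OF oM.is_group])
    fix b u assume b: "b \<in> carrier A" and "u \<in> ?N'"
    then have u: "u \<in> carrier M" "\<And>a. a \<in> carrier A \<Longrightarrow> act a u \<in> ?N" by auto
    have "act a (act b u) \<in> ?N" if "a \<in> carrier A" for a
      using u(2)[of "a \<otimes>\<^bsub>A\<^esub> b"] that b u(1) by (simp add: act_mult)
    then show "act b u \<in> ?N'" using act_closed b u(1) by blast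
  qed (use stable_zero[OF N] stable_add[OF N] stable_uminus[OF N oM.is_group] in
        \<open>auto simp: act_add_right act_zero_right act_uminus_right\<close>)
  moreover have "G \<subseteq> ?N'" using G(1) gen by blast
  ultimately have "carrier M \<subseteq> ?N'" by (subst G(3)) (rule generated_minimal)
  then have "carrier M \<subseteq> ?N" using act_one A.one_closed by force
  then have "carrier M = ?N" using oM.span_closed[OF H(2)] by blast
  then show ?thesis unfolding finitely_generated_def using H by blast
qed

end

text \<open>Since \<open>S\<close> is central, right ideals of \<open>A\<close> are submodules of \<open>A\<close> over \<open>R[S]\<close> just as left ideals are, and \<open>A\<close> is a noetherian \<open>R[S]\<close>-module.  Generators of such a
submodule over \<open>R[S]\<close> also generate it as a one-sided ideal.  The algebra \<open>A\<close> is generated by \<open>S\<close> and by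
generators of this module.\<close>

lemma noetherian_algebra_if_finite_over_central:
  assumes A: "assoc_algebra R A" and R: "noetherian_ring R"
    and S: "finite S" "S \<subseteq> carrier A"
    and central: "\<And>s x. \<lbrakk>s \<in> S; x \<in> carrier A\<rbrakk> \<Longrightarrow> s \<otimes>\<^bsub>A\<^esub> x = x \<otimes>\<^bsub>A\<^esub> s"
    and fg: "op_fg (scalars R (mult A) A S) A (carrier A)"
  shows "noetherian_algebra R A"
proof -
  interpret assoc_algebra R A by fact
  interpret L: left_module R A "mult A" A by (rule assoc_algebra_is_left_module[OF A])
  interpret oA: operator_group A "scalars R (mult A) A S" by (rule L.scalars_operator_group[OF S(2)])
  let ?\<Omega> = "scalars R (mult A) A S"
  have noeth: "noetherian_on ?\<Omega> A (carrier A)"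
    using central S by (intro L.noetherian_on_carrier[OF R S _ fg]) (auto simp: subset_iff)
  \<comment> \<open>The abstract action covers left and right multiplication at once.\<close>
  have ideal_fg: "finitely_generated (carrier A) act A I"
    if st: "stable_subgroup (carrier A) act A I"
      and sm: "\<And>a x. \<lbrakk>a \<in> carrier R; x \<in> carrier A\<rbrakk> \<Longrightarrow> act (a \<odot>\<^bsub>A\<^esub> \<one>\<^bsub>A\<^esub>) x = a \<odot>\<^bsub>A\<^esub> x"
      and sS: "\<And>s x. \<lbrakk>s \<in> S; x \<in> carrier A\<rbrakk> \<Longrightarrow> act s x = s \<otimes>\<^bsub>A\<^esub> x"
      and cl: "\<And>a x. \<lbrakk>a \<in> carrier A; x \<in> carrier A\<rbrakk> \<Longrightarrow> act a x \<in> carrier A"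
    for act I
  proof -
    note Ic = subsetD[OF stable_subset[OF st]]
    have le: "op_stable ?\<Omega> A J" if J: "stable_subgroup (carrier A) act A J" for J
    proof (rule stable_subgroupI[OF oA.is_group stable_subset[OF J] stable_zero[OF J]
          stable_add[OF J] stable_uminus[OF J oA.is_group]], assumption+)
      fix f x assume f: "f \<in> ?\<Omega>" and x: "x \<in> J"
      then have xc: "x \<in> carrier A" using stable_subset[OF J] by blast
      consider a where "a \<in> carrier R" "f = (\<lambda>x. a \<odot>\<^bsub>A\<^esub> x)" | s where "s \<in> S" "f = mult A s"
        using f by blast
      then show "f x \<in> J"
      proof cases
        case 1
        then show ?thesis using sm[OF _ xc] stable_act[OF J _ x, of "a \<odot>\<^bsub>A\<^esub> \<one>\<^bsub>A\<^esub>"] by simp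
      next
        case 2
        then show ?thesis using sS[OF _ xc] stable_act[OF J _ x, of s] S(2) by auto
      qed
    qed
    have "op_fg ?\<Omega> A I"
      using noeth le[OF st] stable_subset[OF st] unfolding noetherian_on_def by blast
    then obtain F where F: "F \<subseteq> I" "finite F" "I = op_span ?\<Omega> A F"
      unfolding finitely_generated_def by blast
    have "I = generated (carrier A) act A F"
    proof
      show "generated (carrier A) act A F \<subseteq> I" using st F(1) by (rule generated_minimal)
      have "stable_subgroup (carrier A) act A (generated (carrier A) act A F)"
        using F(1) stable_subset[OF st] cl by (intro generated_stable oA.is_group) auto
      then show "I \<subseteq> generated (carrier A) act A F"
        unfolding F(3) by (intro generated_minimal le generated_superset)
    qed
    then show ?thesis unfolding finitely_generated_def using F by blast
  qed
  have left: "left_noetherian A"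
    unfolding left_noetherian_def by (auto intro!: ideal_fg simp: smult_mult_left)
  have right: "right_noetherian A"
    unfolding right_noetherian_def
    by (auto intro!: ideal_fg simp: smult_mult_right) (metis central)
  obtain F where F: "F \<subseteq> carrier A" "finite F" "carrier A = op_span ?\<Omega> A F"
    using fg unfolding finitely_generated_def by auto
  have "carrier A = \<Inter>{B. submodule B R A \<and> \<one>\<^bsub>A\<^esub> \<in> B \<and>
                        (\<forall>x\<in>B. \<forall>y\<in>B. x \<otimes>\<^bsub>A\<^esub> y \<in> B) \<and> S \<union> F \<subseteq> B}" (is "_ = \<Inter>?\<B>")
  proof
    have "submodule (carrier A) R A" using carrier_is_submodule .
    then have "carrier A \<in> ?\<B>" using S F(1) by auto
    then show "\<Inter>?\<B> \<subseteq> carrier A" by blast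
    show "carrier A \<subseteq> \<Inter>?\<B>"
    proof (rule Inter_greatest)
      fix B assume "B \<in> ?\<B>"
      then have B: "submodule B R A" "\<And>x y. \<lbrakk>x \<in> B; y \<in> B\<rbrakk> \<Longrightarrow> x \<otimes>\<^bsub>A\<^esub> y \<in> B" "S \<subseteq> B" "F \<subseteq> B"
        by auto
      have "op_stable ?\<Omega> A B"
        using B submodule.smult_closed[OF B(1)] submodule.axioms(1)[OF B(1)]
        unfolding stable_subgroup_def by (auto intro!: additive_subgroupI)
      then show "carrier A \<subseteq> B" unfolding F(3) using B(4) by (rule generated_minimal)
    qed
  qed
  then have "finitely_generated_algebra R A"
    unfolding finitely_generated_algebra_def using S F(1,2) by (intro exI[of _ "S \<union> F"]) blast
  then show ?thesis unfolding noetherian_algebra_def using A left right by blast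
qed

section \<open>Subquotients\<close>

locale subquotient_module = plain_module R M
  for R :: "'r ring" (structure) and M :: "('r, 'b) module" +
  fixes Z B :: "'b set"
  assumes Z: "submodule Z R M" and B: "submodule B R M" and B_Z: "B \<subseteq> Z"
begin

abbreviation Q where "Q \<equiv> subquotient M Z B"
abbreviation q where "q x \<equiv> B +>\<^bsub>M\<^esub> x"

lemma Z_closed: "x \<in> Z \<Longrightarrow> x \<in> carrier M"
  using submoduleE(1)[OF Z] by blast

lemma B_closed: "x \<in> B \<Longrightarrow> x \<in> carrier M"
  using B_Z Z_closed by blast

lemma B_subgroup: "subgroup B (add_monoid M)"
  using B submodule.axioms(1) by blast

lemma Z_subgroup: "additive_subgroup Z M"
  using Z submodule.axioms(1) additive_subgroupI by blast

lemma coset_self: "x \<in> Z \<Longrightarrow> x \<in> q x"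
  using M.a_rcosI[of "\<zero>\<^bsub>M\<^esub>" B x] submoduleE(1)[OF B] Z_closed[of x]
    subgroup.one_closed[OF B_subgroup] by simp

lemma coset_mem: "x \<in> Z \<Longrightarrow> y \<in> q x \<longleftrightarrow> (\<exists>b\<in>B. y = b \<oplus>\<^bsub>M\<^esub> x)"
  unfolding a_r_coset_def' by auto

lemma coset_memD: "\<lbrakk>x \<in> Z; y \<in> q x\<rbrakk> \<Longrightarrow> y \<in> Z"
  using coset_mem[of x y] submoduleE(5)[OF Z, of _ x] B_Z by auto

lemma coset_eq: "\<lbrakk>x \<in> Z; y \<in> q x\<rbrakk> \<Longrightarrow> q y = q x"
  using M.a_repr_independence[OF _ Z_closed B_subgroup] by blast

lemma coset_eq_add: "\<lbrakk>x \<in> Z; b \<in> B\<rbrakk> \<Longrightarrow> q (b \<oplus>\<^bsub>M\<^esub> x) = q x"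
  using coset_eq[of x "b \<oplus>\<^bsub>M\<^esub> x"] coset_mem[of x "b \<oplus>\<^bsub>M\<^esub> x"] by auto

lemma coset_zero: "b \<in> B \<Longrightarrow> q b = B"
  using M.a_coset_join2[OF _ B_subgroup] B_closed by blast

lemma Q_carrier: "carrier Q = q ` Z"
  by (simp add: subquotient_def)

lemma Q_zero: "\<zero>\<^bsub>Q\<^esub> = B"
  by (simp add: subquotient_def)

lemma Q_add: "\<lbrakk>x \<in> Z; y \<in> Z\<rbrakk> \<Longrightarrow> q x \<oplus>\<^bsub>Q\<^esub> q y = q (x \<oplus>\<^bsub>M\<^esub> y)"
  using abelian_subgroup.a_rcos_sum[OF abelian_subgroupI3[OF additive_subgroupI[OF B_subgroup]
        M.abelian_group_axioms]] Z_closed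
  by (simp add: subquotient_def)

lemma Q_smult:
  assumes "a \<in> carrier R" "x \<in> Z"
  shows "a \<odot>\<^bsub>Q\<^esub> q x = q (a \<odot>\<^bsub>M\<^esub> x)"
proof -
  have "q (a \<odot>\<^bsub>M\<^esub> y) = q (a \<odot>\<^bsub>M\<^esub> x)" if y: "y \<in> q x" for y
  proof -
    obtain b where b: "b \<in> B" "y = b \<oplus>\<^bsub>M\<^esub> x" using y assms coset_mem by auto
    then show ?thesis using assms B_closed[of b] Z_closed submoduleE(4)[OF B] submoduleE(4)[OF Z]
      by (simp add: smult_r_distr coset_eq_add)
  qed
  note rep = this
  have "(\<Union>y\<in>q x. q (a \<odot>\<^bsub>M\<^esub> y)) = q (a \<odot>\<^bsub>M\<^esub> x)"
    using coset_self[OF assms(2)] by (intro SUP_eq_const rep) auto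
  then show ?thesis by (simp add: subquotient_def)
qed

lemma Q_eq_zero: "x \<in> Z \<Longrightarrow> q x = \<zero>\<^bsub>Q\<^esub> \<longleftrightarrow> x \<in> B"
  using coset_zero coset_self Q_zero by auto

lemma Q_module: "module R Q"
proof (rule moduleI)
  have z: "\<zero>\<^bsub>M\<^esub> \<in> Z" "\<zero>\<^bsub>Q\<^esub> = q \<zero>\<^bsub>M\<^esub>"
    using additive_subgroup.zero_closed[OF Z_subgroup] Q_zero coset_zero
      subgroup.one_closed[OF B_subgroup] by auto
  have cl: "x \<oplus>\<^bsub>M\<^esub> y \<in> Z" "\<ominus>\<^bsub>M\<^esub> x \<in> Z" if "x \<in> Z" "y \<in> Z" for x y
    using submoduleE[OF Z] that by auto
  have sm: "a \<odot>\<^bsub>M\<^esub> x \<in> Z" if "a \<in> carrier R" "x \<in> Z" for a x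
    using submoduleE(4)[OF Z] that by auto
  show "cring R" by (rule is_cring)
  show "abelian_group Q"
  proof (rule abelian_groupI)
    fix X Y W assume "X \<in> carrier Q" "Y \<in> carrier Q" "W \<in> carrier Q"
    then obtain x y w where x: "x \<in> Z" "y \<in> Z" "w \<in> Z" "X = q x" "Y = q y" "W = q w"
      unfolding Q_carrier by auto
    show "X \<oplus>\<^bsub>Q\<^esub> Y \<in> carrier Q" "X \<oplus>\<^bsub>Q\<^esub> Y \<oplus>\<^bsub>Q\<^esub> W = X \<oplus>\<^bsub>Q\<^esub> (Y \<oplus>\<^bsub>Q\<^esub> W)"
      "X \<oplus>\<^bsub>Q\<^esub> Y = Y \<oplus>\<^bsub>Q\<^esub> X" "\<zero>\<^bsub>Q\<^esub> \<oplus>\<^bsub>Q\<^esub> X = X"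
      using x cl z Z_closed by (simp_all add: Q_add Q_carrier M.a_ac)
    have "q (\<ominus>\<^bsub>M\<^esub> x) \<oplus>\<^bsub>Q\<^esub> X = \<zero>\<^bsub>Q\<^esub>" using x cl z Z_closed by (simp add: Q_add M.l_neg)
    then show "\<exists>y\<in>carrier Q. y \<oplus>\<^bsub>Q\<^esub> X = \<zero>\<^bsub>Q\<^esub>" using cl x unfolding Q_carrier by blast
  qed (use z in \<open>auto simp: Q_carrier\<close>)
  fix a b X Y assume "X \<in> carrier Q" "Y \<in> carrier Q" and a: "a \<in> carrier R" "b \<in> carrier R"
  then obtain x y where x: "x \<in> Z" "y \<in> Z" "X = q x" "Y = q y" unfolding Q_carrier by auto
  show "a \<odot>\<^bsub>Q\<^esub> X \<in> carrier Q" "(a \<oplus> b) \<odot>\<^bsub>Q\<^esub> X = a \<odot>\<^bsub>Q\<^esub> X \<oplus>\<^bsub>Q\<^esub> b \<odot>\<^bsub>Q\<^esub> X"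
    "a \<odot>\<^bsub>Q\<^esub> (X \<oplus>\<^bsub>Q\<^esub> Y) = a \<odot>\<^bsub>Q\<^esub> X \<oplus>\<^bsub>Q\<^esub> a \<odot>\<^bsub>Q\<^esub> Y" "(a \<otimes> b) \<odot>\<^bsub>Q\<^esub> X = a \<odot>\<^bsub>Q\<^esub> (b \<odot>\<^bsub>Q\<^esub> X)"
    using x a cl sm Z_closed
    by (simp_all add: Q_add Q_smult Q_carrier smult_l_distr smult_r_distr smult_assoc1)
next
  fix X assume "X \<in> carrier Q"
  then show "\<one> \<odot>\<^bsub>Q\<^esub> X = X" using Z_closed by (auto simp: Q_smult Q_carrier)
qed

end

locale subquotient_algebra = subquotient_module R A Z B + assoc_algebra R A
  for R :: "'r ring" (structure) and A :: "('r, 'a) module" and Z B +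
  assumes Z_one: "\<one>\<^bsub>A\<^esub> \<in> Z"
    and Z_mult: "\<lbrakk>x \<in> Z; y \<in> Z\<rbrakk> \<Longrightarrow> x \<otimes>\<^bsub>A\<^esub> y \<in> Z"
    and B_mult_left: "\<lbrakk>x \<in> B; y \<in> Z\<rbrakk> \<Longrightarrow> x \<otimes>\<^bsub>A\<^esub> y \<in> B"
    and B_mult_right: "\<lbrakk>x \<in> Z; y \<in> B\<rbrakk> \<Longrightarrow> x \<otimes>\<^bsub>A\<^esub> y \<in> B"
begin

lemma Q_one: "\<one>\<^bsub>Q\<^esub> = q \<one>\<^bsub>A\<^esub>"
  by (simp add: subquotient_def)

lemma Q_mult:
  assumes "x \<in> Z" "y \<in> Z"
  shows "q x \<otimes>\<^bsub>Q\<^esub> q y = q (x \<otimes>\<^bsub>A\<^esub> y)"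
proof -
  have "q (x' \<otimes>\<^bsub>A\<^esub> y') = q (x \<otimes>\<^bsub>A\<^esub> y)" if xy: "x' \<in> q x" "y' \<in> q y" for x' y'
  proof -
    obtain b c where b: "b \<in> B" "x' = b \<oplus>\<^bsub>A\<^esub> x" "c \<in> B" "y' = c \<oplus>\<^bsub>A\<^esub> y"
      using xy assms coset_mem by auto
    have y': "y' \<in> Z" using xy assms coset_memD by blast
    have "x' \<otimes>\<^bsub>A\<^esub> y' = b \<otimes>\<^bsub>A\<^esub> y' \<oplus>\<^bsub>A\<^esub> (x \<otimes>\<^bsub>A\<^esub> c \<oplus>\<^bsub>A\<^esub> x \<otimes>\<^bsub>A\<^esub> y)"
    proof -
      have "x' \<otimes>\<^bsub>A\<^esub> y' = b \<otimes>\<^bsub>A\<^esub> y' \<oplus>\<^bsub>A\<^esub> x \<otimes>\<^bsub>A\<^esub> y'"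
        unfolding b(2) using b(1) assms B_closed Z_closed y' by (simp add: l_distr)
      also have "x \<otimes>\<^bsub>A\<^esub> y' = x \<otimes>\<^bsub>A\<^esub> c \<oplus>\<^bsub>A\<^esub> x \<otimes>\<^bsub>A\<^esub> y"
        unfolding b(4) using b(3) assms B_closed Z_closed by (simp add: r_distr)
      finally show ?thesis .
    qed
    moreover have "b \<otimes>\<^bsub>A\<^esub> y' \<in> B" "x \<otimes>\<^bsub>A\<^esub> c \<in> B" "x \<otimes>\<^bsub>A\<^esub> y \<in> Z"
      using b assms y' Z_mult B_mult_left B_mult_right by blast+
    moreover from this have "x \<otimes>\<^bsub>A\<^esub> c \<oplus>\<^bsub>A\<^esub> x \<otimes>\<^bsub>A\<^esub> y \<in> Z"
      using submoduleE(5)[OF Z] B_Z by blast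
    ultimately show ?thesis by (simp only: coset_eq_add)
  qed
  note rep = this
  have "(\<Union>x'\<in>q x. \<Union>y'\<in>q y. q (x' \<otimes>\<^bsub>A\<^esub> y')) = q (x \<otimes>\<^bsub>A\<^esub> y)"
    using coset_self[OF assms(1)] coset_self[OF assms(2)]
    by (intro SUP_eq_const rep) auto
  then show ?thesis by (simp add: subquotient_def rcoset_mult_def)
qed

lemma Q_assoc_algebra: "assoc_algebra R Q"
proof -
  note Q_group = module.axioms(2)[OF Q_module]
  have cl: "x \<oplus>\<^bsub>A\<^esub> y \<in> Z" if "x \<in> Z" "y \<in> Z" for x y
    using submoduleE(5)[OF Z that] .
  have sm: "a \<odot>\<^bsub>A\<^esub> x \<in> Z" if "a \<in> carrier R" "x \<in> Z" for a x
    using submoduleE(4)[OF Z that] .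
  have monoid: "Group.monoid Q"
  proof (rule monoidI)
    show "\<one>\<^bsub>Q\<^esub> \<in> carrier Q" using Z_one by (simp add: Q_one Q_carrier)
    fix X Y W assume "X \<in> carrier Q" "Y \<in> carrier Q" "W \<in> carrier Q"
    then obtain x y w where x: "x \<in> Z" "y \<in> Z" "w \<in> Z" "X = q x" "Y = q y" "W = q w"
      unfolding Q_carrier by blast
    show "X \<otimes>\<^bsub>Q\<^esub> Y \<in> carrier Q" "X \<otimes>\<^bsub>Q\<^esub> Y \<otimes>\<^bsub>Q\<^esub> W = X \<otimes>\<^bsub>Q\<^esub> (Y \<otimes>\<^bsub>Q\<^esub> W)"
      "\<one>\<^bsub>Q\<^esub> \<otimes>\<^bsub>Q\<^esub> X = X" "X \<otimes>\<^bsub>Q\<^esub> \<one>\<^bsub>Q\<^esub> = X"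
      using x Z_mult Z_one Z_closed by (simp_all add: Q_mult Q_one Q_carrier m_assoc)
  qed
  have "ring Q"
  proof (rule ringI[OF Q_group monoid])
    fix X Y W assume "X \<in> carrier Q" "Y \<in> carrier Q" "W \<in> carrier Q"
    then obtain x y w where x: "x \<in> Z" "y \<in> Z" "w \<in> Z" "X = q x" "Y = q y" "W = q w"
      unfolding Q_carrier by blast
    show "(X \<oplus>\<^bsub>Q\<^esub> Y) \<otimes>\<^bsub>Q\<^esub> W = X \<otimes>\<^bsub>Q\<^esub> W \<oplus>\<^bsub>Q\<^esub> Y \<otimes>\<^bsub>Q\<^esub> W"
      "W \<otimes>\<^bsub>Q\<^esub> (X \<oplus>\<^bsub>Q\<^esub> Y) = W \<otimes>\<^bsub>Q\<^esub> X \<oplus>\<^bsub>Q\<^esub> W \<otimes>\<^bsub>Q\<^esub> Y"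
      using x Z_mult cl Z_closed by (simp_all add: Q_mult Q_add l_distr r_distr)
  qed
  then show ?thesis
  proof (intro assoc_algebra.intro Q_module assoc_algebra_axioms.intro)
    fix a X Y assume a: "a \<in> carrier R" and "X \<in> carrier Q" "Y \<in> carrier Q"
    then obtain x y where x: "x \<in> Z" "y \<in> Z" "X = q x" "Y = q y" unfolding Q_carrier by blast
    show "a \<odot>\<^bsub>Q\<^esub> X \<otimes>\<^bsub>Q\<^esub> Y = a \<odot>\<^bsub>Q\<^esub> (X \<otimes>\<^bsub>Q\<^esub> Y)"
      "X \<otimes>\<^bsub>Q\<^esub> (a \<odot>\<^bsub>Q\<^esub> Y) = a \<odot>\<^bsub>Q\<^esub> (X \<otimes>\<^bsub>Q\<^esub> Y)"
      using x Z_mult sm a Z_closed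
      by (simp_all add: Q_mult Q_smult smult_mult_left smult_mult_right)
  qed
qed

end

section \<open>Homogeneous components\<close>

lemma (in abelian_group) finsum_in_subgroup:
  assumes N: "additive_subgroup N G" and f: "\<And>k. k \<in> K \<Longrightarrow> f k \<in> N"
  shows "finsum G f K \<in> N"
proof (cases "finite K")
  case True
  then show ?thesis using f
  proof (induction K rule: finite_induct)
    case (insert k K)
    then have "f \<in> K \<rightarrow> carrier G" "f k \<in> carrier G"
      using additive_subgroup.a_subset[OF N] by auto
    then have "finsum G f (insert k K) = f k \<oplus> finsum G f K"
      using insert.hyps by simp
    then show ?case using additive_subgroup.a_closed[OF N] insert by simp
  qed (simp add: additive_subgroup.zero_closed[OF N])
qed (simp add: finsum_infinite additive_subgroup.zero_closed[OF N])

locale graded = plain_module R M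
  for R :: "'r ring" (structure) and M :: "('r, 'b) module" +
  fixes G :: "'i \<Rightarrow> 'b set"
  assumes graded: "graded_module R M G"
begin

lemma piece_submodule: "submodule (G k) R M"
  using graded unfolding graded_module_def by blast

lemma piece_closed: "x \<in> G k \<Longrightarrow> x \<in> carrier M"
  using submoduleE(1)[OF piece_submodule] by blast

lemma piece_zero: "\<zero>\<^bsub>M\<^esub> \<in> G k"
  using subgroup.one_closed[OF submodule.axioms(1)[OF piece_submodule]] by simp

text \<open>The additive projections onto the pieces allow to compare two elements of a graded module degree by degree.\<close>

definition component :: "'b \<Rightarrow> 'i \<Rightarrow> 'b" where
  "component x = (THE f. (\<forall>k. f k \<in> G k) \<and> finite {k. f k \<noteq> \<zero>\<^bsub>M\<^esub>} \<and>
                          x = finsum M f {k. f k \<noteq> \<zero>\<^bsub>M\<^esub>})"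

lemma component_decomposition:
  assumes "x \<in> carrier M"
  shows "(\<forall>k. component x k \<in> G k) \<and> finite {k. component x k \<noteq> \<zero>\<^bsub>M\<^esub>} \<and>
    x = finsum M (component x) {k. component x k \<noteq> \<zero>\<^bsub>M\<^esub>}"
proof -
  have "\<exists>!f. (\<forall>k. f k \<in> G k) \<and> finite {k. f k \<noteq> \<zero>\<^bsub>M\<^esub>} \<and> x = finsum M f {k. f k \<noteq> \<zero>\<^bsub>M\<^esub>}"
    using graded assms unfolding graded_module_def by auto
  from theI'[OF this] show ?thesis unfolding component_def[symmetric] .
qed

lemma component_piece: "x \<in> carrier M \<Longrightarrow> component x k \<in> G k"
  using component_decomposition by blast

lemma component_closed: "x \<in> carrier M \<Longrightarrow> component x k \<in> carrier M"
  using component_piece piece_closed by blast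

lemma finite_support: "x \<in> carrier M \<Longrightarrow> finite {k. component x k \<noteq> \<zero>\<^bsub>M\<^esub>}"
  using component_decomposition by blast

lemma component_unique:
  assumes K: "finite K" and f: "\<And>k. f k \<in> G k" "\<And>k. k \<notin> K \<Longrightarrow> f k = \<zero>\<^bsub>M\<^esub>"
    and x: "x = finsum M f K"
  shows "component x = f"
proof -
  have fc: "f \<in> K \<rightarrow> carrier M" using f(1) piece_closed by blast
  have sub: "{k. f k \<noteq> \<zero>\<^bsub>M\<^esub>} \<subseteq> K" using f(2) by blast
  have "finsum M f {k. f k \<noteq> \<zero>\<^bsub>M\<^esub>} = finsum M f K"
    using K sub fc by (intro M.add.finprod_mono_neutral_cong_left) auto
  then have "(\<forall>k. f k \<in> G k) \<and> finite {k. f k \<noteq> \<zero>\<^bsub>M\<^esub>} \<and> x = finsum M f {k. f k \<noteq> \<zero>\<^bsub>M\<^esub>}"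
    using f(1) finite_subset[OF sub K] x by simp
  moreover have xc: "x \<in> carrier M" unfolding x using fc by (rule M.finsum_closed)
  ultimately show ?thesis
    using component_decomposition[OF xc] graded xc unfolding graded_module_def by blast
qed

lemma component_finsum:
  assumes x: "x \<in> carrier M" and K: "finite K" "{k. component x k \<noteq> \<zero>\<^bsub>M\<^esub>} \<subseteq> K"
  shows "x = finsum M (component x) K"
proof -
  have "finsum M (component x) {k. component x k \<noteq> \<zero>\<^bsub>M\<^esub>} = finsum M (component x) K"
    using K component_closed[OF x] by (intro M.add.finprod_mono_neutral_cong_left) auto
  then show ?thesis using component_decomposition[OF x] by simp
qed

lemma component_add:
  assumes x: "x \<in> carrier M" and y: "y \<in> carrier M"
  shows "component (x \<oplus>\<^bsub>M\<^esub> y) k = component x k \<oplus>\<^bsub>M\<^esub> component y k"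
proof -
  define K where "K = {k. component x k \<noteq> \<zero>\<^bsub>M\<^esub>} \<union> {k. component y k \<noteq> \<zero>\<^bsub>M\<^esub>}"
  have K: "finite K" unfolding K_def using finite_support x y by blast
  have sx: "finsum M (component x) K = x" using component_finsum[OF x K] unfolding K_def by simp
  have sy: "finsum M (component y) K = y" using component_finsum[OF y K] unfolding K_def by simp
  have "finsum M (\<lambda>k. component x k \<oplus>\<^bsub>M\<^esub> component y k) K = finsum M (component x) K \<oplus>\<^bsub>M\<^esub> finsum M (component y) K"
    using component_closed[OF x] component_closed[OF y] by (intro M.finsum_addf) auto
  then have "x \<oplus>\<^bsub>M\<^esub> y = finsum M (\<lambda>k. component x k \<oplus>\<^bsub>M\<^esub> component y k) K" by (simp only: sx sy)
  then have "component (x \<oplus>\<^bsub>M\<^esub> y) = (\<lambda>k. component x k \<oplus>\<^bsub>M\<^esub> component y k)"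
    using submoduleE(5)[OF piece_submodule component_piece[OF x] component_piece[OF y]]
    by (intro component_unique[OF K]) (auto simp: K_def)
  then show ?thesis by simp
qed

lemma component_of_piece:
  assumes x: "x \<in> G k"
  shows "component x l = (if l = k then x else \<zero>\<^bsub>M\<^esub>)"
proof -
  have "finsum M (\<lambda>l. if l = k then x else \<zero>\<^bsub>M\<^esub>) {k} = x"
    using piece_closed[OF x] by simp
  then have "component x = (\<lambda>l. if l = k then x else \<zero>\<^bsub>M\<^esub>)"
    using x piece_zero by (intro component_unique[of "{k}"]) auto
  then show ?thesis by simp
qed

lemma component_zero: "component \<zero>\<^bsub>M\<^esub> k = \<zero>\<^bsub>M\<^esub>"
  using component_of_piece[OF piece_zero, of k] by simp

lemma component_uminus: "x \<in> carrier M \<Longrightarrow> component (\<ominus>\<^bsub>M\<^esub> x) k = \<ominus>\<^bsub>M\<^esub> component x k"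
  using component_add[of "\<ominus>\<^bsub>M\<^esub> x" x k] component_closed
  by (simp add: M.l_neg component_zero M.minus_equality)

lemma component_smult:
  assumes a: "a \<in> carrier R" and x: "x \<in> carrier M"
  shows "component (a \<odot>\<^bsub>M\<^esub> x) k = a \<odot>\<^bsub>M\<^esub> component x k"
proof -
  let ?K = "{k. component x k \<noteq> \<zero>\<^bsub>M\<^esub>}"
  have K: "finite ?K" using finite_support x by blast
  have "finsum M (\<lambda>k. a \<odot>\<^bsub>M\<^esub> component x k) ?K = a \<odot>\<^bsub>M\<^esub> finsum M (component x) ?K"
    using K a component_closed[OF x] by (intro finsum_smult_ldistr[symmetric]) auto
  then have "component (a \<odot>\<^bsub>M\<^esub> x) = (\<lambda>k. a \<odot>\<^bsub>M\<^esub> component x k)"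
    using K submoduleE(4)[OF piece_submodule a] component_piece[OF x] a component_decomposition[OF x]
    by (intro component_unique[of ?K]) auto
  then show ?thesis by simp
qed

lemma mem_if_components_mem:
  assumes "additive_subgroup N M" "x \<in> carrier M" "\<And>k. component x k \<noteq> \<zero>\<^bsub>M\<^esub> \<Longrightarrow> component x k \<in> N"
  shows "x \<in> N"
proof -
  have "finsum M (component x) {k. component x k \<noteq> \<zero>\<^bsub>M\<^esub>} \<in> N"
    using assms by (intro M.finsum_in_subgroup) auto
  then show ?thesis using component_decomposition[OF assms(2)] by simp
qed

lemma carrier_subset_if_pieces:
  assumes "additive_subgroup N M" "\<And>k. G k \<subseteq> N"
  shows "carrier M \<subseteq> N"
  using mem_if_components_mem[OF assms(1)] component_piece assms(2) by blast

end

section \<open>The graded center\<close>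

text \<open>The bihomogeneous elements of the graded center.  The Leibniz rule applies to bihomogeneous elements, whereas
the graded center is defined by means of the total degree.\<close>

definition homogeneous_central ::
    "('r, 'a) module \<Rightarrow> (int \<times> int \<Rightarrow> 'a set) \<Rightarrow> 'a set" where
  "homogeneous_central A G = {c. \<exists>i j. c \<in> G (i, j) \<and>
     (\<forall>k l. \<forall>x\<in>G (k, l). c \<otimes>\<^bsub>A\<^esub> x = signed A ((i + j) * (k + l)) (x \<otimes>\<^bsub>A\<^esub> c))}"

definition even_central ::
    "('r, 'a) module \<Rightarrow> (int \<times> int \<Rightarrow> 'a set) \<Rightarrow> 'a set" where
  "even_central A G = {c. (\<exists>i j. even (i + j) \<and> c \<in> G (i, j)) \<and>
     (\<forall>x\<in>carrier A. c \<otimes>\<^bsub>A\<^esub> x = x \<otimes>\<^bsub>A\<^esub> c)}"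

locale bigraded = graded R A G + assoc_algebra R A
  for R :: "'r ring" (structure) and A :: "('r, 'a) module" and G :: "int \<times> int \<Rightarrow> 'a set" +
  assumes bigraded: "bigraded_algebra R A G"
begin

lemma mult_piece: "\<lbrakk>x \<in> G (i, j); y \<in> G (k, l)\<rbrakk> \<Longrightarrow> x \<otimes>\<^bsub>A\<^esub> y \<in> G (i + k, j + l)"
  using bigraded unfolding bigraded_algebra_def by blast

lemma A_group: "abelian_group A" ..

lemma component_mult_right:
  assumes c: "c \<in> carrier A" and x: "x \<in> G (k, l)"
  shows "component (c \<otimes>\<^bsub>A\<^esub> x) (p + k, q + l) = component c (p, q) \<otimes>\<^bsub>A\<^esub> x"
proof -
  have xc: "x \<in> carrier A" using piece_closed[OF x] .
  let ?N = "{c \<in> carrier A. component (c \<otimes>\<^bsub>A\<^esub> x) (p + k, q + l) = component c (p, q) \<otimes>\<^bsub>A\<^esub> x}"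
  have "additive_subgroup ?N A"
    using xc by (intro M.additive_subgroupI')
      (auto simp: component_zero component_add component_uminus component_closed l_distr l_minus)
  moreover have "G d \<subseteq> ?N" for d
  proof
    fix c assume c: "c \<in> G d"
    obtain i j where d: "d = (i, j)" by (cases d)
    show "c \<in> ?N"
      using component_of_piece[OF mult_piece[OF c[unfolded d] x]] component_of_piece[OF c] piece_closed[OF c] xc d
      by auto
  qed
  ultimately show ?thesis using carrier_subset_if_pieces c by blast
qed

lemma component_mult_left:
  assumes c: "c \<in> carrier A" and x: "x \<in> G (k, l)"
  shows "component (x \<otimes>\<^bsub>A\<^esub> c) (p + k, q + l) = x \<otimes>\<^bsub>A\<^esub> component c (p, q)"
proof -
  have xc: "x \<in> carrier A" using piece_closed[OF x] .
  let ?N = "{c \<in> carrier A. component (x \<otimes>\<^bsub>A\<^esub> c) (p + k, q + l) = x \<otimes>\<^bsub>A\<^esub> component c (p, q)}"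
  have "additive_subgroup ?N A"
    using xc by (intro M.additive_subgroupI')
      (auto simp: component_zero component_add component_uminus component_closed r_distr r_minus)
  moreover have "G d \<subseteq> ?N" for d
  proof
    fix c assume c: "c \<in> G d"
    obtain i j where d: "d = (i, j)" by (cases d)
    show "c \<in> ?N"
      using component_of_piece[OF mult_piece[OF x c[unfolded d]]] component_of_piece[OF c] piece_closed[OF c] xc d
      by (auto simp: add.commute)
  qed
  ultimately show ?thesis using carrier_subset_if_pieces c by blast
qed

lemma component_signed: "x \<in> carrier A \<Longrightarrow> component (signed A n x) k = signed A n (component x k)"
  by (simp add: signed_def component_uminus)

lemma total_degree_part_component:
  assumes c: "c \<in> total_degree_part R A G n" and pq: "p + q \<noteq> n"
  shows "c \<in> carrier A" "component c (p, q) = \<zero>\<^bsub>A\<^esub>"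
proof -
  let ?N = "{c \<in> carrier A. component c (p, q) = \<zero>\<^bsub>A\<^esub>}"
  have "stable_subgroup (carrier R) (\<lambda>a x. a \<odot>\<^bsub>A\<^esub> x) A ?N"
    by (rule stable_subgroupI[OF A_group])
      (auto simp: component_zero component_add component_uminus component_smult)
  moreover have "(\<Union>i. G (i, n - i)) \<subseteq> ?N"
    using pq piece_closed by (auto simp: component_of_piece)
  ultimately have "total_degree_part R A G n \<subseteq> ?N"
    unfolding total_degree_part_def linear_span_def by (rule generated_minimal)
  then show "c \<in> carrier A" "component c (p, q) = \<zero>\<^bsub>A\<^esub>" using c by auto
qed

lemma homogeneous_central_closed: "homogeneous_central A G \<subseteq> carrier A"
  unfolding homogeneous_central_def using piece_closed by blast

lemma zero_homogeneous_central: "\<zero>\<^bsub>A\<^esub> \<in> homogeneous_central A G"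
  unfolding homogeneous_central_def signed_def
  using piece_zero piece_closed by (auto intro!: exI[of _ 0])

text \<open>If \<open>c\<close> commutes up to sign with a bihomogeneous element \<open>x\<close>, then the components of \<open>c x\<close> and \<open>x c\<close> in each
bidegree agree up to the same sign.  So every bihomogeneous component of \<open>c\<close> commutes up to sign with \<open>x\<close>.\<close>

lemma graded_center_subset:
  "graded_center R A G \<subseteq> linear_span R A (homogeneous_central A G)"
  unfolding graded_center_def linear_span_def
proof (rule generated_minimal)
  let ?H = "homogeneous_central A G"
  let ?L = "generated (carrier R) (\<lambda>a x. a \<odot>\<^bsub>A\<^esub> x) A ?H"
  show L: "stable_subgroup (carrier R) (\<lambda>a x. a \<odot>\<^bsub>A\<^esub> x) A ?L"
    using homogeneous_central_closed A_group by (intro generated_stable) auto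
  show "{c. \<exists>n. c \<in> total_degree_part R A G n \<and>
     (\<forall>k. \<forall>x\<in>total_degree_part R A G k. c \<otimes>\<^bsub>A\<^esub> x = signed A (n * k) (x \<otimes>\<^bsub>A\<^esub> c))} \<subseteq> ?L"
  proof (rule subsetI, clarify)
    fix c n assume c: "c \<in> total_degree_part R A G n"
      and comm: "\<forall>k. \<forall>x\<in>total_degree_part R A G k. c \<otimes>\<^bsub>A\<^esub> x = signed A (n * k) (x \<otimes>\<^bsub>A\<^esub> c)"
    have cc: "c \<in> carrier A" using total_degree_part_component(1)[OF c, of "n + 1" 0] by simp
    have "component c k \<in> ?H" for k
    proof (cases k)
      case (Pair p q)
      show ?thesis
      proof (cases "p + q = n")
        case False
        then show ?thesis using total_degree_part_component(2)[OF c] zero_homogeneous_central Pair by simp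
      next
        case True
        have "component c (p, q) \<otimes>\<^bsub>A\<^esub> x = signed A ((p + q) * (i + j)) (x \<otimes>\<^bsub>A\<^esub> component c (p, q))"
          if x: "x \<in> G (i, j)" for i j x
        proof -
          have "x \<in> G (i, (i + j) - i)" using x by simp
          then have "x \<in> (\<Union>i'. G (i', (i + j) - i'))" by blast
          then have "x \<in> total_degree_part R A G (i + j)"
            unfolding total_degree_part_def linear_span_def by (rule subsetD[OF generated_superset])
          then have "c \<otimes>\<^bsub>A\<^esub> x = signed A (n * (i + j)) (x \<otimes>\<^bsub>A\<^esub> c)" using comm by blast
          then have "component (c \<otimes>\<^bsub>A\<^esub> x) (p + i, q + j) = signed A (n * (i + j)) (component (x \<otimes>\<^bsub>A\<^esub> c) (p + i, q + j))"
            using cc piece_closed[OF x] by (simp add: component_signed)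
          then show ?thesis
            using True by (simp add: component_mult_right[OF cc x] component_mult_left[OF cc x])
        qed
        then show ?thesis unfolding homogeneous_central_def Pair using component_piece[OF cc] by blast
      qed
    qed
    then have "component c k \<in> ?L" for k by (rule subsetD[OF generated_superset])
    then show "c \<in> ?L"
      using mem_if_components_mem[of ?L c] L[unfolded stable_subgroup_def] cc by blast
  qed
qed


lemma even_central_closed: "even_central A G \<subseteq> carrier A"
  unfolding even_central_def using piece_closed by blast

lemma homogeneous_central_commute:
  assumes "c \<in> homogeneous_central A G" "x \<in> G k"
  shows "c \<otimes>\<^bsub>A\<^esub> x = x \<otimes>\<^bsub>A\<^esub> c \<or> c \<otimes>\<^bsub>A\<^esub> x = \<ominus>\<^bsub>A\<^esub> (x \<otimes>\<^bsub>A\<^esub> c)"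
  using assms unfolding homogeneous_central_def signed_def by (cases k) (auto split: if_splits)

text \<open>Moving \<open>c\<close> past an element \<open>x\<close> twice produces the same sign twice.\<close>

lemma square_even_central:
  assumes c: "c \<in> homogeneous_central A G"
  shows "c \<otimes>\<^bsub>A\<^esub> c \<in> even_central A G"
proof -
  have cc: "c \<in> carrier A" using c homogeneous_central_closed by blast
  obtain i j where "c \<in> G (i, j)" using c unfolding homogeneous_central_def by blast
  then have "c \<otimes>\<^bsub>A\<^esub> c \<in> G (i + i, j + j)" by (intro mult_piece)
  moreover have "even ((i + i) + (j + j))" by simp
  moreover have "carrier A \<subseteq> {x \<in> carrier A. c \<otimes>\<^bsub>A\<^esub> c \<otimes>\<^bsub>A\<^esub> x = x \<otimes>\<^bsub>A\<^esub> (c \<otimes>\<^bsub>A\<^esub> c)}"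
  proof (rule carrier_subset_if_pieces)
    show "additive_subgroup {x \<in> carrier A. c \<otimes>\<^bsub>A\<^esub> c \<otimes>\<^bsub>A\<^esub> x = x \<otimes>\<^bsub>A\<^esub> (c \<otimes>\<^bsub>A\<^esub> c)} A"
      using cc by (intro M.additive_subgroupI') (auto simp: l_distr r_distr l_minus r_minus)
    show "G k \<subseteq> {x \<in> carrier A. c \<otimes>\<^bsub>A\<^esub> c \<otimes>\<^bsub>A\<^esub> x = x \<otimes>\<^bsub>A\<^esub> (c \<otimes>\<^bsub>A\<^esub> c)}" for k
    proof
      fix x assume x: "x \<in> G k"
      then have xc: "x \<in> carrier A" by (rule piece_closed)
      have "c \<otimes>\<^bsub>A\<^esub> c \<otimes>\<^bsub>A\<^esub> x = c \<otimes>\<^bsub>A\<^esub> (c \<otimes>\<^bsub>A\<^esub> x)" using cc xc by (simp add: m_assoc)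
      also have "\<dots> = c \<otimes>\<^bsub>A\<^esub> x \<otimes>\<^bsub>A\<^esub> c \<or> \<dots> = \<ominus>\<^bsub>A\<^esub> (c \<otimes>\<^bsub>A\<^esub> x \<otimes>\<^bsub>A\<^esub> c)"
        using homogeneous_central_commute[OF c x] cc xc by (auto simp: m_assoc r_minus)
      finally have "c \<otimes>\<^bsub>A\<^esub> c \<otimes>\<^bsub>A\<^esub> x = x \<otimes>\<^bsub>A\<^esub> c \<otimes>\<^bsub>A\<^esub> c"
        using homogeneous_central_commute[OF c x] cc xc
        by (smt (verit) M.minus_minus l_minus m_assoc m_closed r_minus)
      then show "x \<in> {x \<in> carrier A. c \<otimes>\<^bsub>A\<^esub> c \<otimes>\<^bsub>A\<^esub> x = x \<otimes>\<^bsub>A\<^esub> (c \<otimes>\<^bsub>A\<^esub> c)}"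
        using xc cc by (simp add: m_assoc)
    qed
  qed
  ultimately show ?thesis unfolding even_central_def by blast
qed

lemma even_central_power:
  assumes "s \<in> even_central A G"
  shows "s [^]\<^bsub>A\<^esub> (n::nat) \<in> even_central A G"
proof (induction n)
  case 0
  have "\<one>\<^bsub>A\<^esub> \<in> G (0, 0)" using bigraded unfolding bigraded_algebra_def by blast
  then show ?case unfolding even_central_def by (auto intro!: exI[of _ 0])
next
  case (Suc n)
  obtain i j k l where d: "s \<in> G (i, j)" "even (i + j)" "s [^]\<^bsub>A\<^esub> n \<in> G (k, l)" "even (k + l)"
    and cs: "\<And>x. x \<in> carrier A \<Longrightarrow> s \<otimes>\<^bsub>A\<^esub> x = x \<otimes>\<^bsub>A\<^esub> s"
    and cn: "\<And>x. x \<in> carrier A \<Longrightarrow> s [^]\<^bsub>A\<^esub> n \<otimes>\<^bsub>A\<^esub> x = x \<otimes>\<^bsub>A\<^esub> s [^]\<^bsub>A\<^esub> n"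
    using assms Suc unfolding even_central_def by blast
  have sc: "s \<in> carrier A" using d(1) piece_closed by blast
  have "s [^]\<^bsub>A\<^esub> Suc n \<in> G (k + i, l + j)" using mult_piece[OF d(3,1)] by simp
  moreover have "even ((k + i) + (l + j))" using d(2,4) by simp
  moreover have "s [^]\<^bsub>A\<^esub> Suc n \<otimes>\<^bsub>A\<^esub> x = x \<otimes>\<^bsub>A\<^esub> s [^]\<^bsub>A\<^esub> Suc n" if x: "x \<in> carrier A" for x
  proof -
    have "s [^]\<^bsub>A\<^esub> Suc n \<otimes>\<^bsub>A\<^esub> x = s [^]\<^bsub>A\<^esub> n \<otimes>\<^bsub>A\<^esub> (s \<otimes>\<^bsub>A\<^esub> x)" using sc x by (simp add: m_assoc)
    also have "\<dots> = (s [^]\<^bsub>A\<^esub> n \<otimes>\<^bsub>A\<^esub> x) \<otimes>\<^bsub>A\<^esub> s" unfolding cs[OF x] using sc x by (simp add: m_assoc)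
    also have "\<dots> = x \<otimes>\<^bsub>A\<^esub> s [^]\<^bsub>A\<^esub> Suc n" unfolding cn[OF x] using sc x by (simp add: m_assoc)
    finally show ?thesis .
  qed
  ultimately show ?case unfolding even_central_def by blast
qed

text \<open>A linear combination of elements of \<open>F\<close> involves finitely many coefficients from the graded center, and each of them is a
linear combination of finitely many bihomogeneous ones.\<close>

lemma center_span_element:
  assumes F: "F \<subseteq> carrier A"
    and gen: "carrier A = generated (graded_center R A G) (mult A) A F"
    and x: "x \<in> carrier A"
  shows "\<exists>S. finite S \<and> S \<subseteq> homogeneous_central A G \<and> x \<in> op_span (scalars R (mult A) A S) A F"
proof -
  interpret L: left_module R A "mult A" A
    by (rule assoc_algebra_is_left_module) (rule assoc_algebra_axioms)
  let ?sp = "\<lambda>S. op_span (scalars R (mult A) A S) A F"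
  let ?H = "homogeneous_central A G"
  define W where "W = {x \<in> carrier A. \<exists>S. finite S \<and> S \<subseteq> ?H \<and> x \<in> ?sp S}"
  have WI: "x \<in> W" if "x \<in> carrier A" "finite S" "S \<subseteq> ?H" "x \<in> ?sp S" for x S
    using that unfolding W_def by blast
  have WE: "\<exists>S. finite S \<and> S \<subseteq> ?H \<and> x \<in> ?sp S" if "x \<in> W" for x
    using that unfolding W_def by blast
  have Wc: "x \<in> carrier A" if "x \<in> W" for x using that unfolding W_def by blast
  have sp: "op_stable (scalars R (mult A) A S) A (?sp S)" if "S \<subseteq> ?H" for S
    using operator_group.span_stable[OF L.scalars_operator_group F] that homogeneous_central_closed
    by blast
  have mono: "?sp S \<subseteq> ?sp T" if "S \<subseteq> T" for S T using that by (intro generated_mono) auto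
  have W: "stable_subgroup ?H (mult A) A W"
  proof (rule stable_subgroupI[OF A_group])
    show "\<zero>\<^bsub>A\<^esub> \<in> W" using stable_zero[OF sp[of "{}"]] by (intro WI[of _ "{}"]) auto
    fix x assume "x \<in> W"
    then obtain S where S: "x \<in> carrier A" "finite S" "S \<subseteq> ?H" "x \<in> ?sp S" using WE Wc by blast
    show "\<ominus>\<^bsub>A\<^esub> x \<in> W" using stable_uminus[OF sp[OF S(3)] A_group S(4)] S(1-3) by (intro WI) auto
    { fix y assume "y \<in> W"
      then obtain T where T: "y \<in> carrier A" "finite T" "T \<subseteq> ?H" "y \<in> ?sp T" using WE Wc by blast
      have "x \<in> ?sp (S \<union> T)" "y \<in> ?sp (S \<union> T)" using S T mono[of S "S \<union> T"] mono[of T "S \<union> T"] by auto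
      then have "x \<oplus>\<^bsub>A\<^esub> y \<in> ?sp (S \<union> T)" using S T by (intro stable_add[OF sp]) auto
      then show "x \<oplus>\<^bsub>A\<^esub> y \<in> W" using S(1-3) T(1-3) by (intro WI[of _ "S \<union> T"]) auto }
    { fix c assume c: "c \<in> ?H"
      have "x \<in> ?sp (insert c S)" using S mono[of S "insert c S"] by auto
      then have "c \<otimes>\<^bsub>A\<^esub> x \<in> ?sp (insert c S)"
        using stable_act[OF sp[of "insert c S"], of "mult A c" x] S c by auto
      moreover have "c \<otimes>\<^bsub>A\<^esub> x \<in> carrier A" using c S homogeneous_central_closed by blast
      ultimately show "c \<otimes>\<^bsub>A\<^esub> x \<in> W" using S(1-3) c by (intro WI[of _ "insert c S"]) auto }
  qed (use Wc in blast)
  have Wsm: "a \<odot>\<^bsub>A\<^esub> x \<in> W" if xW: "x \<in> W" and a: "a \<in> carrier R" for a x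
  proof -
    obtain S where S: "x \<in> carrier A" "finite S" "S \<subseteq> ?H" "x \<in> ?sp S" using WE[OF xW] Wc[OF xW] by blast
    then have "a \<odot>\<^bsub>A\<^esub> x \<in> ?sp S" using stable_act[OF sp[OF S(3)], of "\<lambda>x. a \<odot>\<^bsub>A\<^esub> x" x] a by auto
    then show ?thesis using S(1-3) a by (intro WI[of _ S]) auto
  qed
  have "linear_span R A ?H \<subseteq> {c \<in> carrier A. \<forall>x\<in>W. c \<otimes>\<^bsub>A\<^esub> x \<in> W}"
    unfolding linear_span_def
  proof (rule generated_minimal)
    show "?H \<subseteq> {c \<in> carrier A. \<forall>x\<in>W. c \<otimes>\<^bsub>A\<^esub> x \<in> W}"
      using homogeneous_central_closed stable_act[OF W] by blast
    show "stable_subgroup (carrier R) (\<lambda>a x. a \<odot>\<^bsub>A\<^esub> x) A {c \<in> carrier A. \<forall>x\<in>W. c \<otimes>\<^bsub>A\<^esub> x \<in> W}"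
    proof (rule stable_subgroupI[OF A_group])
      show "\<zero>\<^bsub>A\<^esub> \<in> {c \<in> carrier A. \<forall>x\<in>W. c \<otimes>\<^bsub>A\<^esub> x \<in> W}"
        using stable_zero[OF W] Wc by simp
    next
      fix c d assume c: "c \<in> {c \<in> carrier A. \<forall>x\<in>W. c \<otimes>\<^bsub>A\<^esub> x \<in> W}"
        and d: "d \<in> {c \<in> carrier A. \<forall>x\<in>W. c \<otimes>\<^bsub>A\<^esub> x \<in> W}"
      have "(c \<oplus>\<^bsub>A\<^esub> d) \<otimes>\<^bsub>A\<^esub> x \<in> W" if x: "x \<in> W" for x
      proof -
        have "(c \<oplus>\<^bsub>A\<^esub> d) \<otimes>\<^bsub>A\<^esub> x = c \<otimes>\<^bsub>A\<^esub> x \<oplus>\<^bsub>A\<^esub> d \<otimes>\<^bsub>A\<^esub> x"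
          using c d Wc[OF x] by (intro l_distr) blast+
        moreover have "c \<otimes>\<^bsub>A\<^esub> x \<in> W" "d \<otimes>\<^bsub>A\<^esub> x \<in> W" using c d x by blast+
        ultimately show ?thesis using stable_add[OF W] by presburger
      qed
      then show "c \<oplus>\<^bsub>A\<^esub> d \<in> {c \<in> carrier A. \<forall>x\<in>W. c \<otimes>\<^bsub>A\<^esub> x \<in> W}" using c d by blast
    next
      fix c assume c: "c \<in> {c \<in> carrier A. \<forall>x\<in>W. c \<otimes>\<^bsub>A\<^esub> x \<in> W}"
      have "(\<ominus>\<^bsub>A\<^esub> c) \<otimes>\<^bsub>A\<^esub> x \<in> W" if x: "x \<in> W" for x
      proof -
        have "(\<ominus>\<^bsub>A\<^esub> c) \<otimes>\<^bsub>A\<^esub> x = \<ominus>\<^bsub>A\<^esub> (c \<otimes>\<^bsub>A\<^esub> x)" using c Wc[OF x] by (intro l_minus) blast+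
        moreover have "c \<otimes>\<^bsub>A\<^esub> x \<in> W" using c x by blast
        ultimately show ?thesis using stable_uminus[OF W A_group] by presburger
      qed
      then show "\<ominus>\<^bsub>A\<^esub> c \<in> {c \<in> carrier A. \<forall>x\<in>W. c \<otimes>\<^bsub>A\<^esub> x \<in> W}" using c by blast
      fix a assume a: "a \<in> carrier R"
      have "(a \<odot>\<^bsub>A\<^esub> c) \<otimes>\<^bsub>A\<^esub> x \<in> W" if x: "x \<in> W" for x
      proof -
        have "(a \<odot>\<^bsub>A\<^esub> c) \<otimes>\<^bsub>A\<^esub> x = a \<odot>\<^bsub>A\<^esub> (c \<otimes>\<^bsub>A\<^esub> x)"
          using a c Wc[OF x] by (intro smult_mult_left) blast+
        moreover have "c \<otimes>\<^bsub>A\<^esub> x \<in> W" using c x by blast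
        ultimately show ?thesis using Wsm[OF _ a] by presburger
      qed
      then show "a \<odot>\<^bsub>A\<^esub> c \<in> {c \<in> carrier A. \<forall>x\<in>W. c \<otimes>\<^bsub>A\<^esub> x \<in> W}" using a c by blast
    qed blast
  qed
  then have "stable_subgroup (graded_center R A G) (mult A) A W"
    using W graded_center_subset unfolding stable_subgroup_def by blast
  moreover have "F \<subseteq> W"
  proof
    fix x assume x: "x \<in> F"
    then have "x \<in> ?sp {}" by (rule subsetD[OF generated_superset])
    then show "x \<in> W" using x F by (intro WI[of _ "{}"]) auto
  qed
  ultimately have "carrier A \<subseteq> W" by (subst gen) (rule generated_minimal)
  then show ?thesis using x WE by blast
qed

text \<open>The argument of Artin and Tate.  Let \<open>T'\<close> be a finite set of homogeneous generators of the algebra, and let \<open>F'\<close> consist of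
generators over the graded center and of the unit.  Write every product \<open>t f\<close> with \<open>t \<in> T'\<close> and \<open>f \<in> F'\<close> as a
combination of elements of \<open>F\<close>, and let \<open>S0\<close> be the set of the coefficients.  The span \<open>N\<close> of \<open>F'\<close> over \<open>R[S0]\<close>
is stable under left multiplication by \<open>T'\<close>, since elements of \<open>T'\<close> and \<open>S0\<close> commute up to sign.  Hence it is a left ideal; as it
contains the unit, it is everything.\<close>

lemma finite_over_homogeneous_central:
  assumes fga: "finitely_generated_algebra R A"
    and fgm: "finitely_generated (graded_center R A G) (mult A) A (carrier A)"
  shows "\<exists>S. finite S \<and> S \<subseteq> homogeneous_central A G \<and> op_fg (scalars R (mult A) A S) A (carrier A)"
proof -
  interpret L: left_module R A "mult A" A
    by (rule assoc_algebra_is_left_module) (rule assoc_algebra_axioms)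
  let ?H = "homogeneous_central A G"
  obtain T where T: "T \<subseteq> carrier A" "finite T" 
    and TA: "carrier A = \<Inter>{B. submodule B R A \<and> \<one>\<^bsub>A\<^esub> \<in> B \<and> (\<forall>x\<in>B. \<forall>y\<in>B. x \<otimes>\<^bsub>A\<^esub> y \<in> B) \<and> T \<subseteq> B}"
    using fga unfolding finitely_generated_algebra_def by blast
  obtain F where F: "F \<subseteq> carrier A" "finite F" "carrier A = generated (graded_center R A G) (mult A) A F"
    using fgm unfolding finitely_generated_def by blast
  define T' where "T' = (\<Union>t\<in>T. component t ` {k. component t k \<noteq> \<zero>\<^bsub>A\<^esub>})"
  have T': "finite T'" unfolding T'_def using T finite_support by blast
  have T'_hom: "\<exists>k. t \<in> G k" if "t \<in> T'" for t
    using that T component_piece unfolding T'_def by blast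
  have T'c: "t \<in> carrier A" if "t \<in> T'" for t using T'_hom[OF that] piece_closed by blast
  define F' where "F' = insert \<one>\<^bsub>A\<^esub> F"
  have F': "finite F'" "F' \<subseteq> carrier A" unfolding F'_def using F(1,2) by auto
  have "\<forall>t\<in>T'. \<forall>f\<in>F'. \<exists>S. finite S \<and> S \<subseteq> ?H \<and> t \<otimes>\<^bsub>A\<^esub> f \<in> op_span (scalars R (mult A) A S) A F"
    by (intro ballI center_span_element[OF F(1,3)] m_closed T'c subsetD[OF F'(2)])
  then obtain S where S: "\<And>t f. \<lbrakk>t \<in> T'; f \<in> F'\<rbrakk> \<Longrightarrow> finite (S t f) \<and> S t f \<subseteq> ?H \<and>
      t \<otimes>\<^bsub>A\<^esub> f \<in> op_span (scalars R (mult A) A (S t f)) A F" by metis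
  define S0 where "S0 = (\<Union>t\<in>T'. \<Union>f\<in>F'. S t f)"
  have S0: "finite S0" "S0 \<subseteq> ?H" unfolding S0_def using S T' F'(1) by auto
  let ?N = "op_span (scalars R (mult A) A S0) A F'"
  have N: "op_stable (scalars R (mult A) A S0) A ?N"
    using operator_group.span_stable[OF L.scalars_operator_group F'(2)] S0 homogeneous_central_closed
    by blast
  note Nc = subsetD[OF stable_subset[OF N]]
  have tN: "?N \<subseteq> {x \<in> ?N. t \<otimes>\<^bsub>A\<^esub> x \<in> ?N}" if t: "t \<in> T'" for t
  proof (rule generated_minimal)
    show "F' \<subseteq> {x \<in> ?N. t \<otimes>\<^bsub>A\<^esub> x \<in> ?N}"
    proof
      fix f assume f: "f \<in> F'"
      have "op_span (scalars R (mult A) A (S t f)) A F \<subseteq> ?N"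
        using t f unfolding S0_def F'_def by (intro generated_mono) auto
      then have "t \<otimes>\<^bsub>A\<^esub> f \<in> ?N" using S[OF t f] by blast
      moreover have "f \<in> ?N" using f by (rule subsetD[OF generated_superset])
      ultimately show "f \<in> {x \<in> ?N. t \<otimes>\<^bsub>A\<^esub> x \<in> ?N}" by blast
    qed
    have tc: "t \<in> carrier A" using T'c[OF t] .
    show "op_stable (scalars R (mult A) A S0) A {x \<in> ?N. t \<otimes>\<^bsub>A\<^esub> x \<in> ?N}"
    proof (rule stable_subgroupI[OF A_group])
      fix g x assume g: "g \<in> scalars R (mult A) A S0" and "x \<in> {x \<in> ?N. t \<otimes>\<^bsub>A\<^esub> x \<in> ?N}"
      then have x: "x \<in> ?N" "t \<otimes>\<^bsub>A\<^esub> x \<in> ?N" by auto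
      have gN: "g x \<in> ?N" "g (t \<otimes>\<^bsub>A\<^esub> x) \<in> ?N" using stable_act[OF N g] x by auto
      have "t \<otimes>\<^bsub>A\<^esub> g x = g (t \<otimes>\<^bsub>A\<^esub> x) \<or> t \<otimes>\<^bsub>A\<^esub> g x = \<ominus>\<^bsub>A\<^esub> g (t \<otimes>\<^bsub>A\<^esub> x)"
      proof -
        consider a where "a \<in> carrier R" "g = (\<lambda>x. a \<odot>\<^bsub>A\<^esub> x)" | c where "c \<in> S0" "g = mult A c"
          using g by blast
        then show ?thesis
        proof cases
          case 1
          then show ?thesis using tc Nc[OF x(1)] by (simp add: smult_mult_right)
        next
          case 2
          then have cH: "c \<in> ?H" using S0 by blast
          then have cc: "c \<in> carrier A" using homogeneous_central_closed by blast
          obtain k where "t \<in> G k" using T'_hom[OF t] by blast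
          then have "c \<otimes>\<^bsub>A\<^esub> t = t \<otimes>\<^bsub>A\<^esub> c \<or> c \<otimes>\<^bsub>A\<^esub> t = \<ominus>\<^bsub>A\<^esub> (t \<otimes>\<^bsub>A\<^esub> c)"
            by (rule homogeneous_central_commute[OF cH])
          then have "c \<otimes>\<^bsub>A\<^esub> t \<otimes>\<^bsub>A\<^esub> x = t \<otimes>\<^bsub>A\<^esub> c \<otimes>\<^bsub>A\<^esub> x \<or> c \<otimes>\<^bsub>A\<^esub> t \<otimes>\<^bsub>A\<^esub> x = \<ominus>\<^bsub>A\<^esub> (t \<otimes>\<^bsub>A\<^esub> c \<otimes>\<^bsub>A\<^esub> x)"
            using cc tc Nc[OF x(1)] by (auto simp: l_minus)
          then show ?thesis using 2 cc tc Nc[OF x(1)] by (auto simp: m_assoc)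
        qed
      qed
      then have "t \<otimes>\<^bsub>A\<^esub> g x \<in> ?N" using gN(2) stable_uminus[OF N A_group gN(2)] by metis
      then show "g x \<in> {x \<in> ?N. t \<otimes>\<^bsub>A\<^esub> x \<in> ?N}" using gN by blast
    qed (use tc Nc stable_zero[OF N] stable_add[OF N] stable_uminus[OF N A_group] in
        \<open>auto simp: r_distr r_minus\<close>)
  qed
  let ?B = "{a \<in> carrier A. \<forall>x\<in>?N. a \<otimes>\<^bsub>A\<^esub> x \<in> ?N}"
  have B: "submodule ?B R A"
  proof (rule submoduleI)
    fix a b assume a: "a \<in> carrier R" and b: "b \<in> ?B"
    have "(a \<odot>\<^bsub>A\<^esub> b) \<otimes>\<^bsub>A\<^esub> x \<in> ?N" if "x \<in> ?N" for x
      using stable_act[OF N, of "\<lambda>x. a \<odot>\<^bsub>A\<^esub> x" "b \<otimes>\<^bsub>A\<^esub> x"] a b that Nc[OF that]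
      by (auto simp: smult_mult_left)
    then show "a \<odot>\<^bsub>A\<^esub> b \<in> ?B" using a b by blast
  qed (use Nc stable_zero[OF N] stable_add[OF N] stable_uminus[OF N A_group] in
        \<open>auto simp: l_distr l_minus\<close>)
  have "\<one>\<^bsub>A\<^esub> \<in> ?B" using Nc by auto
  moreover have "\<forall>x\<in>?B. \<forall>y\<in>?B. x \<otimes>\<^bsub>A\<^esub> y \<in> ?B" using Nc by (auto simp: m_assoc)
  moreover have "T \<subseteq> ?B"
  proof
    fix t assume t: "t \<in> T"
    then have "component t k \<in> ?B" if "component t k \<noteq> \<zero>\<^bsub>A\<^esub>" for k
      using that tN[of "component t k"] T'c[of "component t k"] unfolding T'_def by blast
    moreover have "additive_subgroup ?B A" using submodule.axioms(1)[OF B] additive_subgroupI by blast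
    ultimately show "t \<in> ?B" using mem_if_components_mem[of ?B t] t T(1) by blast
  qed
  ultimately have "?B \<in> {B. submodule B R A \<and> \<one>\<^bsub>A\<^esub> \<in> B \<and> (\<forall>x\<in>B. \<forall>y\<in>B. x \<otimes>\<^bsub>A\<^esub> y \<in> B) \<and> T \<subseteq> B}"
    using B by blast
  then have AB: "carrier A \<subseteq> ?B" by (subst TA) (rule Inter_lower)
  have one: "\<one>\<^bsub>A\<^esub> \<in> ?N" by (rule subsetD[OF generated_superset]) (simp add: F'_def)
  have "carrier A \<subseteq> ?N"
  proof
    fix x assume x: "x \<in> carrier A"
    then have "x \<otimes>\<^bsub>A\<^esub> \<one>\<^bsub>A\<^esub> \<in> ?N" using AB one by blast
    then show "x \<in> ?N" using x by simp
  qed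
  then have "carrier A = ?N" using Nc by blast
  then have "op_fg (scalars R (mult A) A S0) A (carrier A)"
    unfolding finitely_generated_def using F' by blast
  then show ?thesis using S0 by blast
qed

text \<open>Multiplications by homogeneous elements of the graded center commute up to sign with each other, so
that they can be replaced by their squares.\<close>

lemma finite_over_even_central:
  assumes "finitely_generated_algebra R A"
    and "finitely_generated (graded_center R A G) (mult A) A (carrier A)"
  shows "\<exists>S. finite S \<and> S \<subseteq> even_central A G \<and> op_fg (scalars R (mult A) A S) A (carrier A)"
proof -
  interpret L: left_module R A "mult A" A
    by (rule assoc_algebra_is_left_module) (rule assoc_algebra_axioms)
  obtain S where S: "finite S" "S \<subseteq> homogeneous_central A G" "op_fg (scalars R (mult A) A S) A (carrier A)"
    using finite_over_homogeneous_central[OF assms] by blast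
  have Sc: "S \<subseteq> carrier A" using S(2) homogeneous_central_closed by blast
  define h where "h = (\<lambda>s. mult A (s \<otimes>\<^bsub>A\<^esub> s))"
  have "op_fg (smults R A \<union> h ` S) A (carrier A)"
  proof (rule fg_replace_by_powers[where g = "mult A" and k = 2])
    show "operator_group A (scalars R (mult A) A S)" by (rule L.scalars_operator_group[OF Sc])
    fix s x assume s: "s \<in> S" and x: "x \<in> carrier A"
    then have sc: "s \<in> carrier A" using Sc by blast
    show "h s x = (mult A s ^^ 2) x" using sc x by (simp add: h_def numeral_2_eq_2 m_assoc)
    fix f assume "f \<in> scalars R (mult A) A S"
    then consider a where "a \<in> carrier R" "f = (\<lambda>x. a \<odot>\<^bsub>A\<^esub> x)" | c where "c \<in> S" "f = mult A c"
      by blast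
    then show "s \<otimes>\<^bsub>A\<^esub> f x = f (s \<otimes>\<^bsub>A\<^esub> x) \<or> s \<otimes>\<^bsub>A\<^esub> f x = \<ominus>\<^bsub>A\<^esub> f (s \<otimes>\<^bsub>A\<^esub> x)"
    proof cases
      case 1
      then show ?thesis using sc x by (simp add: smult_mult_right)
    next
      case 2
      then obtain k where "c \<in> G k" using S(2) unfolding homogeneous_central_def by blast
      then have "s \<otimes>\<^bsub>A\<^esub> c = c \<otimes>\<^bsub>A\<^esub> s \<or> s \<otimes>\<^bsub>A\<^esub> c = \<ominus>\<^bsub>A\<^esub> (c \<otimes>\<^bsub>A\<^esub> s)"
        using homogeneous_central_commute s S(2) by blast
      moreover have cc: "c \<in> carrier A" using 2 Sc by blast
      ultimately have "s \<otimes>\<^bsub>A\<^esub> c \<otimes>\<^bsub>A\<^esub> x = c \<otimes>\<^bsub>A\<^esub> s \<otimes>\<^bsub>A\<^esub> x \<or> s \<otimes>\<^bsub>A\<^esub> c \<otimes>\<^bsub>A\<^esub> x = \<ominus>\<^bsub>A\<^esub> (c \<otimes>\<^bsub>A\<^esub> s \<otimes>\<^bsub>A\<^esub> x)"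
        using sc x by (auto simp: l_minus)
      then show ?thesis using 2 sc cc x by (auto simp: m_assoc)
    qed
  qed (use S in auto)
  moreover have "h ` S = mult A ` (\<lambda>s. s \<otimes>\<^bsub>A\<^esub> s) ` S" unfolding h_def by auto
  ultimately show ?thesis
    using S(1,2) square_even_central
    by (intro exI[of _ "(\<lambda>s. s \<otimes>\<^bsub>A\<^esub> s) ` S"]) auto
qed

end

section \<open>Passing to the next page\<close>

definition next_page :: "('r, 'a) spectral_seq \<Rightarrow> nat \<Rightarrow> 'a \<Rightarrow> 'a" where
  "next_page E r x = Ident E r (hclass E r x)"

context spectral_sequence
begin

lemma page_graded_locale: "r \<ge> 1 \<Longrightarrow> graded R (Page E r) (Piece E r)"
  using page_graded[of r] unfolding graded_def graded_axioms_def plain_module_def graded_module_def by blast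

lemma page_plain_module: "r \<ge> 1 \<Longrightarrow> plain_module R (Page E r)"
  using page_graded_locale graded_def by blast

lemma page_module: "r \<ge> 1 \<Longrightarrow> module R (Page E r)"
  using page_plain_module plain_module_def by blast

lemma page_group: "r \<ge> 1 \<Longrightarrow> abelian_group (Page E r)"
  using page_module module.axioms(2) by blast

lemma diff_closed: "\<lbrakk>r \<ge> 1; x \<in> carrier (Page E r)\<rbrakk> \<Longrightarrow> Diff E r x \<in> carrier (Page E r)"
  using diff_linear unfolding linear_map_def by blast

lemma diff_add: "\<lbrakk>r \<ge> 1; x \<in> carrier (Page E r); y \<in> carrier (Page E r)\<rbrakk> \<Longrightarrow>
    Diff E r (x \<oplus>\<^bsub>Page E r\<^esub> y) = Diff E r x \<oplus>\<^bsub>Page E r\<^esub> Diff E r y"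
  using diff_linear unfolding linear_map_def by blast

lemma diff_smult: "\<lbrakk>r \<ge> 1; a \<in> carrier R; x \<in> carrier (Page E r)\<rbrakk> \<Longrightarrow>
    Diff E r (a \<odot>\<^bsub>Page E r\<^esub> x) = a \<odot>\<^bsub>Page E r\<^esub> Diff E r x"
  using diff_linear unfolding linear_map_def by blast

lemma diff_operator_group: "r \<ge> 1 \<Longrightarrow> operator_group (Page E r) {Diff E r}"
  using page_group diff_closed diff_add
  by (intro operator_group.intro operator_group_axioms.intro) auto

lemma diff_zero: "r \<ge> 1 \<Longrightarrow> Diff E r \<zero>\<^bsub>Page E r\<^esub> = \<zero>\<^bsub>Page E r\<^esub>"
  using operator_group.op_zero[OF diff_operator_group] by blast

lemma diff_uminus: "\<lbrakk>r \<ge> 1; x \<in> carrier (Page E r)\<rbrakk> \<Longrightarrow>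
    Diff E r (\<ominus>\<^bsub>Page E r\<^esub> x) = \<ominus>\<^bsub>Page E r\<^esub> Diff E r x"
  using operator_group.op_uminus[OF diff_operator_group] by blast

lemma cycles_submodule:
  assumes r: "r \<ge> 1"
  shows "submodule (Cycles E r) R (Page E r)"
proof -
  interpret module R "Page E r" using page_module[OF r] .
  show ?thesis
    unfolding Cycles_def using r
    by (intro submoduleI) (auto simp: diff_zero diff_uminus diff_add diff_smult)
qed

lemma boundaries_submodule:
  assumes r: "r \<ge> 1"
  shows "submodule (Boundaries E r) R (Page E r)"
proof -
  interpret module R "Page E r" using page_module[OF r] .
  show ?thesis
  proof (rule submoduleI)
    show "\<zero>\<^bsub>Page E r\<^esub> \<in> Boundaries E r"
      unfolding Boundaries_def using diff_zero[OF r] M.zero_closed by (metis imageI)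
    show "Boundaries E r \<subseteq> carrier (Page E r)"
      unfolding Boundaries_def using diff_closed[OF r] by blast
  qed (auto simp: Boundaries_def diff_uminus[OF r, symmetric] diff_add[OF r, symmetric]
        diff_smult[OF r, symmetric] intro!: imageI)
qed

lemma boundaries_cycles: "r \<ge> 1 \<Longrightarrow> Boundaries E r \<subseteq> Cycles E r"
  unfolding Boundaries_def Cycles_def using diff_diff diff_closed by auto

lemma homology_subquotient:
  "r \<ge> 1 \<Longrightarrow> subquotient_module R (Page E r) (Cycles E r) (Boundaries E r)"
  using page_plain_module cycles_submodule boundaries_submodule boundaries_cycles
  by (intro subquotient_module.intro subquotient_module_axioms.intro)

lemma next_page_add:
  assumes r: "r \<ge> 1" and x: "x \<in> Cycles E r" "y \<in> Cycles E r"
  shows "next_page E r (x \<oplus>\<^bsub>Page E r\<^esub> y) = next_page E r x \<oplus>\<^bsub>Page E (Suc r)\<^esub> next_page E r y"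
proof -
  interpret subquotient_module R "Page E r" "Cycles E r" "Boundaries E r"
    by (rule homology_subquotient[OF r])
  have "hclass E r (x \<oplus>\<^bsub>Page E r\<^esub> y) = hclass E r x \<oplus>\<^bsub>Homology E r\<^esub> hclass E r y"
    using Q_add[OF x] unfolding hclass_def Homology_def by simp
  moreover have "hclass E r x \<in> carrier (Homology E r)" "hclass E r y \<in> carrier (Homology E r)"
    using x unfolding hclass_def Homology_def Q_carrier by auto
  ultimately show ?thesis
    using ident_iso[OF r] unfolding linear_iso_def linear_map_def next_page_def by simp
qed

lemma next_page_smult:
  assumes r: "r \<ge> 1" and a: "a \<in> carrier R" and x: "x \<in> Cycles E r"
  shows "next_page E r (a \<odot>\<^bsub>Page E r\<^esub> x) = a \<odot>\<^bsub>Page E (Suc r)\<^esub> next_page E r x"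
proof -
  interpret subquotient_module R "Page E r" "Cycles E r" "Boundaries E r"
    by (rule homology_subquotient[OF r])
  have "hclass E r (a \<odot>\<^bsub>Page E r\<^esub> x) = a \<odot>\<^bsub>Homology E r\<^esub> hclass E r x"
    using Q_smult[OF a x] unfolding hclass_def Homology_def by simp
  moreover have "hclass E r x \<in> carrier (Homology E r)"
    using x unfolding hclass_def Homology_def Q_carrier by auto
  ultimately show ?thesis
    using ident_iso[OF r] a unfolding linear_iso_def linear_map_def next_page_def by simp
qed

lemma next_page_image:
  assumes r: "r \<ge> 1"
  shows "next_page E r ` Cycles E r = carrier (Page E (Suc r))"
proof -
  interpret subquotient_module R "Page E r" "Cycles E r" "Boundaries E r"
    by (rule homology_subquotient[OF r])
  have "carrier (Homology E r) = hclass E r ` Cycles E r"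
    unfolding Homology_def Q_carrier hclass_def ..
  then show ?thesis
    using ident_iso[OF r] unfolding linear_iso_def bij_betw_def next_page_def by (auto simp: image_image)
qed

lemma next_page_closed: "\<lbrakk>r \<ge> 1; x \<in> Cycles E r\<rbrakk> \<Longrightarrow> next_page E r x \<in> carrier (Page E (Suc r))"
  using next_page_image by blast

lemma next_page_piece:
  "\<lbrakk>r \<ge> 1; x \<in> Cycles E r; x \<in> Piece E r k\<rbrakk> \<Longrightarrow> next_page E r x \<in> Piece E (Suc r) k"
  unfolding next_page_def using ident_bidegree[of r k] by blast

lemma cycles_closed: "x \<in> Cycles E r \<Longrightarrow> x \<in> carrier (Page E r)"
  unfolding Cycles_def by blast

lemma cycles_subgroup: "r \<ge> 1 \<Longrightarrow> additive_subgroup (Cycles E r) (Page E r)"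
  using cycles_submodule submodule.axioms(1) additive_subgroupI by blast

end

lemma (in multiplicative_spectral_sequence) page_bigraded:
  assumes "r \<ge> 1"
  shows "bigraded R (Page E r) (Piece E r)"
  using page_algebra[OF assms] page_graded_locale[OF assms]
  by (intro bigraded.intro bigraded_axioms.intro) (auto simp: bigraded_algebra_def)

text \<open>Through this instance the results on module spectral sequences yield those on \<open>E\<close> itself.\<close>

lemma (in multiplicative_spectral_sequence) self_module:
  "module_spectral_sequence R E (\<lambda>r. mult (Page E r)) E"
proof (intro module_spectral_sequence.intro module_spectral_sequence_axioms.intro)
  show "multiplicative_spectral_sequence R E" by (rule multiplicative_spectral_sequence_axioms)
  show "spectral_sequence R E" by (rule spectral_sequence_axioms)
  fix r :: nat assume r: "r \<ge> 1"
  interpret bigraded R "Page E r" "Piece E r" by (rule page_bigraded[OF r])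
  show "left_module R (Page E r) (mult (Page E r)) (Page E r)"
    by (rule assoc_algebra_is_left_module) (rule assoc_algebra_axioms)
  show "x \<otimes>\<^bsub>Page E r\<^esub> u \<in> Piece E r (i + k, j + l)"
    if "x \<in> Piece E r (i, j)" "u \<in> Piece E r (k, l)" for x u i j k l
    using mult_piece that .
qed (use diff_derivation ident_mult in auto)

context module_spectral_sequence
begin

text \<open>The second term of the Leibniz rule, which carries a sign depending on the degree of \<open>x\<close>, vanishes for a cycle \<open>u\<close>.
Therefore the formula extends from homogeneous \<open>x\<close> to all \<open>x\<close> by additivity.\<close>

lemma diff_act_cycle:
  assumes r: "r \<ge> 1" and x: "x \<in> carrier (Page E r)" and u: "u \<in> Cycles M r"
  shows "Diff M r (act r x u) = act r (Diff E r x) u"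
proof -
  interpret L: left_module R "Page E r" "act r" "Page M r" by (rule page_module[OF r])
  interpret G: graded R "Page E r" "Piece E r" by (rule E.page_graded_locale[OF r])
  have uc: "u \<in> carrier (Page M r)" "Diff M r u = \<zero>\<^bsub>Page M r\<^esub>" using u unfolding Cycles_def by auto
  let ?N = "{x \<in> carrier (Page E r). Diff M r (act r x u) = act r (Diff E r x) u}"
  have "additive_subgroup ?N (Page E r)"
    using uc r
    by (intro abelian_group.additive_subgroupI'[OF E.page_group])
      (auto simp: L.act_zero_left L.act_add_left L.act_uminus_left L.act_closed
        E.diff_zero M.diff_zero E.diff_add M.diff_add E.diff_uminus M.diff_uminus E.diff_closed)
  moreover have "Piece E r k \<subseteq> ?N" for k
  proof
    fix x assume x: "x \<in> Piece E r k"
    obtain i j where k: "k = (i, j)" by (cases k)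
    have xc: "x \<in> carrier (Page E r)" using G.piece_closed[OF x] .
    then show "x \<in> ?N"
      using diff_leibniz[OF r x[unfolded k] uc(1)] uc E.diff_closed[OF r xc]
      by (simp add: L.act_zero_right signed_def L.act_closed)
  qed
  ultimately show ?thesis using G.carrier_subset_if_pieces x by blast
qed

lemma act_cycle:
  assumes r: "r \<ge> 1" and x: "x \<in> Cycles E r" and u: "u \<in> Cycles M r"
  shows "act r x u \<in> Cycles M r"
proof -
  interpret L: left_module R "Page E r" "act r" "Page M r" by (rule page_module[OF r])
  show ?thesis
    using diff_act_cycle[OF r _ u, of x] x u unfolding Cycles_def
    by (simp add: L.act_zero_left L.act_closed)
qed

lemma next_page_act:
  "\<lbrakk>r \<ge> 1; x \<in> Cycles E r; u \<in> Cycles M r\<rbrakk> \<Longrightarrow>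
    next_page M r (act r x u) = act (Suc r) (next_page E r x) (next_page M r u)"
  unfolding next_page_def by (rule ident_act)

end

lemma (in module) add_pow_smult:
  "\<lbrakk>a \<in> carrier R; x \<in> carrier M\<rbrakk> \<Longrightarrow> ([(n::nat)] \<cdot>\<^bsub>R\<^esub> a) \<odot>\<^bsub>M\<^esub> x = [n] \<cdot>\<^bsub>M\<^esub> (a \<odot>\<^bsub>M\<^esub> x)"
  by (induction n) (simp_all add: smult_l_distr)

context multiplicative_spectral_sequence
begin

lemma next_page_mult:
  "\<lbrakk>r \<ge> 1; x \<in> Cycles E r; y \<in> Cycles E r\<rbrakk> \<Longrightarrow>
    next_page E r (x \<otimes>\<^bsub>Page E r\<^esub> y) = next_page E r x \<otimes>\<^bsub>Page E (Suc r)\<^esub> next_page E r y"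
  using module_spectral_sequence.next_page_act[OF self_module] .

text \<open>For a central element of even degree the Leibniz rule gives \<open>d (s\<^sup>n\<^sup>+\<^sup>1) = (n + 1) s\<^sup>n d s\<close>, without signs.\<close>

lemma power_is_cycle:
  assumes r: "r \<ge> 1" and m: "[(m::nat)] \<cdot>\<^bsub>R\<^esub> \<one>\<^bsub>R\<^esub> = \<zero>\<^bsub>R\<^esub>" "m > 0"
    and s: "s \<in> even_central (Page E r) (Piece E r)"
  shows "s [^]\<^bsub>Page E r\<^esub> m \<in> Cycles E r"
proof -
  let ?A = "Page E r"
  interpret bigraded R ?A "Piece E r" by (rule page_bigraded[OF r])
  have sc: "s \<in> carrier ?A" using s even_central_closed by blast
  define ds where "ds = Diff E r s"
  have ds: "ds \<in> carrier ?A" unfolding ds_def using diff_closed[OF r sc] .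
  have cs: "s \<otimes>\<^bsub>?A\<^esub> x = x \<otimes>\<^bsub>?A\<^esub> s" if "x \<in> carrier ?A" for x
    using s that unfolding even_central_def by blast
  have "Diff E r (s [^]\<^bsub>?A\<^esub> Suc n) = [Suc n] \<cdot>\<^bsub>?A\<^esub> (s [^]\<^bsub>?A\<^esub> n \<otimes>\<^bsub>?A\<^esub> ds)" for n
  proof (induction n)
    case 0
    then show ?case using sc ds by (simp add: ds_def)
  next
    case (Suc n)
    obtain i j where d: "even (i + j)" "s [^]\<^bsub>?A\<^esub> Suc n \<in> Piece E r (i, j)"
      using even_central_power[OF s, of "Suc n"] unfolding even_central_def by blast
    have "Diff E r (s [^]\<^bsub>?A\<^esub> Suc (Suc n)) =
        Diff E r (s [^]\<^bsub>?A\<^esub> Suc n) \<otimes>\<^bsub>?A\<^esub> s \<oplus>\<^bsub>?A\<^esub> s [^]\<^bsub>?A\<^esub> Suc n \<otimes>\<^bsub>?A\<^esub> ds"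
      using diff_derivation[OF r d(2) sc] d(1) by (simp add: signed_def ds_def)
    also have "Diff E r (s [^]\<^bsub>?A\<^esub> Suc n) \<otimes>\<^bsub>?A\<^esub> s = [Suc n] \<cdot>\<^bsub>?A\<^esub> (s [^]\<^bsub>?A\<^esub> n \<otimes>\<^bsub>?A\<^esub> ds \<otimes>\<^bsub>?A\<^esub> s)"
      unfolding Suc.IH using sc ds by (intro add_pow_ldistr) auto
    also have "s [^]\<^bsub>?A\<^esub> n \<otimes>\<^bsub>?A\<^esub> ds \<otimes>\<^bsub>?A\<^esub> s = s [^]\<^bsub>?A\<^esub> Suc n \<otimes>\<^bsub>?A\<^esub> ds"
      using sc ds cs[OF ds] by (simp add: m_assoc)
    finally show ?case using sc ds by (simp add: M.add.nat_pow_Suc)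
  qed
  from this[of "m - 1"] have "Diff E r (s [^]\<^bsub>?A\<^esub> m) = [m] \<cdot>\<^bsub>?A\<^esub> (s [^]\<^bsub>?A\<^esub> (m - 1) \<otimes>\<^bsub>?A\<^esub> ds)"
    using m(2) by simp
  also have "\<dots> = ([m] \<cdot>\<^bsub>R\<^esub> \<one>\<^bsub>R\<^esub>) \<odot>\<^bsub>?A\<^esub> (s [^]\<^bsub>?A\<^esub> (m - 1) \<otimes>\<^bsub>?A\<^esub> ds)"
    using add_pow_smult[of "\<one>\<^bsub>R\<^esub>" "s [^]\<^bsub>?A\<^esub> (m - 1) \<otimes>\<^bsub>?A\<^esub> ds" m] sc ds by simp
  also have "\<dots> = \<zero>\<^bsub>?A\<^esub>" unfolding m(1) using sc ds by simp
  finally show ?thesis unfolding Cycles_def using sc by simp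
qed

lemma next_page_even_central:
  assumes r: "r \<ge> 1" and s: "s \<in> even_central (Page E r) (Piece E r)" "s \<in> Cycles E r"
  shows "next_page E r s \<in> even_central (Page E (Suc r)) (Piece E (Suc r))"
proof -
  have "next_page E r s \<otimes>\<^bsub>Page E (Suc r)\<^esub> y = y \<otimes>\<^bsub>Page E (Suc r)\<^esub> next_page E r s"
    if y: "y \<in> carrier (Page E (Suc r))" for y
  proof -
    obtain x where x: "x \<in> Cycles E r" "y = next_page E r x"
      using y unfolding next_page_image[OF r, symmetric] by blast
    have "s \<otimes>\<^bsub>Page E r\<^esub> x = x \<otimes>\<^bsub>Page E r\<^esub> s" using s(1) cycles_closed[OF x(1)] unfolding even_central_def by blast
    then show ?thesis using next_page_mult[OF r s(2) x(1)] next_page_mult[OF r x(1) s(2)] x(2) by simp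
  qed
  then show ?thesis using s next_page_piece[OF r s(2)] unfolding even_central_def by blast
qed

end

lemma (in left_module) act_power:
  "\<lbrakk>s \<in> carrier A; x \<in> carrier M\<rbrakk> \<Longrightarrow> act (s [^]\<^bsub>A\<^esub> (n::nat)) x = (act s ^^ n) x"
proof (induction n arbitrary: x)
  case (Suc n)
  have "act (s [^]\<^bsub>A\<^esub> Suc n) x = act (s [^]\<^bsub>A\<^esub> n) (act s x)"
    using Suc.prems by (simp add: act_mult)
  then show ?case using Suc act_closed by (simp add: funpow_swap1)
qed (simp add: act_one)

context module_spectral_sequence
begin

text \<open>Since the \<open>m\<close>-th powers of elements of \<open>S\<close> are cycles, the cycles of \<open>M\<^sub>r\<close> form a submodule over \<open>R[s\<^sup>m | s \<in> S]\<close>,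
which is finitely generated by Hilbert's basis theorem; it maps onto \<open>M\<^sub>r\<^sub>+\<^sub>1\<close>.\<close>

lemma fg_next_page:
  assumes R: "noetherian_ring R" and r: "r \<ge> 1" and m: "[(m::nat)] \<cdot>\<^bsub>R\<^esub> \<one>\<^bsub>R\<^esub> = \<zero>\<^bsub>R\<^esub>" "m > 0"
    and S: "finite S" "S \<subseteq> even_central (Page E r) (Piece E r)"
    and fg: "op_fg (scalars R (act r) (Page M r) S) (Page M r) (carrier (Page M r))"
  shows "op_fg (scalars R (act (Suc r)) (Page M (Suc r)) ((\<lambda>s. next_page E r (s [^]\<^bsub>Page E r\<^esub> m)) ` S))
    (Page M (Suc r)) (carrier (Page M (Suc r)))"
proof -
  interpret A: bigraded R "Page E r" "Piece E r" by (rule E.page_bigraded[OF r])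
  interpret L: left_module R "Page E r" "act r" "Page M r" by (rule page_module[OF r])
  interpret L': left_module R "Page E (Suc r)" "act (Suc r)" "Page M (Suc r)" by (rule page_module) simp
  have Sc: "S \<subseteq> carrier (Page E r)" using S(2) A.even_central_closed by blast
  define T where "T = (\<lambda>s. s [^]\<^bsub>Page E r\<^esub> m) ` S"
  have T: "finite T" "T \<subseteq> even_central (Page E r) (Piece E r)" "T \<subseteq> Cycles E r"
    unfolding T_def using S A.even_central_power E.power_is_cycle[OF r m] by auto
  have Tc: "T \<subseteq> carrier (Page E r)" using T(2) A.even_central_closed by blast
  have comm: "s \<otimes>\<^bsub>Page E r\<^esub> t = t \<otimes>\<^bsub>Page E r\<^esub> s" if "s \<in> even_central (Page E r) (Piece E r)" "t \<in> carrier (Page E r)" for s t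
    using that unfolding even_central_def by blast
  have "op_fg (smults R (Page M r) \<union> (\<lambda>s. act r (s [^]\<^bsub>Page E r\<^esub> m)) ` S) (Page M r) (carrier (Page M r))"
  proof (rule fg_replace_by_powers[where g = "act r" and k = m])
    show "operator_group (Page M r) (scalars R (act r) (Page M r) S)" by (rule L.scalars_operator_group[OF Sc])
    fix s x assume s: "s \<in> S" and x: "x \<in> carrier (Page M r)"
    show "act r (s [^]\<^bsub>Page E r\<^esub> m) x = (act r s ^^ m) x" using s x Sc by (intro L.act_power) auto
    fix f assume "f \<in> scalars R (act r) (Page M r) S"
    then have "act r s (f x) = f (act r s x)"
      using L.scalars_commute[OF Sc, of "act r s" f x] comm S(2) Sc s x by blast
    then show "act r s (f x) = f (act r s x) \<or> act r s (f x) = \<ominus>\<^bsub>Page M r\<^esub> f (act r s x)" by blast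
  qed (use S m fg in auto)
  then have "op_fg (scalars R (act r) (Page M r) T) (Page M r) (carrier (Page M r))"
    unfolding T_def by (simp add: image_image)
  then have noeth: "noetherian_on (scalars R (act r) (Page M r) T) (Page M r) (carrier (Page M r))"
    using comm T Tc by (intro L.noetherian_on_carrier[OF R T(1) Tc]) blast+
  have "op_stable (scalars R (act r) (Page M r) T) (Page M r) (Cycles M r)"
    unfolding stable_subgroup_def
    using M.cycles_subgroup[OF r] submodule.smult_closed[OF M.cycles_submodule[OF r]]
      act_cycle[OF r] T(3) by auto
  then have fgZ: "op_fg (scalars R (act r) (Page M r) T) (Page M r) (Cycles M r)"
    using noeth M.cycles_closed unfolding noetherian_on_def by blast
  let ?S' = "(\<lambda>s. next_page E r (s [^]\<^bsub>Page E r\<^esub> m)) ` S"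
  have S': "?S' = next_page E r ` T" unfolding T_def by (simp add: image_image)
  have S'c: "next_page E r ` T \<subseteq> carrier (Page E (Suc r))" using T(3) E.next_page_closed[OF r] by blast
  interpret O': operator_group "Page M (Suc r)" "scalars R (act (Suc r)) (Page M (Suc r)) (next_page E r ` T)"
    by (rule L'.scalars_operator_group[OF S'c])
  have "op_fg (scalars R (act (Suc r)) (Page M (Suc r)) (next_page E r ` T)) (Page M (Suc r)) (next_page M r ` Cycles M r)"
  proof (rule fg_transfer[OF M.page_group[OF r] L.scalars_operator_group[OF Tc] O'.operator_group_axioms
        M.cycles_subgroup[OF r], where p = "\<lambda>x. x"])
    show "next_page M r x = \<zero>\<^bsub>Page M (Suc r)\<^esub>" if "x \<in> Cycles M r" "x = \<zero>\<^bsub>Page M r\<^esub>" for x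
    proof -
      have "next_page M r x = next_page M r x \<oplus>\<^bsub>Page M (Suc r)\<^esub> next_page M r x"
        using M.next_page_add[OF r that(1,1)] that(2) L.M.zero_closed by simp
      then show ?thesis
        using M.next_page_closed[OF r that(1)] L'.M.add.l_cancel_one[of "next_page M r x" "next_page M r x"]
        by simp
    qed
    show "op_stable (scalars R (act (Suc r)) (Page M (Suc r)) (next_page E r ` T)) (Page M (Suc r)) (next_page M r ` Cycles M r)"
      unfolding M.next_page_image[OF r] using O'.op_closed
      by (intro stable_subgroupI O'.is_group) auto
    fix f assume "f \<in> scalars R (act r) (Page M r) T"
    then consider a where "a \<in> carrier R" "f = (\<lambda>x. a \<odot>\<^bsub>Page M r\<^esub> x)" | t where "t \<in> T" "f = act r t" by blast
    then show "\<exists>g\<in>scalars R (act (Suc r)) (Page M (Suc r)) (next_page E r ` T).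
      \<exists>h. \<forall>x\<in>Cycles M r. h x \<in> Cycles M r \<and> h x = f x \<and> next_page M r (h x) = g (next_page M r x)"
    proof cases
      case 1
      then show ?thesis
        using submodule.smult_closed[OF M.cycles_submodule[OF r]] M.next_page_smult[OF r]
        by (intro bexI[of _ "\<lambda>x. a \<odot>\<^bsub>Page M (Suc r)\<^esub> x"] exI[of _ f]) auto
    next
      case 2
      then show ?thesis
        using act_cycle[OF r] next_page_act[OF r] T(3)
        by (intro bexI[of _ "act (Suc r) (next_page E r t)"] exI[of _ f]) auto
    qed
  qed (use fgZ M.cycles_closed M.next_page_add[OF r] in auto)
  then show ?thesis unfolding S' M.next_page_image[OF r] .
qed

lemma fg_later_page:
  assumes R: "noetherian_ring R" and r: "r \<ge> 1" and m: "[(m::nat)] \<cdot>\<^bsub>R\<^esub> \<one>\<^bsub>R\<^esub> = \<zero>\<^bsub>R\<^esub>" "m > 0"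
    and S: "finite S" "S \<subseteq> even_central (Page E r) (Piece E r)"
    and fgE: "op_fg (scalars R (mult (Page E r)) (Page E r) S) (Page E r) (carrier (Page E r))"
    and fgM: "op_fg (scalars R (act r) (Page M r) S) (Page M r) (carrier (Page M r))"
    and r': "r \<le> r'"
  shows "\<exists>S. finite S \<and> S \<subseteq> even_central (Page E r') (Piece E r') \<and>
    op_fg (scalars R (mult (Page E r')) (Page E r') S) (Page E r') (carrier (Page E r')) \<and>
    op_fg (scalars R (act r') (Page M r') S) (Page M r') (carrier (Page M r'))"
  using r'
proof (induction r' rule: dec_induct)
  case base
  then show ?case using S fgE fgM by blast
next
  case (step n)
  then have n: "n \<ge> 1" using r by simp
  obtain S where S: "finite S" "S \<subseteq> even_central (Page E n) (Piece E n)"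
    "op_fg (scalars R (mult (Page E n)) (Page E n) S) (Page E n) (carrier (Page E n))"
    "op_fg (scalars R (act n) (Page M n) S) (Page M n) (carrier (Page M n))"
    using step.IH by blast
  interpret A: bigraded R "Page E n" "Piece E n" by (rule E.page_bigraded[OF n])
  let ?S = "(\<lambda>s. next_page E n (s [^]\<^bsub>Page E n\<^esub> m)) ` S"
  have "?S \<subseteq> even_central (Page E (Suc n)) (Piece E (Suc n))"
    using S(2) A.even_central_power E.power_is_cycle[OF n m] E.next_page_even_central[OF n] by blast
  then show ?case
    using S(1) module_spectral_sequence.fg_next_page[OF E.self_module R n m S(1,2,3)]
      fg_next_page[OF R n m S(1,2,4)]
    by (intro exI[of _ ?S]) auto
qed

end

section \<open>The limit page\<close>

(* The limit page is defined by means of "Page E 1".  If the simplifier replaced 1 by "Suc 0", facts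
   about this page would no longer match. *)
declare One_nat_def [simp del]

context spectral_sequence
begin

lemma Rep_Suc: "r \<ge> 1 \<Longrightarrow> Rep E (Suc r) x = next_page E r (Rep E r x)"
  by (simp add: next_page_def)

lemma Rep_1: "Rep E 1 x = x"
  by (simp add: One_nat_def)

lemma Zsub_1: "Zsub E 1 = carrier (Page E 1)"
  unfolding Zsub_def by auto

lemma Zsub_Suc: "r \<ge> 1 \<Longrightarrow> Zsub E (Suc r) = {x \<in> Zsub E r. Rep E r x \<in> Cycles E r}"
  unfolding Zsub_def by (auto simp: less_Suc_eq)

lemma Zsub_antimono: "r \<le> s \<Longrightarrow> Zsub E s \<subseteq> Zsub E r"
  unfolding Zsub_def by auto

lemma Zinf_Zsub: "r \<ge> 1 \<Longrightarrow> Zinf E \<subseteq> Zsub E r"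
  unfolding Zinf_def by auto

lemma next_page_zero: "r \<ge> 1 \<Longrightarrow> next_page E r \<zero>\<^bsub>Page E r\<^esub> = \<zero>\<^bsub>Page E (Suc r)\<^esub>"
proof -
  assume r: "r \<ge> 1"
  interpret M: abelian_group "Page E r" by (rule page_group[OF r])
  interpret M': abelian_group "Page E (Suc r)" by (rule page_group) simp
  have z: "\<zero>\<^bsub>Page E r\<^esub> \<in> Cycles E r" using diff_zero[OF r] unfolding Cycles_def by simp
  show ?thesis
    using next_page_add[OF r z z] next_page_closed[OF r z]
      M'.add.l_cancel_one[of "next_page E r \<zero>\<^bsub>Page E r\<^esub>" "next_page E r \<zero>\<^bsub>Page E r\<^esub>"]
    by simp
qed

text \<open>Elements of \<open>Z\<^sub>r\<close> are added and scaled in \<open>E\<^sub>1\<close>.  That \<open>Z\<^sub>r\<^sub>+\<^sub>1\<close> is closed under these operations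
relies on the linearity of the map \<open>Z\<^sub>r \<rightarrow> E\<^sub>r\<close>, whence the simultaneous induction.\<close>

lemma Rep_properties:
  assumes "r \<ge> 1"
  shows "submodule (Zsub E r) R (Page E 1) \<and> Rep E r ` Zsub E r = carrier (Page E r) \<and>
    (\<forall>x\<in>Zsub E r. \<forall>y\<in>Zsub E r. Rep E r (x \<oplus>\<^bsub>Page E 1\<^esub> y) = Rep E r x \<oplus>\<^bsub>Page E r\<^esub> Rep E r y) \<and>
    (\<forall>a\<in>carrier R. \<forall>x\<in>Zsub E r. Rep E r (a \<odot>\<^bsub>Page E 1\<^esub> x) = a \<odot>\<^bsub>Page E r\<^esub> Rep E r x)"
  using assms
proof (induction r rule: dec_induct)
  case base
  interpret module R "Page E 1" using page_module by simp
  show ?case unfolding Zsub_1 Rep_1 using carrier_is_submodule by auto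
next
  case (step r)
  then have r: "r \<ge> 1" by simp
  interpret M1: module R "Page E 1" using page_module by simp
  interpret Mr: module R "Page E r" using page_module[OF r] .
  have Z: "submodule (Zsub E r) R (Page E 1)"
    and im: "Rep E r ` Zsub E r = carrier (Page E r)"
    and add: "\<And>x y. \<lbrakk>x \<in> Zsub E r; y \<in> Zsub E r\<rbrakk> \<Longrightarrow> Rep E r (x \<oplus>\<^bsub>Page E 1\<^esub> y) = Rep E r x \<oplus>\<^bsub>Page E r\<^esub> Rep E r y"
    and sm: "\<And>a x. \<lbrakk>a \<in> carrier R; x \<in> Zsub E r\<rbrakk> \<Longrightarrow> Rep E r (a \<odot>\<^bsub>Page E 1\<^esub> x) = a \<odot>\<^bsub>Page E r\<^esub> Rep E r x"
    using step.IH by blast+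
  note C = Mr.submoduleE[OF cycles_submodule[OF r]] and ZE = M1.submoduleE[OF Z]
  have Zc: "x \<in> carrier (Page E 1)" if "x \<in> Zsub E r" for x using ZE(1) that by blast
  have Rc: "Rep E r x \<in> carrier (Page E r)" if "x \<in> Zsub E r" for x using im that by blast
  have z: "\<zero>\<^bsub>Page E 1\<^esub> \<in> Zsub E r" using subgroup.one_closed[OF submodule.axioms(1)[OF Z]] by simp
  have Rz: "Rep E r \<zero>\<^bsub>Page E 1\<^esub> = \<zero>\<^bsub>Page E r\<^esub>"
    using add[OF z z] Rc[OF z] Mr.M.add.l_cancel_one[of "Rep E r \<zero>\<^bsub>Page E 1\<^esub>" "Rep E r \<zero>\<^bsub>Page E 1\<^esub>"]
    by simp
  have um: "Rep E r (\<ominus>\<^bsub>Page E 1\<^esub> x) = \<ominus>\<^bsub>Page E r\<^esub> Rep E r x" if "x \<in> Zsub E r" for x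
    using add[OF ZE(3)[OF that] that] Zc[OF that] Rc[OF that] Rc[OF ZE(3)[OF that]] Rz
    by (simp add: M1.M.l_neg Mr.M.minus_equality)
  have cz: "\<zero>\<^bsub>Page E r\<^esub> \<in> Cycles E r" using diff_zero[OF r] unfolding Cycles_def by simp
  have "submodule (Zsub E (Suc r)) R (Page E 1)"
    unfolding Zsub_Suc[OF r]
    by (rule M1.submoduleI) (auto simp: Zc z Rz cz um add sm C ZE)
  moreover have "Rep E (Suc r) ` Zsub E (Suc r) = carrier (Page E (Suc r))"
  proof -
    have "Rep E r ` Zsub E (Suc r) = Cycles E r"
    proof
      show "Cycles E r \<subseteq> Rep E r ` Zsub E (Suc r)"
      proof
        fix c assume c: "c \<in> Cycles E r"
        then have "c \<in> Rep E r ` Zsub E r" unfolding im by (rule cycles_closed)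
        then show "c \<in> Rep E r ` Zsub E (Suc r)" unfolding Zsub_Suc[OF r] using c by blast
      qed
    qed (auto simp: Zsub_Suc[OF r])
    moreover have "Rep E (Suc r) ` Zsub E (Suc r) = next_page E r ` Rep E r ` Zsub E (Suc r)"
      unfolding image_image Rep_Suc[OF r] ..
    ultimately show ?thesis using next_page_image[OF r] by simp
  qed
  moreover have "Rep E (Suc r) (x \<oplus>\<^bsub>Page E 1\<^esub> y) = Rep E (Suc r) x \<oplus>\<^bsub>Page E (Suc r)\<^esub> Rep E (Suc r) y"
    if "x \<in> Zsub E (Suc r)" "y \<in> Zsub E (Suc r)" for x y
    using that unfolding Zsub_Suc[OF r] Rep_Suc[OF r] by (simp add: add next_page_add[OF r])
  moreover have "Rep E (Suc r) (a \<odot>\<^bsub>Page E 1\<^esub> x) = a \<odot>\<^bsub>Page E (Suc r)\<^esub> Rep E (Suc r) x"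
    if "a \<in> carrier R" "x \<in> Zsub E (Suc r)" for a x
    using that unfolding Zsub_Suc[OF r] Rep_Suc[OF r] by (simp add: sm next_page_smult[OF r])
  ultimately show ?case by blast
qed

lemma Zsub_submodule: "r \<ge> 1 \<Longrightarrow> submodule (Zsub E r) R (Page E 1)"
  using Rep_properties by blast

lemma Rep_image: "r \<ge> 1 \<Longrightarrow> Rep E r ` Zsub E r = carrier (Page E r)"
  using Rep_properties by blast

lemma Rep_closed: "\<lbrakk>r \<ge> 1; x \<in> Zsub E r\<rbrakk> \<Longrightarrow> Rep E r x \<in> carrier (Page E r)"
  using Rep_image by blast

lemma Rep_add: "\<lbrakk>r \<ge> 1; x \<in> Zsub E r; y \<in> Zsub E r\<rbrakk> \<Longrightarrow>
    Rep E r (x \<oplus>\<^bsub>Page E 1\<^esub> y) = Rep E r x \<oplus>\<^bsub>Page E r\<^esub> Rep E r y"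
  using Rep_properties by blast

lemma Rep_smult: "\<lbrakk>r \<ge> 1; a \<in> carrier R; x \<in> Zsub E r\<rbrakk> \<Longrightarrow>
    Rep E r (a \<odot>\<^bsub>Page E 1\<^esub> x) = a \<odot>\<^bsub>Page E r\<^esub> Rep E r x"
  using Rep_properties by blast

lemma page1_module: "module R (Page E 1)"
  using page_module by simp

lemmas Zsub_closures = module.submoduleE[OF page1_module Zsub_submodule]

lemma Zsub_closed: "\<lbrakk>r \<ge> 1; x \<in> Zsub E r\<rbrakk> \<Longrightarrow> x \<in> carrier (Page E 1)"
  unfolding Zsub_def by blast

lemma Zsub_zero: "r \<ge> 1 \<Longrightarrow> \<zero>\<^bsub>Page E 1\<^esub> \<in> Zsub E r"
  using subgroup.one_closed[OF submodule.axioms(1)[OF Zsub_submodule]] by simp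

lemma Rep_zero:
  assumes r: "r \<ge> 1"
  shows "Rep E r \<zero>\<^bsub>Page E 1\<^esub> = \<zero>\<^bsub>Page E r\<^esub>"
proof -
  interpret M1: module R "Page E 1" by (rule page1_module)
  interpret Mr: abelian_group "Page E r" using page_group[OF r] .
  note z = Zsub_zero[OF r]
  show ?thesis
    using Rep_add[OF r z z] Rep_closed[OF r z]
      Mr.add.l_cancel_one[of "Rep E r \<zero>\<^bsub>Page E 1\<^esub>" "Rep E r \<zero>\<^bsub>Page E 1\<^esub>"]
    by simp
qed

lemma Rep_uminus:
  assumes r: "r \<ge> 1" and x: "x \<in> Zsub E r"
  shows "Rep E r (\<ominus>\<^bsub>Page E 1\<^esub> x) = \<ominus>\<^bsub>Page E r\<^esub> Rep E r x"
proof -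
  interpret M1: module R "Page E 1" by (rule page1_module)
  interpret Mr: abelian_group "Page E r" using page_group[OF r] .
  note m = Zsub_closures(3)[OF r x]
  show ?thesis
    using Rep_add[OF r m x] Rep_closed[OF r m] Rep_closed[OF r x] Zsub_closed[OF r x] Rep_zero[OF r]
    by (simp add: M1.M.l_neg Mr.minus_equality)
qed

lemma Bsub_submodule:
  assumes r: "r \<ge> 1"
  shows "submodule (Bsub E r) R (Page E 1)"
proof -
  interpret M1: module R "Page E 1" by (rule page1_module)
  interpret Mr: module R "Page E r" using page_module[OF r] .
  note ZE = Zsub_closures[OF r]
  show ?thesis
    unfolding Bsub_def
    by (rule M1.submoduleI)
      (auto simp: Zsub_closed[OF r] Zsub_zero[OF r] Rep_zero[OF r] Rep_uminus[OF r] Rep_add[OF r]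
        Rep_smult[OF r] ZE)
qed

lemma Bsub_Suc:
  assumes r: "r \<ge> 1"
  shows "Bsub E r \<subseteq> Bsub E (Suc r)"
proof
  fix x assume "x \<in> Bsub E r"
  then have x: "x \<in> Zsub E r" "Rep E r x = \<zero>\<^bsub>Page E r\<^esub>" unfolding Bsub_def by auto
  have "Rep E r x \<in> Cycles E r"
    using diff_zero[OF r] abelian_groupE(2)[OF page_group[OF r]] unfolding Cycles_def x(2) by simp
  then show "x \<in> Bsub E (Suc r)"
    using x next_page_zero[OF r] unfolding Bsub_def Zsub_Suc[OF r] Rep_Suc[OF r] by simp
qed

lemma Bsub_mono:
  assumes r: "r \<ge> 1" and rs: "r \<le> s"
  shows "Bsub E r \<subseteq> Bsub E s"
  using rs
proof (induction s rule: dec_induct)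
  case (step s)
  then show ?case using r Bsub_Suc[of s] by auto
qed simp

lemma Bsub_Zsub: "\<lbrakk>r \<ge> 1; s \<ge> 1\<rbrakk> \<Longrightarrow> Bsub E r \<subseteq> Zsub E s"
proof -
  assume rs: "r \<ge> 1" "s \<ge> 1"
  have "Bsub E r \<subseteq> Bsub E (max r s)" using rs by (intro Bsub_mono) auto
  also have "\<dots> \<subseteq> Zsub E (max r s)" unfolding Bsub_def by blast
  also have "\<dots> \<subseteq> Zsub E s" by (intro Zsub_antimono) auto
  finally show ?thesis .
qed

lemma Binf_Zinf: "Binf E \<subseteq> Zinf E"
  unfolding Binf_def Zinf_def using Bsub_Zsub by blast

lemma Bsub_Binf: "r \<ge> 1 \<Longrightarrow> Bsub E r \<subseteq> Binf E"
  unfolding Binf_def by auto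

lemma Zinf_submodule: "submodule (Zinf E) R (Page E 1)"
proof -
  interpret M1: module R "Page E 1" by (rule page1_module)
  have I: "x \<in> Zinf E" if "\<And>r. r \<ge> 1 \<Longrightarrow> x \<in> Zsub E r" for x using that unfolding Zinf_def by auto
  have D: "x \<in> Zsub E r" if "x \<in> Zinf E" "r \<ge> 1" for x r using that unfolding Zinf_def by auto
  show ?thesis
  proof (rule M1.submoduleI)
    show "Zinf E \<subseteq> carrier (Page E 1)" using D[of _ 1] unfolding Zsub_1 by auto
    show "\<zero>\<^bsub>Page E 1\<^esub> \<in> Zinf E" by (intro I Zsub_zero)
    show "\<ominus>\<^bsub>Page E 1\<^esub> x \<in> Zinf E" if "x \<in> Zinf E" for x
      by (intro I Zsub_closures(3) D[OF that])
    show "x \<oplus>\<^bsub>Page E 1\<^esub> y \<in> Zinf E" if "x \<in> Zinf E" "y \<in> Zinf E" for x y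
      by (intro I Zsub_closures(5) D[OF that(1)] D[OF that(2)])
    show "a \<odot>\<^bsub>Page E 1\<^esub> x \<in> Zinf E" if "a \<in> carrier R" "x \<in> Zinf E" for a x
      by (intro I Zsub_closures(4) D[OF that(2)] that(1))
  qed
qed

lemma Binf_submodule: "submodule (Binf E) R (Page E 1)"
proof -
  interpret M1: module R "Page E 1" by (rule page1_module)
  have "Binf E = (\<Union>n. Bsub E (Suc n))"
  proof -
    have "{1::nat..} = range Suc" by (simp add: One_nat_def atLeast_Suc_greaterThan greaterThan_0)
    then show ?thesis unfolding Binf_def by simp
  qed
  moreover have "stable_subgroup (carrier R) (\<lambda>a x. a \<odot>\<^bsub>Page E 1\<^esub> x) (Page E 1) (\<Union>n. Bsub E (Suc n))"
  proof (rule stable_chain_union)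
    show "stable_subgroup (carrier R) (\<lambda>a x. a \<odot>\<^bsub>Page E 1\<^esub> x) (Page E 1) (Bsub E (Suc n))" for n
      using Bsub_submodule[of "Suc n"] submodule.smult_closed submodule.axioms(1)
      unfolding stable_subgroup_def by (auto intro!: additive_subgroupI)
  qed (use M1.M.abelian_group_axioms Bsub_mono in auto)
  ultimately show ?thesis
    unfolding stable_subgroup_def
    by (intro submodule.intro submodule_axioms.intro) (auto dest: additive_subgroup.a_subgroup)
qed

lemma Einf_subquotient: "subquotient_module R (Page E 1) (Zinf E) (Binf E)"
  using page_plain_module[of 1] Zinf_submodule Binf_submodule Binf_Zinf
  by (intro subquotient_module.intro subquotient_module_axioms.intro) auto

lemma subpage_subquotient:
  assumes "r \<ge> 1"
  shows "subquotient_module R (Page E 1) (Zsub E r) (Bsub E r)"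
  using page_plain_module[of 1] Zsub_submodule[OF assms] Bsub_submodule[OF assms] Bsub_Zsub[OF assms assms]
  by (intro subquotient_module.intro subquotient_module_axioms.intro) auto

lemma coset_eq_if_Rep_eq:
  assumes r: "r \<ge> 1" and x: "x \<in> Zinf E" "y \<in> Zinf E" and eq: "Rep E r x = Rep E r y"
  shows "Binf E +>\<^bsub>Page E 1\<^esub> x = Binf E +>\<^bsub>Page E 1\<^esub> y"
proof -
  interpret Q: subquotient_module R "Page E 1" "Zinf E" "Binf E" by (rule Einf_subquotient)
  interpret Mr: abelian_group "Page E r" using page_group[OF r] .
  have Z: "x \<in> Zsub E r" "y \<in> Zsub E r" using x Zinf_Zsub[OF r] by auto
  note m = Zsub_closures(3)[OF r Z(2)]
  have "x \<oplus>\<^bsub>Page E 1\<^esub> \<ominus>\<^bsub>Page E 1\<^esub> y \<in> Bsub E r"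
    unfolding Bsub_def
    using Zsub_closures(5)[OF r Z(1) m] Rep_add[OF r Z(1) m] Rep_uminus[OF r Z(2)] eq Rep_closed[OF r Z(2)]
    by (simp add: Mr.r_neg)
  then have b: "x \<oplus>\<^bsub>Page E 1\<^esub> \<ominus>\<^bsub>Page E 1\<^esub> y \<in> Binf E" using Bsub_Binf[OF r] by blast
  have "x = (x \<oplus>\<^bsub>Page E 1\<^esub> \<ominus>\<^bsub>Page E 1\<^esub> y) \<oplus>\<^bsub>Page E 1\<^esub> y"
    using x Q.Z_closed by (simp add: Q.M.a_assoc Q.M.l_neg)
  then show ?thesis using Q.coset_eq_add[OF x(2) b] by simp
qed

text \<open>The submodule \<open>Z\<close> can be recovered from the quotient \<open>Z / B\<close>, as the union of all cosets.\<close>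

lemma collapse_Zinf:
  assumes r: "r \<ge> 1" and eq: "Einf E = subpage E r"
  shows "Zinf E = Zsub E r"
proof
  show "Zinf E \<subseteq> Zsub E r" by (rule Zinf_Zsub[OF r])
  interpret Q: subquotient_module R "Page E 1" "Zinf E" "Binf E" by (rule Einf_subquotient)
  interpret Qr: subquotient_module R "Page E 1" "Zsub E r" "Bsub E r" by (rule subpage_subquotient[OF r])
  have c: "Q.q ` Zinf E = Qr.q ` Zsub E r"
    using eq Q.Q_carrier Qr.Q_carrier unfolding Einf_def subpage_def by simp
  show "Zsub E r \<subseteq> Zinf E"
  proof
    fix x assume x: "x \<in> Zsub E r"
    then obtain y where y: "y \<in> Zinf E" "Qr.q x = Q.q y" using c by blast
    then have "x \<in> Q.q y" using Qr.coset_self[OF x] by simp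
    then show "x \<in> Zinf E" using Q.coset_memD y(1) by blast
  qed
qed

end

context module_spectral_sequence
begin

lemma Rep_act:
  assumes "r \<ge> 1" "x \<in> Zsub E r" "u \<in> Zsub M r"
  shows "act 1 x u \<in> Zsub M r \<and> Rep M r (act 1 x u) = act r (Rep E r x) (Rep M r u)"
  using assms
proof (induction r rule: dec_induct)
  case base
  interpret L: left_module R "Page E 1" "act 1" "Page M 1" by (rule page_module) simp
  show ?case using base unfolding E.Zsub_1 M.Zsub_1 E.Rep_1 M.Rep_1 by (auto intro: L.act_closed)
next
  case (step r)
  then have r: "r \<ge> 1" by simp
  have x: "x \<in> Zsub E r" "Rep E r x \<in> Cycles E r" and u: "u \<in> Zsub M r" "Rep M r u \<in> Cycles M r"
    using step.prems unfolding E.Zsub_Suc[OF r] M.Zsub_Suc[OF r] by auto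
  have IH: "act 1 x u \<in> Zsub M r" "Rep M r (act 1 x u) = act r (Rep E r x) (Rep M r u)"
    using step.IH x u by auto
  show ?case
    unfolding M.Zsub_Suc[OF r] E.Rep_Suc[OF r] M.Rep_Suc[OF r]
    using IH act_cycle[OF r x(2) u(2)] next_page_act[OF r x(2) u(2)] by simp
qed

lemma act_Zinf: "\<lbrakk>x \<in> Zinf E; u \<in> Zinf M\<rbrakk> \<Longrightarrow> act 1 x u \<in> Zinf M"
  using Rep_act unfolding Zinf_def by blast

lemma act_Binf_left:
  assumes x: "x \<in> Binf E" and u: "u \<in> Zinf M"
  shows "act 1 x u \<in> Binf M"
proof -
  obtain r where r: "r \<ge> 1" "x \<in> Bsub E r" using x unfolding Binf_def by auto
  interpret L: left_module R "Page E r" "act r" "Page M r" by (rule page_module[OF r(1)])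
  have u: "u \<in> Zsub M r" using u M.Zinf_Zsub[OF r(1)] by blast
  have "act 1 x u \<in> Bsub M r"
    using r(2) Rep_act[OF r(1) _ u, of x] M.Rep_closed[OF r(1) u] unfolding Bsub_def
    by (simp add: L.act_zero_left)
  then show ?thesis using M.Bsub_Binf[OF r(1)] by blast
qed

lemma act_Binf_right:
  assumes x: "x \<in> Zinf E" and u: "u \<in> Binf M"
  shows "act 1 x u \<in> Binf M"
proof -
  obtain r where r: "r \<ge> 1" "u \<in> Bsub M r" using u unfolding Binf_def by auto
  interpret L: left_module R "Page E r" "act r" "Page M r" by (rule page_module[OF r(1)])
  have x: "x \<in> Zsub E r" using x E.Zinf_Zsub[OF r(1)] by blast
  have "act 1 x u \<in> Bsub M r"
    using r(2) Rep_act[OF r(1) x, of u] E.Rep_closed[OF r(1) x] unfolding Bsub_def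
    by (simp add: L.act_zero_right)
  then show ?thesis using M.Bsub_Binf[OF r(1)] by blast
qed

end

context multiplicative_spectral_sequence
begin

text \<open>From \<open>1 = 1 \<cdot> 1\<close> one gets \<open>d 1 = d 1 + d 1\<close>.\<close>

lemma diff_one:
  assumes r: "r \<ge> 1"
  shows "\<one>\<^bsub>Page E r\<^esub> \<in> Cycles E r"
proof -
  interpret bigraded R "Page E r" "Piece E r" by (rule page_bigraded[OF r])
  have one: "\<one>\<^bsub>Page E r\<^esub> \<in> Piece E r (0, 0)" using bigraded unfolding bigraded_algebra_def by blast
  have c: "Diff E r \<one>\<^bsub>Page E r\<^esub> \<in> carrier (Page E r)" using diff_closed[OF r] by simp
  have "Diff E r \<one>\<^bsub>Page E r\<^esub> = Diff E r \<one>\<^bsub>Page E r\<^esub> \<oplus>\<^bsub>Page E r\<^esub> Diff E r \<one>\<^bsub>Page E r\<^esub>"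
    using diff_derivation[OF r one one_closed] c by (simp add: signed_def)
  then have "Diff E r \<one>\<^bsub>Page E r\<^esub> = \<zero>\<^bsub>Page E r\<^esub>"
    using c M.add.l_cancel_one[of "Diff E r \<one>\<^bsub>Page E r\<^esub>" "Diff E r \<one>\<^bsub>Page E r\<^esub>"] by simp
  then show ?thesis unfolding Cycles_def by simp
qed

lemma Rep_one: "r \<ge> 1 \<Longrightarrow> \<one>\<^bsub>Page E 1\<^esub> \<in> Zsub E r \<and> Rep E r \<one>\<^bsub>Page E 1\<^esub> = \<one>\<^bsub>Page E r\<^esub>"
proof (induction r rule: dec_induct)
  case base
  interpret bigraded R "Page E 1" "Piece E 1" by (rule page_bigraded) simp
  show ?case unfolding Zsub_1 Rep_1 by simp
next
  case (step r)
  then show ?case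
    using diff_one[of r] ident_one[of r] by (simp add: Zsub_Suc)
qed

lemma Einf_subquotient_algebra: "subquotient_algebra R (Page E 1) (Zinf E) (Binf E)"
proof -
  interpret S: module_spectral_sequence R E "\<lambda>r. mult (Page E r)" E by (rule self_module)
  interpret bigraded R "Page E 1" "Piece E 1" by (rule page_bigraded) simp
  show ?thesis
    using Einf_subquotient assoc_algebra_axioms S.act_Zinf S.act_Binf_left S.act_Binf_right Rep_one
    by (intro subquotient_algebra.intro subquotient_algebra_axioms.intro) (auto simp: Zinf_def)
qed

lemma inf_act_mult: "inf_act (mult (Page E 1)) E = mult (Einf E)"
  by (intro ext) (simp add: inf_act_def Einf_def subquotient_def rcoset_mult_def)

end

context module_spectral_sequence
begin

lemma inf_act_cosets:
  assumes x: "x \<in> Zinf E" and u: "u \<in> Zinf M"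
  shows "inf_act (act 1) M (Binf E +>\<^bsub>Page E 1\<^esub> x) (Binf M +>\<^bsub>Page M 1\<^esub> u) =
    Binf M +>\<^bsub>Page M 1\<^esub> act 1 x u"
proof -
  interpret QE: subquotient_module R "Page E 1" "Zinf E" "Binf E" by (rule E.Einf_subquotient)
  interpret QM: subquotient_module R "Page M 1" "Zinf M" "Binf M" by (rule M.Einf_subquotient)
  interpret L: left_module R "Page E 1" "act 1" "Page M 1" by (rule page_module) simp
  have rep: "QM.q (act 1 x' u') = QM.q (act 1 x u)" if xu: "x' \<in> QE.q x" "u' \<in> QM.q u" for x' u'
  proof -
    obtain b where b: "b \<in> Binf E" "x' = b \<oplus>\<^bsub>Page E 1\<^esub> x" using xu(1) x QE.coset_mem by auto
    obtain c where c: "c \<in> Binf M" "u' = c \<oplus>\<^bsub>Page M 1\<^esub> u" using xu(2) u QM.coset_mem by auto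
    have u': "u' \<in> Zinf M" using xu(2) u QM.coset_memD by blast
    have "act 1 x' u' = act 1 b u' \<oplus>\<^bsub>Page M 1\<^esub> act 1 x u'"
      unfolding b(2) using b(1) x u' QE.B_closed QE.Z_closed QM.Z_closed by (simp add: L.act_add_left)
    then have "QM.q (act 1 x' u') = QM.q (act 1 x u')"
      using QM.coset_eq_add[OF act_Zinf[OF x u'] act_Binf_left[OF b(1) u']] by simp
    also have "act 1 x u' = act 1 x c \<oplus>\<^bsub>Page M 1\<^esub> act 1 x u"
      unfolding c(2) using c(1) x u QM.B_closed QE.Z_closed QM.Z_closed by (simp add: L.act_add_right)
    then have "QM.q (act 1 x u') = QM.q (act 1 x u)"
      using QM.coset_eq_add[OF act_Zinf[OF x u] act_Binf_right[OF x c(1)]] by simp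
    finally show ?thesis .
  qed
  show ?thesis
    unfolding inf_act_def using QE.coset_self[OF x] QM.coset_self[OF u]
    by (intro SUP_eq_const rep) auto
qed

lemma Einf_left_module: "left_module R (Einf E) (inf_act (act 1) M) (Einf M)"
proof -
  interpret QE: subquotient_algebra R "Page E 1" "Zinf E" "Binf E" by (rule E.Einf_subquotient_algebra)
  interpret QM: subquotient_module R "Page M 1" "Zinf M" "Binf M" by (rule M.Einf_subquotient)
  interpret L: left_module R "Page E 1" "act 1" "Page M 1" by (rule page_module) simp
  have cE: "x \<oplus>\<^bsub>Page E 1\<^esub> y \<in> Zinf E" "a \<odot>\<^bsub>Page E 1\<^esub> x \<in> Zinf E"
    if "x \<in> Zinf E" "y \<in> Zinf E" "a \<in> carrier R" for x y a
    using that QE.submoduleE(4,5)[OF QE.Z] by auto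
  have cM: "x \<oplus>\<^bsub>Page M 1\<^esub> y \<in> Zinf M" "a \<odot>\<^bsub>Page M 1\<^esub> x \<in> Zinf M"
    if "x \<in> Zinf M" "y \<in> Zinf M" "a \<in> carrier R" for x y a
    using that QM.submoduleE(4,5)[OF QM.Z] by auto
  show ?thesis
    unfolding Einf_def
  proof (intro left_module.intro left_module_axioms.intro QE.Q_assoc_algebra QM.Q_module)
    fix X Y U V assume "X \<in> carrier QE.Q" "Y \<in> carrier QE.Q" "U \<in> carrier QM.Q" 
    then obtain x y u where x: "x \<in> Zinf E" "X = QE.q x" "y \<in> Zinf E" "Y = QE.q y"
      and u: "u \<in> Zinf M" "U = QM.q u"
      unfolding QE.Q_carrier QM.Q_carrier by blast
    note c = QE.Z_closed[OF x(1)] QE.Z_closed[OF x(3)] QM.Z_closed[OF u(1)]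
    note z = act_Zinf[OF x(1) u(1)] act_Zinf[OF x(3) u(1)] QE.Z_mult[OF x(1,3)]
      QE.submoduleE(5)[OF QE.Z x(1,3)]
    show "inf_act (act 1) M X U \<in> carrier QM.Q"
      unfolding x u inf_act_cosets[OF x(1) u(1)] QM.Q_carrier using z by blast
    show "inf_act (act 1) M (X \<oplus>\<^bsub>QE.Q\<^esub> Y) U = inf_act (act 1) M X U \<oplus>\<^bsub>QM.Q\<^esub> inf_act (act 1) M Y U"
      unfolding x u using x(1,3) u(1) z c by (simp only: QE.Q_add QM.Q_add inf_act_cosets L.act_add_left)
    show "inf_act (act 1) M (X \<otimes>\<^bsub>QE.Q\<^esub> Y) U = inf_act (act 1) M X (inf_act (act 1) M Y U)"
      unfolding x u using x(1,3) u(1) z c by (simp only: QE.Q_mult inf_act_cosets L.act_mult)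
  next
    fix U assume "U \<in> carrier QM.Q"
    then obtain u where u: "u \<in> Zinf M" "U = QM.q u" unfolding QM.Q_carrier by blast
    show "inf_act (act 1) M \<one>\<^bsub>QE.Q\<^esub> U = U"
      unfolding u using u(1) QM.Z_closed[OF u(1)] QE.Z_one
      by (simp only: QE.Q_one inf_act_cosets L.act_one)
  next
    fix X U V assume "X \<in> carrier QE.Q" "U \<in> carrier QM.Q" "V \<in> carrier QM.Q"
    then obtain x u v where x: "x \<in> Zinf E" "X = QE.q x"
      and u: "u \<in> Zinf M" "U = QM.q u" "v \<in> Zinf M" "V = QM.q v"
      unfolding QE.Q_carrier QM.Q_carrier by blast
    note c = QE.Z_closed[OF x(1)] QM.Z_closed[OF u(1)] QM.Z_closed[OF u(3)]
    note z = act_Zinf[OF x(1) u(1)] act_Zinf[OF x(1) u(3)] QM.submoduleE(5)[OF QM.Z u(1,3)]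
    show "inf_act (act 1) M X (U \<oplus>\<^bsub>QM.Q\<^esub> V) = inf_act (act 1) M X U \<oplus>\<^bsub>QM.Q\<^esub> inf_act (act 1) M X V"
      unfolding x u using x(1) u(1,3) z c by (simp only: QM.Q_add inf_act_cosets L.act_add_right)
  next
    fix a X U assume a: "a \<in> carrier R" and "X \<in> carrier QE.Q" "U \<in> carrier QM.Q"
    then obtain x u where x: "x \<in> Zinf E" "X = QE.q x" and u: "u \<in> Zinf M" "U = QM.q u"
      unfolding QE.Q_carrier QM.Q_carrier by blast
    note c = QE.Z_closed[OF x(1)] QM.Z_closed[OF u(1)]
    note z = act_Zinf[OF x(1) u(1)] cE(2)[OF x(1,1) a] cM(2)[OF u(1,1) a]
    show "inf_act (act 1) M (a \<odot>\<^bsub>QE.Q\<^esub> X) U = a \<odot>\<^bsub>QM.Q\<^esub> inf_act (act 1) M X U"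
      unfolding x u using a x(1) u(1) z c
      by (simp only: QE.Q_smult QM.Q_smult inf_act_cosets L.act_smult_left)
    show "inf_act (act 1) M X (a \<odot>\<^bsub>QM.Q\<^esub> U) = a \<odot>\<^bsub>QM.Q\<^esub> inf_act (act 1) M X U"
      unfolding x u using a x(1) u(1) z c
      by (simp only: QE.Q_smult QM.Q_smult inf_act_cosets L.act_smult_right)
  qed
qed

text \<open>The collapse of \<open>E\<close> enters through \<open>\<Inter>s. Z\<^sub>s E = Z\<^sub>r E\<close>: every element of \<open>S\<close> is represented by a permanent
cycle.  Multiplication by it preserves the permanent cycles of \<open>M\<close>, so that these have a finitely generated image in the
noetherian module \<open>M\<^sub>r\<close>.  Elements of \<open>\<Inter>s. Z\<^sub>s M\<close> with image \<open>0\<close> lie in \<open>B\<^sub>r M\<close>, hence the image maps onto \<open>M\<^sub>\<infinity>\<close>.\<close>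

lemma fg_limit:
  assumes R: "noetherian_ring R" and r: "r \<ge> 1" and coll: "Einf E = subpage E r"
    and S: "finite S" "S \<subseteq> even_central (Page E r) (Piece E r)"
    and fg: "op_fg (scalars R (act r) (Page M r) S) (Page M r) (carrier (Page M r))"
  shows "\<exists>T. finite T \<and> T \<subseteq> carrier (Einf E) \<and>
    (\<forall>t\<in>T. \<forall>x\<in>carrier (Einf E). t \<otimes>\<^bsub>Einf E\<^esub> x = x \<otimes>\<^bsub>Einf E\<^esub> t) \<and>
    op_fg (scalars R (inf_act (act 1) M) (Einf M) T) (Einf M) (carrier (Einf M))"
proof -
  interpret QE: subquotient_algebra R "Page E 1" "Zinf E" "Binf E" by (rule E.Einf_subquotient_algebra)
  interpret QM: subquotient_module R "Page M 1" "Zinf M" "Binf M" by (rule M.Einf_subquotient)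
  interpret A: bigraded R "Page E r" "Piece E r" by (rule E.page_bigraded[OF r])
  interpret L: left_module R "Page E r" "act r" "Page M r" by (rule page_module[OF r])
  interpret L1: left_module R "Page E 1" "act 1" "Page M 1" by (rule page_module) simp
  interpret LI: left_module R "Einf E" "inf_act (act 1) M" "Einf M" by (rule Einf_left_module)
  note Zeq = E.collapse_Zinf[OF r coll]
  have Sc: "S \<subseteq> carrier (Page E r)" using S(2) A.even_central_closed by blast
  have central: "s \<otimes>\<^bsub>Page E r\<^esub> x = x \<otimes>\<^bsub>Page E r\<^esub> s" if "s \<in> S" "x \<in> carrier (Page E r)" for s x
    using S(2) that unfolding even_central_def by blast
  have "\<forall>s\<in>S. \<exists>x\<in>Zinf E. Rep E r x = s"
  proof
    fix s assume "s \<in> S"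
    then have "s \<in> Rep E r ` Zsub E r" unfolding E.Rep_image[OF r] using Sc by blast
    then show "\<exists>x\<in>Zinf E. Rep E r x = s" unfolding Zeq by blast
  qed
  then obtain l where l: "\<And>s. s \<in> S \<Longrightarrow> l s \<in> Zinf E" "\<And>s. s \<in> S \<Longrightarrow> Rep E r (l s) = s" by metis
  define T where "T = (\<lambda>s. QE.q (l s)) ` S"
  have EQ: "carrier (Einf E) = QE.q ` Zinf E" unfolding Einf_def by (rule QE.Q_carrier)
  have MQ: "carrier (Einf M) = QM.q ` Zinf M" unfolding Einf_def by (rule QM.Q_carrier)
  have T: "finite T" "T \<subseteq> carrier (Einf E)" unfolding T_def EQ using S(1) l(1) by auto
  have Tcentral: "t \<otimes>\<^bsub>Einf E\<^esub> y = y \<otimes>\<^bsub>Einf E\<^esub> t" if t: "t \<in> T" and y: "y \<in> carrier (Einf E)" for t y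
  proof -
    obtain s where s: "s \<in> S" "t = QE.q (l s)" using t unfolding T_def by blast
    obtain x where x: "x \<in> Zinf E" "y = QE.q x" using y unfolding EQ by blast
    have Zr: "l s \<in> Zsub E r" "x \<in> Zsub E r" using l(1)[OF s(1)] x(1) E.Zinf_Zsub[OF r] by auto
    interpret S: module_spectral_sequence R E "\<lambda>r. mult (Page E r)" E by (rule E.self_module)
    have "Rep E r (l s \<otimes>\<^bsub>Page E 1\<^esub> x) = Rep E r (x \<otimes>\<^bsub>Page E 1\<^esub> l s)"
      using S.Rep_act[OF r Zr] S.Rep_act[OF r Zr(2,1)] central[OF s(1) E.Rep_closed[OF r Zr(2)]]
        l(2)[OF s(1)] by simp
    then have "QE.q (l s \<otimes>\<^bsub>Page E 1\<^esub> x) = QE.q (x \<otimes>\<^bsub>Page E 1\<^esub> l s)"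
      using l(1)[OF s(1)] x(1) QE.Z_mult by (intro E.coset_eq_if_Rep_eq[OF r]) auto
    then show ?thesis
      unfolding s(2) x(2) Einf_def using QE.Q_mult[OF l(1)[OF s(1)] x(1)] QE.Q_mult[OF x(1) l(1)[OF s(1)]]
      by simp
  qed
  have noeth: "noetherian_on (scalars R (act r) (Page M r) S) (Page M r) (carrier (Page M r))"
    using central Sc by (intro L.noetherian_on_carrier[OF R S(1) Sc _ fg]) blast
  have Rmem: "Rep M r u \<in> carrier (Page M r)" if "u \<in> Zinf M" for u
    using that M.Zinf_Zsub[OF r] M.Rep_closed[OF r] by blast
  have radd: "Rep M r (u \<oplus>\<^bsub>Page M 1\<^esub> v) = Rep M r u \<oplus>\<^bsub>Page M r\<^esub> Rep M r v"
    if "u \<in> Zinf M" "v \<in> Zinf M" for u v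
    using that M.Zinf_Zsub[OF r] M.Rep_add[OF r] by blast
  have rsm: "Rep M r (a \<odot>\<^bsub>Page M 1\<^esub> u) = a \<odot>\<^bsub>Page M r\<^esub> Rep M r u"
    if "u \<in> Zinf M" "a \<in> carrier R" for u a
    using that M.Zinf_Zsub[OF r] M.Rep_smult[OF r] by blast
  have ract: "Rep M r (act 1 (l s) u) = act r s (Rep M r u)" if "s \<in> S" "u \<in> Zinf M" for s u
    using Rep_act[OF r, of "l s" u] l that E.Zinf_Zsub[OF r] M.Zinf_Zsub[OF r] by auto
  note ZM = QM.submoduleE[OF QM.Z]
  have "op_stable (scalars R (act r) (Page M r) S) (Page M r) (Rep M r ` Zinf M)"
  proof (rule stable_subgroupI)
    show "abelian_group (Page M r)" by (rule M.page_group[OF r])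
    show "Rep M r ` Zinf M \<subseteq> carrier (Page M r)" using Rmem by blast
    show "\<zero>\<^bsub>Page M r\<^esub> \<in> Rep M r ` Zinf M"
      using M.Rep_zero[OF r] additive_subgroup.zero_closed[OF QM.Z_subgroup] by (metis imageI)
    fix y assume "y \<in> Rep M r ` Zinf M"
    then obtain u where u: "u \<in> Zinf M" "y = Rep M r u" by blast
    show "\<ominus>\<^bsub>Page M r\<^esub> y \<in> Rep M r ` Zinf M"
      using M.Rep_uminus[OF r, of u] u M.Zinf_Zsub[OF r] ZM(3)[OF u(1)] by (metis imageI subsetD)
    { fix z assume "z \<in> Rep M r ` Zinf M"
      then obtain v where v: "v \<in> Zinf M" "z = Rep M r v" by blast
      show "y \<oplus>\<^bsub>Page M r\<^esub> z \<in> Rep M r ` Zinf M"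
        unfolding u(2) v(2) radd[OF u(1) v(1), symmetric] using ZM(5)[OF u(1) v(1)] by blast }
    { fix f assume "f \<in> scalars R (act r) (Page M r) S"
      then consider a where "a \<in> carrier R" "f = (\<lambda>x. a \<odot>\<^bsub>Page M r\<^esub> x)" | s where "s \<in> S" "f = act r s"
        by blast
      then show "f y \<in> Rep M r ` Zinf M"
      proof cases
        case 1
        then show ?thesis unfolding u(2) using rsm[OF u(1)] ZM(4)[OF _ u(1)] by (metis imageI)
      next
        case 2
        then show ?thesis unfolding u(2) using ract[OF _ u(1)] act_Zinf[OF l(1) u(1)] by (metis imageI)
      qed }
  qed
  then have fgZ: "op_fg (scalars R (act r) (Page M r) S) (Page M r) (Rep M r ` Zinf M)"
    using noeth Rmem unfolding noetherian_on_def by blast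
  have og: "operator_group (Einf M) (scalars R (inf_act (act 1) M) (Einf M) T)"
    by (rule LI.scalars_operator_group[OF T(2)])
  have "op_fg (scalars R (inf_act (act 1) M) (Einf M) T) (Einf M) (QM.q ` Zinf M)"
  proof (rule fg_transfer[OF M.page_group[of 1] L.scalars_operator_group[OF Sc] og QM.Z_subgroup, where p = "Rep M r"])
    show "QM.q (u \<oplus>\<^bsub>Page M 1\<^esub> v) = QM.q u \<oplus>\<^bsub>Einf M\<^esub> QM.q v" if "u \<in> Zinf M" "v \<in> Zinf M" for u v
      using QM.Q_add[OF that] unfolding Einf_def by simp
    show "QM.q u = \<zero>\<^bsub>Einf M\<^esub>" if "u \<in> Zinf M" "Rep M r u = \<zero>\<^bsub>Page M r\<^esub>" for u
    proof -
      have "u \<in> Bsub M r" using that M.Zinf_Zsub[OF r] unfolding Bsub_def by blast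
      then show ?thesis using M.Bsub_Binf[OF r] QM.Q_eq_zero[OF that(1)] unfolding Einf_def by blast
    qed
    show "op_stable (scalars R (inf_act (act 1) M) (Einf M) T) (Einf M) (QM.q ` Zinf M)"
      unfolding MQ[symmetric]
      using operator_group.op_closed[OF og] LI.M.abelian_group_axioms
      by (intro stable_subgroupI) auto
    fix f assume "f \<in> scalars R (act r) (Page M r) S"
    then consider a where "a \<in> carrier R" "f = (\<lambda>x. a \<odot>\<^bsub>Page M r\<^esub> x)" | s where "s \<in> S" "f = act r s"
      by blast
    then show "\<exists>g\<in>scalars R (inf_act (act 1) M) (Einf M) T. \<exists>h. \<forall>u\<in>Zinf M.
        h u \<in> Zinf M \<and> Rep M r (h u) = f (Rep M r u) \<and> QM.q (h u) = g (QM.q u)"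
    proof cases
      case 1
      then show ?thesis
        using ZM(4) rsm QM.Q_smult[OF 1(1)] unfolding Einf_def[of M]
        by (intro bexI[of _ "\<lambda>x. a \<odot>\<^bsub>QM.Q\<^esub> x"] exI[of _ "\<lambda>u. a \<odot>\<^bsub>Page M 1\<^esub> u"]) auto
    next
      case 2
      then show ?thesis
        using act_Zinf[OF l(1)] ract inf_act_cosets[OF l(1)] unfolding T_def
        by (intro bexI[of _ "inf_act (act 1) M (QE.q (l s))"] exI[of _ "act 1 (l s)"]) auto
    qed
  qed (use fgZ Rmem radd in auto)
  then have fg_T: "op_fg (scalars R (inf_act (act 1) M) (Einf M) T) (Einf M) (carrier (Einf M))"
    unfolding MQ .
  show ?thesis by (intro exI[of _ T] conjI ballI T fg_T Tcentral)
qed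

lemma fg_over_limit:
  assumes "T \<subseteq> carrier (Einf E)"
    and fg: "op_fg (scalars R (inf_act (act 1) M) (Einf M) T) (Einf M) (carrier (Einf M))"
  shows "finitely_generated_over R (Einf E) (inf_act (act 1) M) (Einf M)"
proof -
  interpret LI: left_module R "Einf E" "inf_act (act 1) M" "Einf M" by (rule Einf_left_module)
  have LM: "abelian_group (Einf M)" ..
  let ?act = "inf_act (act 1) M"
  obtain F where F: "F \<subseteq> carrier (Einf M)" "finite F" "carrier (Einf M) = op_span (scalars R ?act (Einf M) T) (Einf M) F"
    using fg unfolding finitely_generated_def by auto
  have st: "stable_subgroup (carrier (Einf E)) ?act (Einf M) (generated (carrier (Einf E)) ?act (Einf M) F)"
    (is "stable_subgroup _ _ _ ?N")
    using F(1) LM LI.act_closed by (intro generated_stable) auto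
  have "op_stable (scalars R ?act (Einf M) T) (Einf M) ?N"
  proof (rule stable_subgroupI[OF LM stable_subset[OF st] stable_zero[OF st] stable_add[OF st]
        stable_uminus[OF st LM]], assumption+)
    fix f x assume f: "f \<in> scalars R ?act (Einf M) T" and x: "x \<in> ?N"
    have xc: "x \<in> carrier (Einf M)" using stable_subset[OF st] x by blast
    consider a where "a \<in> carrier R" "f = (\<lambda>x. a \<odot>\<^bsub>Einf M\<^esub> x)" | t where "t \<in> T" "f = ?act t"
      using f by blast
    then show "f x \<in> ?N"
    proof cases
      case 1
      have "?act (a \<odot>\<^bsub>Einf E\<^esub> \<one>\<^bsub>Einf E\<^esub>) x = a \<odot>\<^bsub>Einf M\<^esub> x"
        using 1 xc by (simp add: LI.act_smult_left LI.act_one)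
      then show ?thesis
        using stable_act[OF st _ x, of "a \<odot>\<^bsub>Einf E\<^esub> \<one>\<^bsub>Einf E\<^esub>"] 1 by simp
    next
      case 2
      then show ?thesis using stable_act[OF st _ x, of t] assms(1) by blast
    qed
  qed
  then have "carrier (Einf M) \<subseteq> ?N"
    by (subst F(3)) (rule generated_minimal[OF _ generated_superset])
  then have "carrier (Einf M) = ?N" using stable_subset[OF st] by blast
  then show ?thesis
    unfolding finitely_generated_over_def finitely_generated_def
    using F LI.left_module_axioms by blast
qed

end

section \<open>Finiteness of the limit page\<close>

theorem lemma4p8:
  fixes R :: "'r ring" and m :: nat
    and E :: "('r, 'a) spectral_seq" and H :: "('r, 'h) abutment"
    and gr_iso :: "int \<times> int \<Rightarrow> 'h set \<Rightarrow> 'a set"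
    and r\<^sub>0 r\<^sub>1 :: nat
  assumes "cring R" and "noetherian_ring R" and "has_char R m" and "m > 0"
    and "multiplicative_spectral_sequence R E"
    and "converges_multiplicatively_to R E H gr_iso"
    and "in_half_plane E"
    and "r\<^sub>0 \<ge> 1"
    and "finitely_generated (graded_center R (Page E r\<^sub>0) (Piece E r\<^sub>0))
           (\<lambda>c x. c \<otimes>\<^bsub>Page E r\<^sub>0\<^esub> x) (Page E r\<^sub>0) (carrier (Page E r\<^sub>0))"
    and "noetherian_algebra R (Page E r\<^sub>0)"
    and "r\<^sub>1 \<ge> r\<^sub>0" and "collapses_at E r\<^sub>1"
  shows "noetherian_algebra R (Einf E) \<and>
    (\<forall>(M :: ('r, 'b) spectral_seq) act (K :: ('r, 'k) abutment) gr_iso'.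
       module_spectral_sequence R E act M \<and>
       converges_to R M K gr_iso' \<and>
       finitely_generated_over R (Page E r\<^sub>0) (act r\<^sub>0) (Page M r\<^sub>0) \<longrightarrow>
       finitely_generated_over R (Einf E) (inf_act (act 1) M) (Einf M))"
proof -
  interpret E: multiplicative_spectral_sequence R E by fact
  interpret A: bigraded R "Page E r\<^sub>0" "Piece E r\<^sub>0" by (rule E.page_bigraded) fact
  have m: "[m] \<cdot>\<^bsub>R\<^esub> \<one>\<^bsub>R\<^esub> = \<zero>\<^bsub>R\<^esub>" "m > 0" using assms(3,4) unfolding has_char_def by auto
  have r1: "r\<^sub>1 \<ge> 1" using assms(8,11) by simp
  have coll: "Einf E = subpage E r\<^sub>1" using assms(12) unfolding collapses_at_def by blast
  obtain S where S: "finite S" "S \<subseteq> even_central (Page E r\<^sub>0) (Piece E r\<^sub>0)"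
    "op_fg (scalars R (mult (Page E r\<^sub>0)) (Page E r\<^sub>0) S) (Page E r\<^sub>0) (carrier (Page E r\<^sub>0))"
    using A.finite_over_even_central assms(9,10) unfolding noetherian_algebra_def by blast
  \<comment> \<open>Both conclusions follow from this: the first with \<open>M = E\<close>, the second with the given \<open>M\<close>.\<close>
  have limit: "\<exists>T. finite T \<and> T \<subseteq> carrier (Einf E) \<and>
      (\<forall>t\<in>T. \<forall>x\<in>carrier (Einf E). t \<otimes>\<^bsub>Einf E\<^esub> x = x \<otimes>\<^bsub>Einf E\<^esub> t) \<and>
      op_fg (scalars R (inf_act (act 1) M) (Einf M) T) (Einf M) (carrier (Einf M))"
    if ms: "module_spectral_sequence R E act M"
      and fg: "op_fg (scalars R (act r\<^sub>0) (Page M r\<^sub>0) S) (Page M r\<^sub>0) (carrier (Page M r\<^sub>0))"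
    for act and M :: "('r, 'c) spectral_seq"
  proof -
    interpret module_spectral_sequence R E act M by fact
    obtain S1 where "finite S1" "S1 \<subseteq> even_central (Page E r\<^sub>1) (Piece E r\<^sub>1)"
      "op_fg (scalars R (act r\<^sub>1) (Page M r\<^sub>1) S1) (Page M r\<^sub>1) (carrier (Page M r\<^sub>1))"
      using fg_later_page[OF assms(2,8) m S fg assms(11)] by blast
    then show ?thesis by (rule fg_limit[OF assms(2) r1 coll])
  qed
  obtain T where T: "finite T" "T \<subseteq> carrier (Einf E)"
    "\<And>t x. \<lbrakk>t \<in> T; x \<in> carrier (Einf E)\<rbrakk> \<Longrightarrow> t \<otimes>\<^bsub>Einf E\<^esub> x = x \<otimes>\<^bsub>Einf E\<^esub> t"
    "op_fg (scalars R (mult (Einf E)) (Einf E) T) (Einf E) (carrier (Einf E))"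
    using limit[OF E.self_module S(3)] unfolding E.inf_act_mult by blast
  have "assoc_algebra R (Einf E)"
    using subquotient_algebra.Q_assoc_algebra[OF E.Einf_subquotient_algebra] unfolding Einf_def .
  then have "noetherian_algebra R (Einf E)"
    using assms(2) T by (rule noetherian_algebra_if_finite_over_central)
  moreover have "finitely_generated_over R (Einf E) (inf_act (act 1) M) (Einf M)"
    if ms: "module_spectral_sequence R E act M"
      and fg: "finitely_generated_over R (Page E r\<^sub>0) (act r\<^sub>0) (Page M r\<^sub>0)"
    for M :: "('r, 'b) spectral_seq" and act
  proof -
    interpret module_spectral_sequence R E act M by fact
    interpret L: left_module R "Page E r\<^sub>0" "act r\<^sub>0" "Page M r\<^sub>0" by (rule page_module) fact
    have "S \<subseteq> carrier (Page E r\<^sub>0)" using S(2) A.even_central_closed by blast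
    then have "op_fg (scalars R (act r\<^sub>0) (Page M r\<^sub>0) S) (Page M r\<^sub>0) (carrier (Page M r\<^sub>0))"
      using S(3) fg unfolding finitely_generated_over_def by (intro L.fg_over_scalars) auto
    then show ?thesis using limit[OF ms] fg_over_limit by blast
  qed
  ultimately show ?thesis by blast
qed

end
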